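(* Let $X$ be an affine process relative to its natural filtration $(\mathcal F_t^0)$. Then there exists a process $\widetilde X$ such that, for each $x\in D_\Delta$, $\widetilde X$ is a $\mathbb P_x$-version of $X$ which is an affine process relative to $(\mathcal F_t^x)$, whose paths are càdlàg and satisfy, $\mathbb P_x$-a.s., $\widetilde X_t=\Delta$ for $t\ge s$ whenever $\|\widetilde X_{s-}\|=\infty$ or $\|\widetilde X_s\|=\infty$.
   Context: Spaces. $V$ is an $n$-dimensional real vector space with scalar product $\langle\cdot,\cdot\rangle$ and norm $\|\cdot\|$; $\langle\cdot,\cdot\rangle$ is extended bilinearly (without complex conjugation) to $V+\mathrm iV$. The state space $D\subseteq V$ is closed, non-empty and contains $n+1$ affinely independent elements; $\mathcal D$ is its Borel $\sigma$-algebra. $\Delta\notin D$ is a cemetery state, $D_\Delta=D\cup\{\Delta\}$, $\mathcal D_\Delta=\sigma(\mathcal D,\{\Delta\})$, with the conventions $\|\Delta\|=\infty$ and $f(\Delta)=0$ for any other function $f$ on $D$. If $D$ is non-compact, paths may have the "point at infinity" $\infty$ of the one-point compactification $D_\Delta\cup\{\infty\}$ of $D_\Delta$ as a limiting value ($\|\infty\|=\infty$); the point $\infty$ is then identified with $\Delta$. $\mathbb R_+=[0,\infty)$. Put $\mathcal U=\{u\in V+\mathrm iV: x\mapsto e^{\langle u,x\rangle}\text{ is bounded on }D\}$ and $\mathcal U^m=\{u\in V+\mathrm iV:\sup_{x\in D}e^{\langle\mathrm{Re}\,u,x\rangle}\le m\}$, $m\ge1$. Markov processes. $X=(X_t)_{t\ge0}$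 is a $D_\Delta$-valued process on a space $\Omega$ such that $X_s(\omega)=\Delta$ implies $X_t(\omega)=\Delta$ for $t\ge s$; $\mathcal F_t^0=\sigma(X_s,s\le t)$, $\mathcal F^0=\bigvee_t\mathcal F_t^0$; $(\mathbb P_x)_{x\in D_\Delta}$ are probability measures on $(\Omega,\mathcal F^0)$. $X$ is a time-homogeneous Markov process relative to a filtration $(\mathcal F_t)$ with $\mathcal F_t\supseteq\mathcal F_t^0$ if $\mathbb E_x[f(X_{t+s})|\mathcal F_s]=\mathbb E_{X_s}[f(X_t)]=\int_D f(\xi)p_t(X_s,d\xi)$ $\mathbb P_x$-a.s. for all $s,t\ge0$, $x\in D_\Delta$ and bounded measurable $f:D_\Delta\to\mathbb R$, where $(p_t)$ is a transition function: kernels $p_t:D_\Delta\times\mathcal D_\Delta\to[0,1]$ such that $p_t(x,\cdot)$ is a measure with $p_t(x,D)\le1$, $p_t(x,\{\Delta\})=1-p_t(x,D)$, $p_t(\Delta,\{\Delta\})=1$, $p_0(x,\cdot)=\delta_x$, $x\mapsto p_t(x,\Gamma)$ is measurable, and the Chapman–Kolmogorov equation holds. Affine processes. Such an $X$ is affine if (1) it is stochastically continuous: $\lim_{s\to t}p_s(x,\cdot)=p_t(x,\cdot)$ weakly on $D$ for all $t\ge0$, $x\in D$; (2) there are functions $\Phi:\mathbb R_+\times\mathcal U\to\mathbb C$, $\psi:\mathbb R_+\times\mathcal U\to V+\mathrm iV$ such that for every $x\in D$, $m\ge1$ the map $(t,u)\mapsto\langle\psi(t,u),x\rangle$ is locally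 continuous on the subset of $\mathbb R_+\times\mathcal U^m$ where $\Phi$ does not vanish, denoted $\mathcal Q^m=\{(t,u)\in\mathbb R_+\times\mathcal U^m:\Phi(s,u)\ne0\ \forall s\in[0,t]\}$, and $\mathbb E_x[e^{\langle u,X_t\rangle}]=\int_De^{\langle u,\xi\rangle}p_t(x,d\xi)=\Phi(t,u)e^{\langle\psi(t,u),x\rangle}$ for all $x\in D$, $(t,u)\in\mathbb R_+\times\mathcal U$. Augmentation and versions. $\mathcal F^x$ is the completion of $\mathcal F^0$ with respect to $\mathbb P_x$, and $\mathcal F_t^x=\sigma(\mathcal F_t^0,\mathcal N(\mathcal F^x))$ with $\mathcal N(\mathcal F^x)$ the $\mathbb P_x$-null sets in $\mathcal F^x$. $\widetilde X$ is a $\mathbb P_x$-version of $X$ if $\mathbb P_x[\widetilde X_t=X_t]=1$ for every $t\ge0$. *)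

theory Defs
  imports "HOL-Probability.Probability"
begin

section \<open>The state space with cemetery\<close>

text \<open>The cemetery \<open>\<Delta>\<close> is \<^term>\<open>None\<close>. A function \<open>f\<close> on \<open>D\<close> is extended by
  \<open>f(\<Delta>) = 0\<close>, i.e. to \<^term>\<open>case_option 0 f\<close>.\<close>

definition state_cem :: "'v set \<Rightarrow> 'v option set" where
  "state_cem D = insert None (Some ` D)"

definition state_algebra :: "'v::euclidean_space set \<Rightarrow> 'v option measure" where
  "state_algebra D =
     sigma (state_cem D) ({Some ` A | A. A \<in> sets (restrict_space borel D)} \<union> {{None}})"

text \<open>In \<open>D \<union> {\<Delta>}\<close> the cemetery is an isolated point.\<close>

definition cem_topology :: "'v::euclidean_space set \<Rightarrow> 'v option topology" where
  "cem_topology D =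
     topology (\<lambda>U. U \<subseteq> state_cem D \<and> openin (top_of_set D) {x. Some x \<in> U})"

lemma istopology_cem:
  fixes D :: "'v::euclidean_space set"
  shows "istopology (\<lambda>U. U \<subseteq> state_cem D \<and> openin (top_of_set D) {x. Some x \<in> U})"
  unfolding istopology_def
proof safe
  fix S T :: "'v option set"
  assume "openin (top_of_set D) {x. Some x \<in> S}" "openin (top_of_set D) {x. Some x \<in> T}"
  then have "openin (top_of_set D) ({x. Some x \<in> S} \<inter> {x. Some x \<in> T})"
    by (rule openin_Int)
  then show "openin (top_of_set D) {x. Some x \<in> S \<inter> T}"
    by (simp add: Collect_conj_eq)
next
  fix K :: "'v option set set"
  assume "\<forall>S\<in>K. S \<subseteq> state_cem D \<and> openin (top_of_set D) {x. Some x \<in> S}"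
  then have "openin (top_of_set D) (\<Union>S\<in>K. {x. Some x \<in> S})"
    by (intro openin_Union) auto
  moreover have "{x. Some x \<in> \<Union>K} = (\<Union>S\<in>K. {x. Some x \<in> S})"
    by auto
  ultimately show "openin (top_of_set D) {x. Some x \<in> \<Union>K}"
    by simp
qed blast+

lemma openin_cem_topology:
  "openin (cem_topology D) U \<longleftrightarrow> U \<subseteq> state_cem D \<and> openin (top_of_set D) {x. Some x \<in> U}"
  by (simp add: cem_topology_def topology_inverse'[OF istopology_cem])

text \<open>The one-point compactification of \<open>D \<union> {\<Delta>}\<close> has the points \<^term>\<open>None\<close> (this is
  \<open>\<infinity>\<close>), \<^term>\<open>Some None\<close> (this is \<open>\<Delta>\<close>) and \<^term>\<open>Some (Some x)\<close> for \<open>x\<close> in \<open>D\<close>.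
  If \<open>D\<close> is compact, the library construction adds \<open>\<infinity>\<close> as an isolated point, which is then
  never a limit of a path in \<open>D \<union> {\<Delta>}\<close>.\<close>

abbreviation compact_cem :: "'v::euclidean_space set \<Rightarrow> 'v option option topology" where
  "compact_cem D \<equiv> Alexandroff_compactification (cem_topology D)"

fun ext_norm :: "'v::euclidean_space option option \<Rightarrow> ereal" where
  "ext_norm None = \<infinity>"
| "ext_norm (Some None) = \<infinity>"
| "ext_norm (Some (Some x)) = ereal (norm x)"

section \<open>Exponentials\<close>

text \<open>The complexification \<open>V + iV\<close> is the product \<^typ>\<open>'v \<times> 'v\<close>, the pair \<open>(a, b)\<close>
  standing for \<open>a + ib\<close>. The bilinear extension of the scalar product is only needed with
  second argument in \<open>V\<close>.\<close>

definition cpair :: "'v::euclidean_space \<times> 'v \<Rightarrow> 'v \<Rightarrow> complex" where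
  "cpair u x = Complex (fst u \<bullet> x) (snd u \<bullet> x)"

definition exp_fun :: "'v::euclidean_space \<times> 'v \<Rightarrow> 'v option \<Rightarrow> complex" where
  "exp_fun u = case_option 0 (\<lambda>x. exp (cpair u x))"

definition bdd_exponents :: "'v::euclidean_space set \<Rightarrow> ('v \<times> 'v) set" where
  "bdd_exponents D = {u. bounded ((\<lambda>x. exp (cpair u x)) ` D)}"

definition bdd_exponents_by :: "'v::euclidean_space set \<Rightarrow> real \<Rightarrow> ('v \<times> 'v) set" where
  "bdd_exponents_by D m = {u. \<forall>x\<in>D. exp (fst u \<bullet> x) \<le> m}"

section \<open>Markov processes\<close>

text \<open>Time is \<open>[0, \<infinity>)\<close>; families indexed by \<^typ>\<open>real\<close> are only constrained there.\<close>

definition transition_function ::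
    "'v::euclidean_space set \<Rightarrow> (real \<Rightarrow> 'v option \<Rightarrow> 'v option measure) \<Rightarrow> bool" where
  "transition_function D p \<longleftrightarrow>
     (\<forall>t\<ge>0. \<forall>x\<in>state_cem D.
        sets (p t x) = sets (state_algebra D) \<and>
        emeasure (p t x) (Some ` D) \<le> 1 \<and>
        emeasure (p t x) {None} = 1 - emeasure (p t x) (Some ` D)) \<and>
     (\<forall>t\<ge>0. emeasure (p t None) {None} = 1) \<and>
     (\<forall>x\<in>state_cem D. p 0 x = return (state_algebra D) x) \<and>
     (\<forall>t\<ge>0. \<forall>\<Gamma>\<in>sets (state_algebra D).
        (\<lambda>x. emeasure (p t x) \<Gamma>) \<in> borel_measurable (state_algebra D)) \<and>
     (\<forall>s\<ge>0. \<forall>t\<ge>0. \<forall>x\<in>state_cem D. \<forall>\<Gamma>\<in>sets (state_algebra D).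
        emeasure (p (s + t) x) \<Gamma> = (\<integral>\<^sup>+\<xi>. emeasure (p t \<xi>) \<Gamma> \<partial>p s x))"

definition natural_filtration ::
    "'v::euclidean_space set \<Rightarrow> 'w set \<Rightarrow> (real \<Rightarrow> 'w \<Rightarrow> 'v option) \<Rightarrow> real \<Rightarrow> 'w measure" where
  "natural_filtration D \<Omega> X t =
     sigma \<Omega> {X s -` A \<inter> \<Omega> | s A. 0 \<le> s \<and> s \<le> t \<and> A \<in> sets (state_algebra D)}"

definition natural_algebra ::
    "'v::euclidean_space set \<Rightarrow> 'w set \<Rightarrow> (real \<Rightarrow> 'w \<Rightarrow> 'v option) \<Rightarrow> 'w measure" where
  "natural_algebra D \<Omega> X = sigma \<Omega> (\<Union>t\<in>{0..}. sets (natural_filtration D \<Omega> X t))"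

text \<open>For a probability measure \<open>M\<close> on the \<open>\<sigma>\<close>-algebra generated by \<open>X\<close>.\<close>

definition augmented_filtration ::
    "'v::euclidean_space set \<Rightarrow> 'w set \<Rightarrow> (real \<Rightarrow> 'w \<Rightarrow> 'v option) \<Rightarrow> 'w measure \<Rightarrow>
     real \<Rightarrow> 'w measure" where
  "augmented_filtration D \<Omega> X M t =
     sigma \<Omega> (sets (natural_filtration D \<Omega> X t) \<union> null_sets (completion M))"

definition cemetery_process ::
    "'v::euclidean_space set \<Rightarrow> 'w set \<Rightarrow> (real \<Rightarrow> 'w \<Rightarrow> 'v option) \<Rightarrow> bool" where
  "cemetery_process D \<Omega> X \<longleftrightarrow>
     (\<forall>t\<ge>0. \<forall>\<omega>\<in>\<Omega>. X t \<omega> \<in> state_cem D) \<and>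
     (\<forall>s\<ge>0. \<forall>t\<ge>s. \<forall>\<omega>\<in>\<Omega>. X s \<omega> = None \<longrightarrow> X t \<omega> = None)"

text \<open>The filtration \<open>F x\<close> used under \<open>P x\<close> may depend on \<open>x\<close>, as it does for the
  augmented filtrations; for an ordinary filtration \<open>F\<close> is constant in \<open>x\<close>. The test
  functions satisfy the convention \<open>f(\<Delta>) = 0\<close>.\<close>

definition markov_process ::
    "'v::euclidean_space set \<Rightarrow> 'w set \<Rightarrow> ('v option \<Rightarrow> 'w measure) \<Rightarrow>
     ('v option \<Rightarrow> real \<Rightarrow> 'w measure) \<Rightarrow> (real \<Rightarrow> 'v option \<Rightarrow> 'v option measure) \<Rightarrow>
     (real \<Rightarrow> 'w \<Rightarrow> 'v option) \<Rightarrow> bool" where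
  "markov_process D \<Omega> P F p X \<longleftrightarrow>
     cemetery_process D \<Omega> X \<and>
     transition_function D p \<and>
     (\<forall>x\<in>state_cem D. prob_space (P x) \<and> space (P x) = \<Omega>) \<and>
     (\<forall>x\<in>state_cem D. \<forall>t\<ge>0.
        subalgebra (P x) (F x t) \<and>
        sets (natural_filtration D \<Omega> X t) \<subseteq> sets (F x t) \<and>
        (\<forall>s\<in>{0..t}. sets (F x s) \<subseteq> sets (F x t))) \<and>
     (\<forall>s\<ge>0. \<forall>t\<ge>0. \<forall>x\<in>state_cem D. \<forall>f\<in>borel_measurable (state_algebra D).
        bounded (f ` state_cem D) \<and> f None = 0 \<longrightarrow>
        (AE \<omega> in P x.
           real_cond_exp (P x) (F x s) (\<lambda>\<omega>'. f (X (t + s) \<omega>')) \<omega>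
             = (LINT \<omega>'|P (X s \<omega>). f (X t \<omega>')) \<and>
           (LINT \<omega>'|P (X s \<omega>). f (X t \<omega>'))
             = (LINT \<xi>:Some ` D|p t (X s \<omega>). (f \<xi> :: real))))"

section \<open>Affine processes\<close>

definition stochastically_continuous ::
    "'v::euclidean_space set \<Rightarrow> (real \<Rightarrow> 'v option \<Rightarrow> 'v option measure) \<Rightarrow> bool" where
  "stochastically_continuous D p \<longleftrightarrow>
     (\<forall>t\<ge>0. \<forall>x\<in>D. \<forall>f::'v \<Rightarrow> real. continuous_on D f \<and> bounded (f ` D) \<longrightarrow>
        ((\<lambda>s. LINT \<xi>:Some ` D|p s (Some x). case_option 0 f \<xi>)
           \<longlongrightarrow> (LINT \<xi>:Some ` D|p t (Some x). case_option 0 f \<xi>)) (at t within {0..}))"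

definition locally_continuous_on ::
    "'a::topological_space set \<Rightarrow> ('a \<Rightarrow> 'b::topological_space) \<Rightarrow> bool" where
  "locally_continuous_on S f \<longleftrightarrow>
     (\<forall>q\<in>S. \<exists>U. open U \<and> q \<in> U \<and> continuous_on (S \<inter> U) f)"

definition nonvanishing_set ::
    "'v::euclidean_space set \<Rightarrow> (real \<Rightarrow> 'v \<times> 'v \<Rightarrow> complex) \<Rightarrow> real \<Rightarrow> (real \<times> 'v \<times> 'v) set" where
  "nonvanishing_set D \<Phi> m =
     {(t, u). 0 \<le> t \<and> u \<in> bdd_exponents_by D m \<and> (\<forall>s\<in>{0..t}. \<Phi> s u \<noteq> 0)}"

definition affine_transform ::
    "'v::euclidean_space set \<Rightarrow> ('v option \<Rightarrow> 'w measure) \<Rightarrow>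
     (real \<Rightarrow> 'v option \<Rightarrow> 'v option measure) \<Rightarrow> (real \<Rightarrow> 'w \<Rightarrow> 'v option) \<Rightarrow> bool" where
  "affine_transform D P p X \<longleftrightarrow>
     (\<exists>(\<Phi> :: real \<Rightarrow> 'v \<times> 'v \<Rightarrow> complex) (\<psi> :: real \<Rightarrow> 'v \<times> 'v \<Rightarrow> 'v \<times> 'v).
        (\<forall>x\<in>D. \<forall>m\<ge>1. locally_continuous_on (nonvanishing_set D \<Phi> m) (\<lambda>(t, u). cpair (\<psi> t u) x)) \<and>
        (\<forall>x\<in>D. \<forall>t\<ge>0. \<forall>u\<in>bdd_exponents D.
           (LINT \<omega>|P (Some x). exp_fun u (X t \<omega>))
             = (LINT \<xi>:Some ` D|p t (Some x). exp_fun u \<xi>) \<and>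
           (LINT \<xi>:Some ` D|p t (Some x). exp_fun u \<xi>)
             = \<Phi> t u * exp (cpair (\<psi> t u) x)))"

definition affine_process ::
    "'v::euclidean_space set \<Rightarrow> 'w set \<Rightarrow> ('v option \<Rightarrow> 'w measure) \<Rightarrow>
     ('v option \<Rightarrow> real \<Rightarrow> 'w measure) \<Rightarrow> (real \<Rightarrow> 'w \<Rightarrow> 'v option) \<Rightarrow> bool" where
  "affine_process D \<Omega> P F X \<longleftrightarrow>
     (\<exists>p. markov_process D \<Omega> P F p X \<and>
          stochastically_continuous D p \<and>
          affine_transform D P p X)"

section \<open>Path properties\<close>

definition version_of ::
    "'w measure \<Rightarrow> (real \<Rightarrow> 'w \<Rightarrow> 'v option) \<Rightarrow> (real \<Rightarrow> 'w \<Rightarrow> 'v option) \<Rightarrow> bool" where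
  "version_of M Y X \<longleftrightarrow> (\<forall>t\<ge>0. AE \<omega> in M. Y t \<omega> = X t \<omega>)"

definition left_limit ::
    "'v::euclidean_space set \<Rightarrow> (real \<Rightarrow> 'v option) \<Rightarrow> real \<Rightarrow> 'v option option \<Rightarrow> bool" where
  "left_limit D \<gamma> s l \<longleftrightarrow> limitin (compact_cem D) (\<lambda>t. Some (\<gamma> t)) l (at_left s)"

definition cadlag :: "'v::euclidean_space set \<Rightarrow> (real \<Rightarrow> 'v option) \<Rightarrow> bool" where
  "cadlag D \<gamma> \<longleftrightarrow>
     (\<forall>s\<ge>0. limitin (compact_cem D) (\<lambda>t. Some (\<gamma> t)) (Some (\<gamma> s)) (at_right s)) \<and>
     (\<forall>s>0. \<exists>l. left_limit D \<gamma> s l)"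

text \<open>The left limit at \<open>s\<close> is unique, as the compactification of the closed set \<open>D\<close> with the
  added isolated point is Hausdorff.\<close>

definition killed_at_infinity :: "'v::euclidean_space set \<Rightarrow> (real \<Rightarrow> 'v option) \<Rightarrow> bool" where
  "killed_at_infinity D \<gamma> \<longleftrightarrow>
     (\<forall>s\<ge>0. (s > 0 \<and> (\<exists>l. left_limit D \<gamma> s l \<and> ext_norm l = \<infinity>)) \<or> ext_norm (Some (\<gamma> s)) = \<infinity>
        \<longrightarrow> (\<forall>t\<ge>s. \<gamma> t = None))"

end

theory Submission
  imports Defs
begin

text \<open>
  Fix a starting point \<open>x\<close>. For a bounded test function \<open>f\<close> with \<open>f(\<Delta>) = 0\<close> and a horizon
  \<open>T\<close>, the Markov property makes \<open>q \<mapsto> \<integral> f dp\<^bsub>T-q\<^esub>(X\<^bsub>q\<^esub>, \<cdot>)\<close> a bounded martingale on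
  \<open>[0, T]\<close> with final value \<open>f(X\<^bsub>T\<^esub>)\<close>. Two facts about bounded martingales in discrete time, a
  maximal inequality and a bound on the number of moves of size \<open>\<epsilon>\<close>, are applied on finer and
  finer dyadic grids to \<open>f = 1\<close>, to the indicators of \<open>|\<xi>| > R\<close>, and to the real and imaginary
  parts of \<open>exp (i \<langle>v, \<xi>\<rangle>)\<close>. Hence almost every path, watched at dyadic times only, is a good
  path (\<open>good_path\<close>): the survival probabilities \<open>p\<^bsub>T-q\<^esub>(X\<^bsub>q\<^esub>, D)\<close> stay away from zero if
  \<open>X\<^bsub>T\<^esub> \<noteq> \<Delta>\<close>, the laws \<open>p\<^bsub>T-q\<^esub>(X\<^bsub>q\<^esub>, \<cdot>)\<close> are tight uniformly in \<open>q\<close>, and their Fourier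
  transforms at a countable set of frequencies have one-sided limits in \<open>q\<close>. Only these three
  properties enter the study of the paths, which is deterministic.

  The heart of the matter is that states which run off to infinity cannot have tight laws after
  every short time (\<open>bounded_if_equicontinuous_at_zero\<close>). Only imaginary exponents \<open>iv\<close> are
  used. For \<open>|v| \<le> 1\<close> and small \<open>h\<close> the transform does not vanish, so that
  \<open>\<psi>(h, iv) - \<psi>(h, 0)\<close> is continuous in \<open>(h, v)\<close> and tends to \<open>iv\<close> as \<open>h \<rightarrow> 0\<close>. Given
  states \<open>x\<^bsub>k\<^esub>\<close>, let \<open>L\<close> be the space of vectors \<open>w\<close> for which \<open>\<langle>w, x\<^bsub>k\<^esub>\<rangle>\<close> is bounded in
  \<open>k\<close>. Tightness makes the Fourier transforms equicontinuous, so the exponents at nearby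
  frequencies differ, after pairing with \<open>x\<^bsub>k\<^esub>\<close>, by a bounded amount as long as the transforms are
  not small. On \<open>L\<close> the pairing is bounded uniformly, and for small \<open>h\<close> the real part of the
  increment is small, so the transforms are indeed not small at frequencies whose increments lie
  in \<open>L + iL\<close>. Starting at \<open>v = 0\<close> and moving by steps of a fixed length one finds that all
  increments with \<open>|v| \<le> 1\<close> lie in \<open>L + iL\<close>. Letting \<open>h \<rightarrow> 0\<close> gives \<open>v \<in> L\<close> for all such
  \<open>v\<close>, that is, \<open>L\<close> is everything and \<open>x\<^bsub>k\<^esub>\<close> is bounded.

  It follows that before its death a good path stays bounded near every time, and that a finite
  limit point on one side of a time excludes infinity as a further limit point there. Two finite
  one-sided limit points \<open>y, y'\<close> satisfy \<open>exp (i \<langle>v, y\<rangle>) = exp (i \<langle>v, y'\<rangle>)\<close> for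
  frequencies \<open>v\<close> along every axis and arbitrarily close to zero, hence agree. So right limits
  along dyadic times exist; they define a cadlag path, which can have an infinite left limit only
  at its death (\<open>regularization_cadlag\<close>, \<open>regularization_killed\<close>). Stochastic continuity
  gives convergence in \<open>L\<^sup>2\<close> of \<open>f(X\<^bsub>q\<^esub>)\<close> to \<open>f(X\<^bsub>t\<^esub>)\<close> as \<open>q\<close> decreases to \<open>t\<close>, so the
  regularization is a version of \<open>X\<close> (\<open>Y_version\<close>). Since every set in the augmented
  filtration differs by a null set from one in the natural filtration, a version inherits the
  Markov property (\<open>Y_markov\<close>).
\<close>

section \<open>Bounded martingales in discrete time\<close>

text \<open>The martingale property is tested against bounded measurable functions of the past, the form in
  which it is used both for events and for squares.\<close>

locale bounded_martingale = prob_space M for M :: "'a measure" +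
  fixes F :: "nat \<Rightarrow> 'a measure" and N :: "nat \<Rightarrow> 'a \<Rightarrow> real" and C :: real
  assumes subalg: "\<And>j. subalgebra M (F j)"
    and filtration: "\<And>j. sets (F j) \<subseteq> sets (F (Suc j))"
    and adapted: "\<And>j. N j \<in> borel_measurable (F j)"
    and bounded_by: "\<And>j \<omega>. \<omega> \<in> space M \<Longrightarrow> \<bar>N j \<omega>\<bar> \<le> C"
    and martingale: "\<And>j G K. \<lbrakk>G \<in> borel_measurable (F j); \<And>\<omega>. \<omega> \<in> space M \<Longrightarrow> \<bar>G \<omega>\<bar> \<le> K\<rbrakk>
      \<Longrightarrow> (LINT \<omega>|M. G \<omega> * N (Suc j) \<omega>) = (LINT \<omega>|M. G \<omega> * N j \<omega>)"
begin

lemma space_F: "space (F j) = space M"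
  using subalg unfolding subalgebra_def by blast

lemma F_measurable_mono: "i \<le> j \<Longrightarrow> f \<in> borel_measurable (F i) \<Longrightarrow> f \<in> borel_measurable (F j)"
proof (induction j)
  case (Suc j)
  show ?case
  proof (cases "i = Suc j")
    case False
    then have "f \<in> borel_measurable (F j)"
      using Suc by auto
    then show ?thesis
      using filtration[of j] space_F by (auto simp: measurable_def)
  qed (use Suc in auto)
qed auto

lemma F_measurable_M: "f \<in> borel_measurable (F j) \<Longrightarrow> f \<in> borel_measurable M"
  by (rule measurable_from_subalg[OF subalg])

lemma C_nonneg: "0 \<le> C"
proof -
  obtain \<omega> where "\<omega> \<in> space M"
    using not_empty by blast
  from bounded_by[OF this, of 0] show ?thesis by linarith
qed

text \<open>Doob's maximal inequality, for a threshold of either sign: the event is split according to the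
  first index at which \<open>a\<close> is exceeded, and from then on the martingale keeps its mean.\<close>

lemma weak_maximal_inequality:
  fixes a :: real
  defines "B \<equiv> \<lambda>j. {\<omega> \<in> space M. \<exists>i\<le>j. a \<le> N i \<omega>}"
  shows "B n \<in> sets (F n)" and "a * prob (B n) \<le> (LINT \<omega>|M. indicator (B n) \<omega> * N n \<omega>)"
proof -
  have adM [measurable]: "N j \<in> borel_measurable M" for j
    using adapted F_measurable_M by blast
  have BF: "B j \<in> sets (F j)" for j
  proof -
    have [measurable]: "N i \<in> borel_measurable (F j)" if "i \<le> j" for i
      using F_measurable_mono[OF that adapted] .
    have "B j = (\<Union>i\<in>{..j}. {\<omega> \<in> space (F j). a \<le> N i \<omega>})"
      by (auto simp: B_def space_F)
    also have "\<dots> \<in> sets (F j)"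
      by (intro sets.finite_UN) auto
    finally show ?thesis .
  qed
  then have BM [measurable]: "B j \<in> sets M" for j
    using subalg unfolding subalgebra_def by blast
  have int: "integrable M (\<lambda>\<omega>. indicator A \<omega> * N j \<omega>)" if "A \<in> sets M" for A j
    by (rule integrable_const_bound[where B = C])
      (use that in \<open>auto intro!: AE_I2 simp: indicator_def bounded_by C_nonneg\<close>)
  have intA: "integrable M (\<lambda>\<omega>. a * indicator A \<omega>)" if "A \<in> sets M" for A
    using that by (intro integrable_mult_right integrable_real_indicator) (auto simp: less_top[symmetric])
  show "B n \<in> sets (F n)" by (rule BF)
  show "a * prob (B n) \<le> (LINT \<omega>|M. indicator (B n) \<omega> * N n \<omega>)"
  proof (induction n)
    case 0
    have "a * prob (B 0) = (LINT \<omega>|M. a * indicator (B 0) \<omega>)"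
      by simp
    also have "\<dots> \<le> (LINT \<omega>|M. indicator (B 0) \<omega> * N 0 \<omega>)"
      by (intro integral_mono int intA BM) (simp add: B_def indicator_def)
    finally show ?case .
  next
    case (Suc n)
    let ?E = "B (Suc n) - B n"
    have sub: "B n \<subseteq> B (Suc n)"
      unfolding B_def using le_SucI by blast
    have E: "a \<le> N (Suc n) \<omega>" if "\<omega> \<in> ?E" for \<omega>
      using that unfolding B_def by (auto simp: le_Suc_eq)
    have "prob (B (Suc n)) = prob (B n) + prob ?E"
      using sub by (simp add: finite_measure_Diff)
    then have "a * prob (B (Suc n)) = a * prob (B n) + (LINT \<omega>|M. a * indicator ?E \<omega>)"
      by (simp add: distrib_left)
    also have "\<dots> \<le> (LINT \<omega>|M. indicator (B n) \<omega> * N n \<omega>) + (LINT \<omega>|M. indicator ?E \<omega> * N (Suc n) \<omega>)"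
      by (intro add_mono Suc integral_mono int intA sets.Diff BM) (use E in \<open>auto simp: indicator_def\<close>)
    also have "(LINT \<omega>|M. indicator (B n) \<omega> * N n \<omega>) = (LINT \<omega>|M. indicator (B n) \<omega> * N (Suc n) \<omega>)"
      by (rule martingale[symmetric, where K = 1]) (use BF in \<open>auto simp: indicator_def\<close>)
    also have "(LINT \<omega>|M. indicator (B n) \<omega> * N (Suc n) \<omega>) + (LINT \<omega>|M. indicator ?E \<omega> * N (Suc n) \<omega>)
        = (LINT \<omega>|M. indicator (B n) \<omega> * N (Suc n) \<omega> + indicator ?E \<omega> * N (Suc n) \<omega>)"
      by (intro Bochner_Integration.integral_add[symmetric] int) auto
    also have "\<dots> = (LINT \<omega>|M. indicator (B (Suc n)) \<omega> * N (Suc n) \<omega>)"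
      using sub by (intro Bochner_Integration.integral_cong) (auto simp: indicator_def)
    finally show ?case .
  qed
qed

end

text \<open>A greedy count of moves of size \<open>e\<close>: the reference value is replaced by the current value
  whenever the two are at least \<open>e\<close> apart.\<close>

primrec osc_ref :: "real \<Rightarrow> (nat \<Rightarrow> real) \<Rightarrow> nat \<Rightarrow> real" where
  "osc_ref e m 0 = m 0"
| "osc_ref e m (Suc j) = (if e \<le> \<bar>m (Suc j) - osc_ref e m j\<bar> then m (Suc j) else osc_ref e m j)"

primrec osc_count :: "real \<Rightarrow> (nat \<Rightarrow> real) \<Rightarrow> nat \<Rightarrow> nat" where
  "osc_count e m 0 = 0"
| "osc_count e m (Suc j) = osc_count e m j + (if e \<le> \<bar>m (Suc j) - osc_ref e m j\<bar> then 1 else 0)"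

lemma osc_count_mono: "i \<le> j \<Longrightarrow> osc_count e m i \<le> osc_count e m j"
  by (rule lift_Suc_mono_le[of "osc_count e m"]) auto

lemma osc_ref_close: "0 < e \<Longrightarrow> \<bar>m j - osc_ref e m j\<bar> < e"
  by (cases j) auto

text \<open>Between two indices without an update the reference value is constant, and both values lie within
  \<open>e\<close> of it.\<close>

lemma osc_count_increases:
  assumes "0 < e" "i \<le> j" "2 * e \<le> \<bar>m i - m j\<bar>"
  shows "osc_count e m i < osc_count e m j"
proof (rule ccontr)
  assume "\<not> ?thesis"
  with osc_count_mono[OF assms(2)] have eq: "osc_count e m j = osc_count e m i"
    by (meson le_antisym not_le)
  have "osc_ref e m k = osc_ref e m i" if "i \<le> k" "k \<le> j" for k
    using that
  proof (induction k rule: dec_induct)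
    case (step k)
    have "osc_count e m (Suc k) \<le> osc_count e m k"
      using osc_count_mono[of i k e m] osc_count_mono[of "Suc k" j e m] step eq by simp
    then show ?case
      using step by (auto split: if_splits)
  qed simp
  then have "osc_ref e m j = osc_ref e m i"
    using assms by blast
  with osc_ref_close[OF assms(1), of m i] osc_ref_close[OF assms(1), of m j] assms(3)
  show False by linarith
qed

context bounded_martingale
begin

lemma osc_measurable:
  "(\<lambda>\<omega>. osc_ref e (\<lambda>i. N i \<omega>) j) \<in> borel_measurable (F j)"
  "(\<lambda>\<omega>. real (osc_count e (\<lambda>i. N i \<omega>) j)) \<in> borel_measurable (F j)"
proof (induction j)
  case 0
  show "(\<lambda>\<omega>. osc_ref e (\<lambda>i. N i \<omega>) 0) \<in> borel_measurable (F 0)"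
    "(\<lambda>\<omega>. real (osc_count e (\<lambda>i. N i \<omega>) 0)) \<in> borel_measurable (F 0)"
    using adapted by auto
next
  case (Suc j)
  have [measurable]: "(\<lambda>\<omega>. osc_ref e (\<lambda>i. N i \<omega>) j) \<in> borel_measurable (F (Suc j))"
    "(\<lambda>\<omega>. real (osc_count e (\<lambda>i. N i \<omega>) j)) \<in> borel_measurable (F (Suc j))"
    "N (Suc j) \<in> borel_measurable (F (Suc j))"
    using Suc F_measurable_mono[of j "Suc j"] adapted by auto
  show "(\<lambda>\<omega>. osc_ref e (\<lambda>i. N i \<omega>) (Suc j)) \<in> borel_measurable (F (Suc j))"
    by simp
  have "(\<lambda>\<omega>. real (osc_count e (\<lambda>i. N i \<omega>) (Suc j))) =
    (\<lambda>\<omega>. real (osc_count e (\<lambda>i. N i \<omega>) j) +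
       (if e \<le> \<bar>N (Suc j) \<omega> - osc_ref e (\<lambda>i. N i \<omega>) j\<bar> then 1 else 0))"
    by auto
  then show "(\<lambda>\<omega>. real (osc_count e (\<lambda>i. N i \<omega>) (Suc j))) \<in> borel_measurable (F (Suc j))"
    by (simp only:) measurable
qed

lemma osc_bounds:
  assumes "\<omega> \<in> space M"
  shows "\<bar>osc_ref e (\<lambda>i. N i \<omega>) j\<bar> \<le> C" "osc_count e (\<lambda>i. N i \<omega>) j \<le> j"
  by (induction j) (use bounded_by[OF assms] in auto)

text \<open>A substitute for the upcrossing inequality: by orthogonality of increments, the potential
  \<open>e\<^sup>2 \<cdot> count + (N - reference)\<^sup>2\<close> grows in mean at most as fast as \<open>N\<^sup>2\<close>.\<close>

lemma expected_osc_count: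
  assumes "0 < e"
  shows "e\<^sup>2 * (LINT \<omega>|M. real (osc_count e (\<lambda>i. N i \<omega>) n)) \<le> C\<^sup>2"
proof -
  define R where "R j \<omega> = osc_ref e (\<lambda>i. N i \<omega>) j" for j \<omega>
  define Q where "Q j \<omega> = real (osc_count e (\<lambda>i. N i \<omega>) j)" for j \<omega>
  have RF: "R j \<in> borel_measurable (F j)" and QF: "Q j \<in> borel_measurable (F j)" for j
    using osc_measurable unfolding R_def Q_def by auto
  have [measurable]: "R j \<in> borel_measurable M" "Q j \<in> borel_measurable M" "N j \<in> borel_measurable M" for j
    using RF QF adapted F_measurable_M by blast+
  have Rb: "\<bar>R j \<omega>\<bar> \<le> C" and Qb: "0 \<le> Q j \<omega>" "Q j \<omega> \<le> real j" if "\<omega> \<in> space M" for j \<omega>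
    using osc_bounds[OF that] unfolding R_def Q_def by auto
  note C0 = C_nonneg
  have iNN: "integrable M (\<lambda>\<omega>. N i \<omega> * N j \<omega>)" for i j
    by (rule integrable_const_bound[where B = "C * C"])
      (auto intro!: AE_I2 mult_mono bounded_by simp: abs_mult C0)
  have iNR: "integrable M (\<lambda>\<omega>. N i \<omega> * R j \<omega>)" for i j
    by (rule integrable_const_bound[where B = "C * C"])
      (auto intro!: AE_I2 mult_mono bounded_by Rb simp: abs_mult C0)
  have iRR: "integrable M (\<lambda>\<omega>. R i \<omega> * R j \<omega>)" for i j
    by (rule integrable_const_bound[where B = "C * C"])
      (auto intro!: AE_I2 mult_mono Rb simp: abs_mult C0)
  have iQ: "integrable M (Q j)" for j
    by (rule integrable_const_bound[where B = "real j"]) (auto intro!: AE_I2 simp: Qb)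
  have sq: "(N i \<omega> - R j \<omega>)\<^sup>2 = N i \<omega> * N i \<omega> - 2 * (N i \<omega> * R j \<omega>) + R j \<omega> * R j \<omega>" for i j \<omega>
    by (simp add: power2_eq_square algebra_simps)
  have ND: "integrable M (\<lambda>\<omega>. (N i \<omega> - R j \<omega>)\<^sup>2)" for i j
    unfolding sq by (intro Bochner_Integration.integrable_add Bochner_Integration.integrable_diff
        integrable_mult_right iNN iNR iRR)
  have E: "(LINT \<omega>|M. (N i \<omega> - R j \<omega>)\<^sup>2) = (LINT \<omega>|M. N i \<omega> * N i \<omega>)
      - 2 * (LINT \<omega>|M. N i \<omega> * R j \<omega>) + (LINT \<omega>|M. R j \<omega> * R j \<omega>)" for i j
    unfolding sq using iNN iNR iRR by simp
  have orth: "(LINT \<omega>|M. N (Suc j) \<omega> * R j \<omega>) = (LINT \<omega>|M. N j \<omega> * R j \<omega>)" for j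
    using martingale[OF RF Rb, of j] by (simp add: mult.commute)
  have key: "e\<^sup>2 * (LINT \<omega>|M. Q j \<omega>) + (LINT \<omega>|M. (N j \<omega> - R j \<omega>)\<^sup>2) \<le> (LINT \<omega>|M. N j \<omega> * N j \<omega>)" for j
  proof (induction j)
    case 0
    have "0 \<le> (LINT \<omega>|M. N 0 \<omega> * N 0 \<omega>)"
      by (rule integral_nonneg_AE) simp
    then show ?case by (simp add: R_def Q_def)
  next
    case (Suc j)
    \<comment> \<open>An update costs \<open>e\<^sup>2\<close>, but it resets a squared distance of at least \<open>e\<^sup>2\<close> to zero.\<close>
    have pw: "e\<^sup>2 * Q (Suc j) \<omega> + (N (Suc j) \<omega> - R (Suc j) \<omega>)\<^sup>2 \<le> e\<^sup>2 * Q j \<omega> + (N (Suc j) \<omega> - R j \<omega>)\<^sup>2" for \<omega>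
    proof (cases "e \<le> \<bar>N (Suc j) \<omega> - R j \<omega>\<bar>")
      case True
      then have "e\<^sup>2 \<le> (N (Suc j) \<omega> - R j \<omega>)\<^sup>2"
        using assms by (metis power2_abs power_mono less_imp_le)
      then show ?thesis
        using True by (simp add: R_def Q_def algebra_simps)
    qed (simp add: R_def Q_def)
    have "(LINT \<omega>|M. e\<^sup>2 * Q (Suc j) \<omega> + (N (Suc j) \<omega> - R (Suc j) \<omega>)\<^sup>2)
        \<le> (LINT \<omega>|M. e\<^sup>2 * Q j \<omega> + (N (Suc j) \<omega> - R j \<omega>)\<^sup>2)"
      by (intro integral_mono Bochner_Integration.integrable_add integrable_mult_right iQ ND pw)
    then have "e\<^sup>2 * (LINT \<omega>|M. Q (Suc j) \<omega>) + (LINT \<omega>|M. (N (Suc j) \<omega> - R (Suc j) \<omega>)\<^sup>2)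
        \<le> e\<^sup>2 * (LINT \<omega>|M. Q j \<omega>) + (LINT \<omega>|M. (N (Suc j) \<omega> - R j \<omega>)\<^sup>2)"
      using iQ ND by simp
    with Suc E[of "Suc j" j] E[of j j] orth[of j] show ?case
      by linarith
  qed
  have "(LINT \<omega>|M. N n \<omega> * N n \<omega>) \<le> (LINT \<omega>|M. C * C)"
  proof (intro integral_mono iNN)
    fix \<omega> assume "\<omega> \<in> space M"
    from bounded_by[OF this, of n] show "N n \<omega> * N n \<omega> \<le> C * C"
      by (metis C0 abs_ge_zero abs_mult_self_eq mult_mono)
  qed simp
  also have "\<dots> = C * C"
    by (simp add: prob_space)
  finally have "(LINT \<omega>|M. N n \<omega> * N n \<omega>) \<le> C * C" .
  moreover have "0 \<le> (LINT \<omega>|M. (N n \<omega> - R n \<omega>)\<^sup>2)"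
    by (rule integral_nonneg_AE) simp
  ultimately have "e\<^sup>2 * (LINT \<omega>|M. Q n \<omega>) \<le> C * C"
    using key[of n] by linarith
  then show ?thesis
    by (simp add: Q_def[abs_def] power2_eq_square)
qed

end

section \<open>The state space with cemetery and unimodular exponentials\<close>

lemma sets_state_algebra:
  fixes D :: "'v::euclidean_space set"
  assumes "closed D"
  shows "sets (state_algebra D) = {A. A \<subseteq> state_cem D \<and> {x. Some x \<in> A} \<in> sets borel}"
proof -
  let ?G = "{Some ` A | A. A \<in> sets (restrict_space borel D)} \<union> {{None}}"
  let ?S = "{A. A \<subseteq> state_cem D \<and> {x. Some x \<in> A} \<in> sets borel}"
  have D: "D \<in> sets borel"
    using assms by simp
  have subD: "sets (restrict_space borel D) = {A. A \<subseteq> D \<and> A \<in> sets borel}"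
    using D by (auto simp: sets_restrict_space) 
  have G: "?G \<subseteq> Pow (state_cem D)"
    by (auto simp: state_cem_def subD)
  have S: "sigma_algebra (state_cem D) ?S"
    unfolding sigma_algebra_iff2
  proof (intro conjI ballI allI impI)
    fix A assume "A \<in> ?S"
    then have "{x. Some x \<in> state_cem D - A} = D - {x. Some x \<in> A}" "{x. Some x \<in> A} \<in> sets borel"
      by (auto simp: state_cem_def)
    with D show "state_cem D - A \<in> ?S"
      by auto
  next
    fix A :: "nat \<Rightarrow> 'v option set" assume A: "range A \<subseteq> ?S"
    then have "(\<Union>i. {x. Some x \<in> A i}) \<in> sets borel"
      by (intro sets.countable_UN) auto
    moreover have "{x. Some x \<in> (\<Union>i. A i)} = (\<Union>i. {x. Some x \<in> A i})"
      by auto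
    ultimately show "(\<Union>i. A i) \<in> ?S"
      using A by auto
  qed auto
  have "sigma_sets (state_cem D) ?G \<subseteq> ?S"
  proof (rule sigma_algebra.sigma_sets_subset[OF S])
    show "?G \<subseteq> ?S"
      by (auto simp: state_cem_def subD image_iff)
  qed
  moreover have "A \<in> sigma_sets (state_cem D) ?G" if A: "A \<in> ?S" for A
  proof -
    have "{x. Some x \<in> A} \<in> sets (restrict_space borel D)"
      using A by (auto simp: subD state_cem_def)
    then have 1: "Some ` {x. Some x \<in> A} \<in> sigma_sets (state_cem D) ?G"
      by (intro sigma_sets.Basic) blast
    have "A \<inter> {None} = {None} \<or> A \<inter> {None} = {}"
      by auto
    then have 2: "A \<inter> {None} \<in> sigma_sets (state_cem D) ?G"
      by (auto intro: sigma_sets.Empty sigma_sets.Basic)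
    have "A = Some ` {x. Some x \<in> A} \<union> (A \<inter> {None})"
      by (auto simp: image_iff) (metis not_None_eq)
    then show ?thesis
      using sigma_sets_Un[OF 1 2] by simp
  qed
  ultimately show ?thesis
    unfolding state_algebra_def sets_measure_of[OF G] by blast
qed

lemma space_state_algebra: "space (state_algebra D) = state_cem D"
  unfolding state_algebra_def
  by (rule space_measure_of) (auto simp: state_cem_def sets_restrict_space)

lemma measurable_state_algebra:
  fixes D :: "'v::euclidean_space set"
  assumes "closed D" "f None \<in> space N" "(\<lambda>x. f (Some x)) \<in> measurable borel N"
  shows "f \<in> measurable (state_algebra D) N"
proof (rule measurableI)
  fix y assume "y \<in> space (state_algebra D)"
  then show "f y \<in> space N"
    using assms measurable_space[OF assms(3)] by (cases y) auto
next
  fix A assume A: "A \<in> sets N"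
  have "{x. Some x \<in> f -` A \<inter> space (state_algebra D)} = ((\<lambda>x. f (Some x)) -` A \<inter> space borel) \<inter> D"
    by (auto simp: space_state_algebra state_cem_def)
  also have "\<dots> \<in> sets borel"
    using measurable_sets[OF assms(3) A] assms(1) by auto
  finally show "f -` A \<inter> space (state_algebra D) \<in> sets (state_algebra D)"
    by (simp add: sets_state_algebra[OF assms(1)] space_state_algebra)
qed

lemma measurable_case_option_state:
  fixes D :: "'v::euclidean_space set" and f :: "'v \<Rightarrow> 'b::{topological_space, zero}"
  assumes "closed D" "f \<in> borel_measurable borel"
  shows "case_option 0 f \<in> borel_measurable (state_algebra D)"
  by (rule measurable_state_algebra) (use assms in auto)

lemma exp_fun_imaginary: "exp_fun (0, v) = case_option 0 (\<lambda>x. cis (v \<bullet> x))"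
  by (auto simp: exp_fun_def cpair_def fun_eq_iff cis_conv_exp complex_eq_iff Re_exp Im_exp split: option.splits)

lemma norm_cis_diff_squared: "(norm (cis a - cis b))\<^sup>2 = 2 * (1 - cos (a - b))"
proof -
  have "(norm (cis a - cis b))\<^sup>2 = (cos a - cos b)\<^sup>2 + (sin a - sin b)\<^sup>2"
    by (simp add: cmod_power2)
  also have "\<dots> = ((cos a)\<^sup>2 + (sin a)\<^sup>2) + ((cos b)\<^sup>2 + (sin b)\<^sup>2) - 2 * (cos a * cos b + sin a * sin b)"
    by (simp add: power2_eq_square algebra_simps)
  finally show ?thesis
    by (simp add: cos_diff)
qed

lemma norm_cis_diff_le: "norm (cis a - cis b) \<le> 2 * min 1 \<bar>a - b\<bar>"
proof -
  have "norm (cis a - cis b) \<le> norm (cis a) + norm (cis b)"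
    by (rule norm_triangle_ineq4)
  then have 1: "norm (cis a - cis b) \<le> 2" by simp
  have "norm (cis a - cis b) \<le> 2 * \<bar>a - b\<bar>"
  proof (rule power2_le_imp_le)
    have "(norm (cis a - cis b))\<^sup>2 = 2 * (1 - cos (a - b))"
      by (rule norm_cis_diff_squared)
    also have "\<dots> = 4 * (sin ((a - b) / 2))\<^sup>2"
    proof -
      have "cos (2 * ((a - b) / 2)) = 1 - 2 * (sin ((a - b) / 2))\<^sup>2"
        by (rule cos_double_sin)
      moreover have "2 * ((a - b) / 2) = a - b"
        by (rule field_sum_of_halves[of "a - b", folded mult_2])
      ultimately show ?thesis
        by (simp only:) simp
    qed
    also have "\<dots> \<le> (2 * \<bar>a - b\<bar>)\<^sup>2"
    proof -
      have "\<bar>sin ((a - b) / 2)\<bar> \<le> \<bar>a - b\<bar>"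
        using abs_sin_x_le_abs_x[of "(a - b) / 2"] by simp
      then have "(sin ((a - b) / 2))\<^sup>2 \<le> (a - b)\<^sup>2"
        by (simp add: abs_le_square_iff)
      then show ?thesis by (simp add: power_mult_distrib)
    qed
    finally show "(norm (cis a - cis b))\<^sup>2 \<le> (2 * \<bar>a - b\<bar>)\<^sup>2" .
  qed simp
  with 1 show ?thesis by simp
qed

text \<open>This bounds the modulus of continuity of a Fourier transform at all frequencies by its real part
  near the frequency zero.\<close>

lemma norm_cis_diff_quadratic: "norm (cis a - cis b) \<le> 4 * (1 - cos (a - b)) + 1 / 8"
proof -
  let ?n = "norm (cis a - cis b)"
  have "?n\<^sup>2 = 2 * (1 - cos (a - b))"
    by (rule norm_cis_diff_squared)
  \<comment> \<open>In terms of \<open>n\<close> the claim is \<open>n \<le> 2 n\<^sup>2 + 1/8\<close>.\<close>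
  moreover have "0 \<le> 2 * (?n - 1 / 4)\<^sup>2"
    by simp
  ultimately show ?thesis
    by (simp add: power2_eq_square algebra_simps)
qed

section \<open>The kernels and their Fourier transforms\<close>

text \<open>The part of the hypotheses that concerns the transition function only. Imaginary exponents belong
  to the set with bound \<open>m = 1\<close>.\<close>

locale affine_kernel =
  fixes D :: "'v::euclidean_space set" and p :: "real \<Rightarrow> 'v option \<Rightarrow> 'v option measure"
    and \<Phi> :: "real \<Rightarrow> 'v \<times> 'v \<Rightarrow> complex" and \<psi> :: "real \<Rightarrow> 'v \<times> 'v \<Rightarrow> 'v \<times> 'v"
  assumes closed_D: "closed D"
    and affine_basis: "\<exists>S\<subseteq>D. card S = DIM('v) + 1 \<and> \<not> affine_dependent S"
    and transition: "transition_function D p"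
    and stochastic_continuity: "stochastically_continuous D p"
    and exponent_continuous: "\<And>x. x \<in> D \<Longrightarrow>
      locally_continuous_on (nonvanishing_set D \<Phi> 1) (\<lambda>(t, u). cpair (\<psi> t u) x)"
    and transform: "\<And>x t u. \<lbrakk>x \<in> D; 0 \<le> t; u \<in> bdd_exponents D\<rbrakk> \<Longrightarrow>
      (LINT \<xi>:Some ` D|p t (Some x). exp_fun u \<xi>) = \<Phi> t u * exp (cpair (\<psi> t u) x)"
begin

lemma Some_in_state: "Some x \<in> state_cem D \<longleftrightarrow> x \<in> D" and None_in_state: "None \<in> state_cem D"
  by (auto simp: state_cem_def)

lemma Some_D_sets: "Some ` D \<in> sets (state_algebra D)" and None_sets: "{None} \<in> sets (state_algebra D)"
  using closed_D by (auto simp: sets_state_algebra state_cem_def image_iff)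

lemma
  assumes "0 \<le> t" "y \<in> state_cem D"
  shows sets_kernel: "sets (p t y) = sets (state_algebra D)"
    and space_kernel: "space (p t y) = state_cem D"
    and prob_space_kernel: "prob_space (p t y)"
proof -
  show s: "sets (p t y) = sets (state_algebra D)"
    using transition assms unfolding transition_function_def by blast
  then show sp: "space (p t y) = state_cem D"
    using sets_eq_imp_space_eq space_state_algebra by blast
  have le: "emeasure (p t y) (Some ` D) \<le> 1"
    and N: "emeasure (p t y) {None} = 1 - emeasure (p t y) (Some ` D)"
    using transition assms unfolding transition_function_def by blast+
  have "state_cem D = Some ` D \<union> {None}"
    by (auto simp: state_cem_def)
  then have "emeasure (p t y) (space (p t y)) = emeasure (p t y) (Some ` D) + emeasure (p t y) {None}"
    unfolding sp using Some_D_sets None_sets by (subst plus_emeasure) (auto simp: s)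
  also have "\<dots> = 1"
    unfolding N using le by (simp add: add_diff_inverse_ennreal)
  finally show "prob_space (p t y)"
    by (rule prob_spaceI)
qed

lemma measurable_kernel_iff:
  "0 \<le> t \<Longrightarrow> y \<in> state_cem D \<Longrightarrow> measurable (p t y) N = measurable (state_algebra D) N"
  by (intro measurable_cong_sets sets_kernel refl)

lemma kernel_measurable:
  assumes "0 \<le> t"
  shows "p t \<in> measurable (state_algebra D) (subprob_algebra (state_algebra D))"
proof (rule measurable_subprob_algebra)
  fix y assume "y \<in> space (state_algebra D)"
  then have y: "y \<in> state_cem D" by (simp add: space_state_algebra)
  show "subprob_space (p t y)"
    using prob_space_kernel[OF assms y] by (rule prob_space_imp_subprob_space)
  show "sets (p t y) = sets (state_algebra D)"
    by (rule sets_kernel[OF assms y])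
next
  fix A assume "A \<in> sets (state_algebra D)"
  then show "(\<lambda>y. emeasure (p t y) A) \<in> borel_measurable (state_algebra D)"
    using transition assms unfolding transition_function_def by blast
qed

lemma kernel_integral_measurable:
  fixes f :: "'v option \<Rightarrow> 'b::{banach, second_countable_topology}"
  assumes "0 \<le> t" "f \<in> borel_measurable (state_algebra D)"
  shows "(\<lambda>y. LINT \<xi>|p t y. f \<xi>) \<in> borel_measurable (state_algebra D)"
  using measurable_comp[OF kernel_measurable[OF assms(1)] integral_measurable_subprob_algebra[OF assms(2)]]
  by (simp add: comp_def)

lemma kernel_integrable:
  fixes f :: "'v option \<Rightarrow> 'b::{banach, second_countable_topology}"
  assumes "0 \<le> t" "y \<in> state_cem D" "f \<in> borel_measurable (state_algebra D)"
    "\<And>\<xi>. \<xi> \<in> state_cem D \<Longrightarrow> norm (f \<xi>) \<le> K"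
  shows "integrable (p t y) f"
proof -
  interpret prob_space "p t y" by (rule prob_space_kernel[OF assms(1,2)])
  show ?thesis
    by (rule integrable_const_bound[where B = K])
      (use assms in \<open>auto intro!: AE_I2 simp: space_kernel measurable_kernel_iff\<close>)
qed

lemma kernel_integral_bound:
  fixes f :: "'v option \<Rightarrow> real"
  assumes "0 \<le> t" "y \<in> state_cem D" "f \<in> borel_measurable (state_algebra D)"
    "\<And>\<xi>. \<xi> \<in> state_cem D \<Longrightarrow> \<bar>f \<xi>\<bar> \<le> K"
  shows "\<bar>LINT \<xi>|p t y. f \<xi>\<bar> \<le> K"
proof -
  interpret prob_space "p t y" by (rule prob_space_kernel[OF assms(1,2)])
  have "\<bar>LINT \<xi>|p t y. f \<xi>\<bar> \<le> (LINT \<xi>|p t y. \<bar>f \<xi>\<bar>)"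
    by (rule integral_abs_bound)
  also have "\<dots> \<le> (LINT \<xi>|p t y. K)"
    using kernel_integrable[OF assms(1,2), of f K] assms
    by (intro integral_mono) (auto simp: space_kernel)
  finally show ?thesis by (simp add: prob_space)
qed

lemma chapman_kolmogorov:
  fixes f :: "'v option \<Rightarrow> real"
  assumes "0 \<le> s" "0 \<le> t" "y \<in> state_cem D" "f \<in> borel_measurable (state_algebra D)"
    and bd: "\<And>\<xi>. \<xi> \<in> state_cem D \<Longrightarrow> \<bar>f \<xi>\<bar> \<le> K"
  shows "(LINT \<xi>|p (s + t) y. f \<xi>) = (LINT z|p s y. LINT \<xi>|p t z. f \<xi>)"
proof -
  interpret prob_space "p s y" by (rule prob_space_kernel[OF assms(1,3)])
  have K: "p t \<in> measurable (p s y) (subprob_algebra (state_algebra D))"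
    using kernel_measurable[OF assms(2)] by (simp add: measurable_kernel_iff assms)
  have "p (s + t) y = p s y \<bind> p t"
  proof (rule measure_eqI)
    show "sets (p (s + t) y) = sets (p s y \<bind> p t)"
      using sets_bind[OF _ not_empty, of "p t" "state_algebra D"] assms
      by (simp add: sets_kernel space_kernel)
    fix A assume "A \<in> sets (p (s + t) y)"
    then have A: "A \<in> sets (state_algebra D)"
      using assms by (simp add: sets_kernel)
    have "emeasure (p (s + t) y) A = (\<integral>\<^sup>+z. emeasure (p t z) A \<partial>p s y)"
      using transition assms A unfolding transition_function_def by blast
    also have "\<dots> = emeasure (p s y \<bind> p t) A"
      by (rule emeasure_bind[OF not_empty K A, symmetric])
    finally show "emeasure (p (s + t) y) A = emeasure (p s y \<bind> p t) A" .
  qed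
  moreover have "(LINT \<xi>|(p s y \<bind> p t). f \<xi>) = (LINT z|p s y. LINT \<xi>|p t z. f \<xi>)"
  proof (rule integral_bind[where K = "state_algebra D" and B' = 1 and B = K])
    show "AE z in p s y. emeasure (p t z) (space (p t z)) \<le> ennreal 1"
      using assms prob_space_kernel[OF assms(2)]
      by (intro AE_I2) (simp add: space_kernel[OF assms(1,3)] prob_space.emeasure_space_1)
  qed (use assms K finite_measure_axioms in \<open>auto simp: space_state_algebra\<close>)
  ultimately show ?thesis by simp
qed

lemma kernel_None:
  fixes f :: "'v option \<Rightarrow> 'b::{banach, second_countable_topology}"
  assumes "0 \<le> t" "f \<in> borel_measurable (state_algebra D)"
  shows "(LINT \<xi>|p t None. f \<xi>) = f None"
proof -
  interpret prob_space "p t None" by (rule prob_space_kernel[OF assms(1) None_in_state])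
  have e: "emeasure (p t None) {None} = 1"
    using transition assms unfolding transition_function_def by blast
  have "AE \<xi> in p t None. \<xi> \<in> {None}"
    using e by (intro AE_prob_1) (auto simp: measure_def)
  then have "(LINT \<xi>|p t None. f \<xi>) = (LINT \<xi>|p t None. f None)"
    by (intro integral_cong_AE) (use assms in \<open>auto simp: measurable_kernel_iff None_in_state\<close>)
  then show ?thesis
    by (simp add: prob_space)
qed

lemma kernel_0:
  fixes f :: "'v option \<Rightarrow> 'b::{banach, second_countable_topology}"
  assumes "y \<in> state_cem D" "f \<in> borel_measurable (state_algebra D)"
  shows "(LINT \<xi>|p 0 y. f \<xi>) = f y"
proof -
  have "p 0 y = return (state_algebra D) y"
    using transition assms unfolding transition_function_def by blast
  then show ?thesis
    using assms by (simp add: integral_return space_state_algebra)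
qed

lemma kernel_set_integral:
  fixes f :: "'v option \<Rightarrow> 'b::{banach, second_countable_topology}"
  assumes "0 \<le> t" "y \<in> state_cem D" "f None = 0"
  shows "(LINT \<xi>:Some ` D|p t y. f \<xi>) = (LINT \<xi>|p t y. f \<xi>)"
  unfolding set_lebesgue_integral_def
  by (rule Bochner_Integration.integral_cong) (use assms in \<open>auto simp: space_kernel state_cem_def\<close>)


text \<open>The Fourier transform of \<open>p\<^bsub>h\<^esub>(y, \<cdot>)\<close>, a measure on \<open>D\<close> of total mass at most one; it
  vanishes at the cemetery.\<close>

definition cf :: "real \<Rightarrow> 'v \<Rightarrow> 'v option \<Rightarrow> complex" where
  "cf h v y = (LINT \<xi>|p h y. exp_fun (0, v) \<xi>)"

definition mass :: "real \<Rightarrow> 'v option \<Rightarrow> real" where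
  "mass h y = measure (p h y) (Some ` D)"

lemma option_test_measurable:
  fixes f :: "'v \<Rightarrow> 'b::{topological_space, zero}"
  shows "f \<in> borel_measurable borel \<Longrightarrow> case_option 0 f \<in> borel_measurable (state_algebra D)"
  by (rule measurable_case_option_state[OF closed_D])

lemma exp_fun_measurable: "exp_fun (0, v) \<in> borel_measurable (state_algebra D)"
  unfolding exp_fun_imaginary
  by (intro option_test_measurable borel_measurable_continuous_onI continuous_intros)

lemma norm_exp_fun_le: "norm (exp_fun (0, v) \<xi>) \<le> 1"
  by (simp add: exp_fun_imaginary split: option.split)

lemma exp_fun_integrable: "0 \<le> h \<Longrightarrow> y \<in> state_cem D \<Longrightarrow> integrable (p h y) (exp_fun (0, v))"
  by (rule kernel_integrable[OF _ _ exp_fun_measurable norm_exp_fun_le])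

lemma
  assumes "0 \<le> h" "y \<in> state_cem D"
  shows Re_cf: "Re (cf h v y) = (LINT \<xi>|p h y. case_option 0 (\<lambda>x. cos (v \<bullet> x)) \<xi>)"
    and Im_cf: "Im (cf h v y) = (LINT \<xi>|p h y. case_option 0 (\<lambda>x. sin (v \<bullet> x)) \<xi>)"
proof -
  have "(LINT \<xi>|p h y. case_option 0 (\<lambda>x. cos (v \<bullet> x)) \<xi>) = (LINT \<xi>|p h y. Re (exp_fun (0, v) \<xi>))"
    by (rule Bochner_Integration.integral_cong) (auto simp: exp_fun_imaginary split: option.split)
  then show "Re (cf h v y) = (LINT \<xi>|p h y. case_option 0 (\<lambda>x. cos (v \<bullet> x)) \<xi>)"
    using exp_fun_integrable[OF assms] by (simp add: cf_def)
  have "(LINT \<xi>|p h y. case_option 0 (\<lambda>x. sin (v \<bullet> x)) \<xi>) = (LINT \<xi>|p h y. Im (exp_fun (0, v) \<xi>))"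
    by (rule Bochner_Integration.integral_cong) (auto simp: exp_fun_imaginary split: option.split)
  then show "Im (cf h v y) = (LINT \<xi>|p h y. case_option 0 (\<lambda>x. sin (v \<bullet> x)) \<xi>)"
    using exp_fun_integrable[OF assms] by (simp add: cf_def)
qed

lemma mass_eq_integral:
  assumes "0 \<le> h" "y \<in> state_cem D"
  shows "mass h y = (LINT \<xi>|p h y. case_option 0 (\<lambda>x. 1) \<xi>)"
proof -
  have "(LINT \<xi>|p h y. case_option 0 (\<lambda>x. 1 :: real) \<xi>) = (LINT \<xi>|p h y. indicator (Some ` D) \<xi>)"
    by (rule Bochner_Integration.integral_cong)
      (use assms in \<open>auto simp: space_kernel state_cem_def\<close>)
  moreover have "Some ` D \<inter> space (p h y) = Some ` D"
    using assms by (auto simp: space_kernel state_cem_def)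
  ultimately show ?thesis
    by (simp add: mass_def)
qed

lemma
  assumes "0 \<le> h" "y \<in> state_cem D"
  shows cf_zero: "cf h 0 y = of_real (mass h y)"
    and mass_nonneg: "0 \<le> mass h y"
    and mass_le_1: "mass h y \<le> 1"
    and norm_cf_le_mass: "norm (cf h v y) \<le> mass h y"
proof -
  interpret prob_space "p h y" by (rule prob_space_kernel[OF assms])
  show "0 \<le> mass h y" "mass h y \<le> 1"
    by (auto simp: mass_def)
  have "(\<lambda>\<xi>. case_option 0 (\<lambda>x::'v. cos (0 \<bullet> x)) \<xi>) = case_option 0 (\<lambda>x. 1)"
    "(\<lambda>\<xi>. case_option 0 (\<lambda>x::'v. sin (0 \<bullet> x)) \<xi>) = (\<lambda>\<xi>. 0)"
    by (auto simp: fun_eq_iff split: option.split)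
  then show "cf h 0 y = of_real (mass h y)"
    using Re_cf[OF assms, of 0] Im_cf[OF assms, of 0] mass_eq_integral[OF assms]
    by (simp add: complex_eq_iff)
  have "norm (cf h v y) \<le> (LINT \<xi>|p h y. norm (exp_fun (0, v) \<xi>))"
    unfolding cf_def by (rule integral_norm_bound)
  also have "\<dots> = mass h y"
    unfolding mass_eq_integral[OF assms]
    by (rule Bochner_Integration.integral_cong) (auto simp: exp_fun_imaginary split: option.split)
  finally show "norm (cf h v y) \<le> mass h y" .
qed

lemma cf_None: "0 \<le> h \<Longrightarrow> cf h v None = 0"
  unfolding cf_def by (subst kernel_None[OF _ exp_fun_measurable]) (auto simp: exp_fun_def)

lemma cf_at_0: "x \<in> D \<Longrightarrow> cf 0 v (Some x) = cis (v \<bullet> x)"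
  unfolding cf_def
  by (subst kernel_0[OF _ exp_fun_measurable]) (auto simp: exp_fun_imaginary Some_in_state)

lemma cf_transform:
  assumes "0 \<le> h" "x \<in> D"
  shows "cf h v (Some x) = \<Phi> h (0, v) * exp (cpair (\<psi> h (0, v)) x)"
proof -
  have "(0, v) \<in> bdd_exponents D"
    unfolding bdd_exponents_def bounded_iff
    by (auto simp: cpair_def intro!: exI[of _ 1])
  then have "(LINT \<xi>:Some ` D|p h (Some x). exp_fun (0, v) \<xi>) = \<Phi> h (0, v) * exp (cpair (\<psi> h (0, v)) x)"
    by (rule transform[OF assms(2,1)])
  then show ?thesis
    using assms by (simp add: cf_def kernel_set_integral Some_in_state exp_fun_def)
qed

lemma integrable_cf:
  assumes "0 \<le> s" "0 \<le> h" "y \<in> state_cem D"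
  shows "integrable (p h y) (cf s v)"
proof (rule kernel_integrable[OF assms(2,3)])
  show "cf s v \<in> borel_measurable (state_algebra D)"
    unfolding cf_def[abs_def] by (rule kernel_integral_measurable[OF assms(1) exp_fun_measurable])
  show "norm (cf s v \<xi>) \<le> 1" if "\<xi> \<in> state_cem D" for \<xi>
    using norm_cf_le_mass[OF assms(1) that] mass_le_1[OF assms(1) that] by (rule order_trans)
qed

lemma cf_chapman_kolmogorov:
  assumes "0 \<le> h" "0 \<le> s" "y \<in> state_cem D"
  shows "cf (h + s) v y = (LINT z|p h y. cf s v z)"
proof -
  have hs: "0 \<le> h + s" using assms by simp
  have c: "case_option 0 (\<lambda>x. cos (v \<bullet> x)) \<in> borel_measurable (state_algebra D)"
    and s: "case_option 0 (\<lambda>x. sin (v \<bullet> x)) \<in> borel_measurable (state_algebra D)"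
    by (intro option_test_measurable borel_measurable_continuous_onI continuous_intros)+
  have "Re (cf (h + s) v y) = (LINT z|p h y. Re (cf s v z))"
    unfolding Re_cf[OF hs assms(3)]
    by (subst chapman_kolmogorov[where K = 1, OF assms c])
      (auto split: option.split intro!: Bochner_Integration.integral_cong simp: Re_cf assms space_kernel)
  moreover have "Im (cf (h + s) v y) = (LINT z|p h y. Im (cf s v z))"
    unfolding Im_cf[OF hs assms(3)]
    by (subst chapman_kolmogorov[where K = 1, OF assms s])
      (auto split: option.split intro!: Bochner_Integration.integral_cong simp: Im_cf assms space_kernel)
  ultimately show ?thesis
    using integrable_cf[OF assms(2,1,3)] by (simp add: complex_eq_iff)
qed

text \<open>The right-hand side is an integral of a bounded continuous function, hence continuous in \<open>h\<close>,
  and small for small \<open>\<delta>\<close>.\<close>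

lemma cf_diff_le:
  assumes "0 \<le> h" "y \<in> state_cem D" "norm (v - w) \<le> \<delta>"
  shows "norm (cf h v y - cf h w y) \<le> 2 * (LINT \<xi>|p h y. case_option 0 (\<lambda>x. min 1 (\<delta> * norm x)) \<xi>)"
proof -
  have d: "0 \<le> \<delta>" using assms(3) norm_ge_zero order_trans by blast
  let ?f = "case_option 0 (\<lambda>x::'v. min 1 (\<delta> * norm x))"
  have "?f \<in> borel_measurable (state_algebra D)"
    by (intro option_test_measurable borel_measurable_continuous_onI continuous_intros)
  then have f: "integrable (p h y) ?f"
    by (rule kernel_integrable[OF assms(1,2), where K = 1]) (use d in \<open>auto split: option.split\<close>)
  have "cf h v y - cf h w y = (LINT \<xi>|p h y. exp_fun (0, v) \<xi> - exp_fun (0, w) \<xi>)"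
    unfolding cf_def by (intro Bochner_Integration.integral_diff[symmetric] exp_fun_integrable assms)
  also have "norm \<dots> \<le> (LINT \<xi>|p h y. norm (exp_fun (0, v) \<xi> - exp_fun (0, w) \<xi>))"
    by (rule integral_norm_bound)
  also have "\<dots> \<le> (LINT \<xi>|p h y. 2 * ?f \<xi>)"
  proof (rule integral_mono)
    show "integrable (p h y) (\<lambda>\<xi>. norm (exp_fun (0, v) \<xi> - exp_fun (0, w) \<xi>))"
      by (intro integrable_norm Bochner_Integration.integrable_diff exp_fun_integrable assms)
    show "integrable (p h y) (\<lambda>\<xi>. 2 * ?f \<xi>)"
      using f by simp
    fix \<xi> assume "\<xi> \<in> space (p h y)"
    have "norm (cis (v \<bullet> x) - cis (w \<bullet> x)) \<le> 2 * min 1 (\<delta> * norm x)" for x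
    proof -
      have "\<bar>v \<bullet> x - w \<bullet> x\<bar> \<le> norm (v - w) * norm x"
        by (metis Cauchy_Schwarz_ineq2 inner_diff_left)
      also have "\<dots> \<le> \<delta> * norm x"
        using assms(3) by (simp add: mult_right_mono)
      finally have "2 * min 1 \<bar>v \<bullet> x - w \<bullet> x\<bar> \<le> 2 * min 1 (\<delta> * norm x)"
        by (intro mult_left_mono min.mono) auto
      with norm_cis_diff_le[of "v \<bullet> x" "w \<bullet> x"] show ?thesis by (rule order_trans)
    qed
    then show "norm (exp_fun (0, v) \<xi> - exp_fun (0, w) \<xi>) \<le> 2 * ?f \<xi>"
      by (cases \<xi>) (auto simp: exp_fun_imaginary)
  qed
  finally show ?thesis by simp
qed

lemma cf_diff_quadratic:
  assumes "0 \<le> h" "y \<in> state_cem D"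
  shows "norm (cf h v y - cf h w y) \<le> 4 * (mass h y - Re (cf h (v - w) y)) + mass h y / 8"
proof -
  have i1: "integrable (p h y) (case_option 0 (\<lambda>x. 1 :: real))"
    by (intro kernel_integrable[OF assms, where K = 1] option_test_measurable) (auto split: option.split)
  have i2: "integrable (p h y) (case_option 0 (\<lambda>x. cos ((v - w) \<bullet> x)))"
    by (intro kernel_integrable[OF assms, where K = 1] option_test_measurable
        borel_measurable_continuous_onI continuous_intros) (auto split: option.split)
  let ?r = "\<lambda>\<xi>. 4 * (case_option 0 (\<lambda>x. 1 :: real) \<xi> - case_option 0 (\<lambda>x. cos ((v - w) \<bullet> x)) \<xi>)
    + case_option 0 (\<lambda>x. 1 :: real) \<xi> / 8"
  have "cf h v y - cf h w y = (LINT \<xi>|p h y. exp_fun (0, v) \<xi> - exp_fun (0, w) \<xi>)"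
    unfolding cf_def by (intro Bochner_Integration.integral_diff[symmetric] exp_fun_integrable assms)
  also have "norm \<dots> \<le> (LINT \<xi>|p h y. norm (exp_fun (0, v) \<xi> - exp_fun (0, w) \<xi>))"
    by (rule integral_norm_bound)
  also have "\<dots> \<le> (LINT \<xi>|p h y. ?r \<xi>)"
  proof (rule integral_mono)
    show "integrable (p h y) (\<lambda>\<xi>. norm (exp_fun (0, v) \<xi> - exp_fun (0, w) \<xi>))"
      by (intro integrable_norm Bochner_Integration.integrable_diff exp_fun_integrable assms)
    show "integrable (p h y) ?r"
      using i1 i2 by (intro Bochner_Integration.integrable_add Bochner_Integration.integrable_diff
          integrable_mult_right integrable_divide)
    fix \<xi>
    show "norm (exp_fun (0, v) \<xi> - exp_fun (0, w) \<xi>) \<le> ?r \<xi>"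
      using norm_cis_diff_quadratic
      by (cases \<xi>) (auto simp: exp_fun_imaginary inner_diff_left)
  qed
  also have "\<dots> = 4 * (mass h y - Re (cf h (v - w) y)) + mass h y / 8"
    unfolding Re_cf[OF assms] mass_eq_integral[OF assms] using i1 i2 by simp
  finally show ?thesis .
qed

lemma kernel_continuous:
  fixes f :: "'v \<Rightarrow> real"
  assumes "0 \<le> t" "x \<in> D" "continuous_on UNIV f" "\<And>z. \<bar>f z\<bar> \<le> K"
  shows "((\<lambda>s. LINT \<xi>|p s (Some x). case_option 0 f \<xi>) \<longlongrightarrow> (LINT \<xi>|p t (Some x). case_option 0 f \<xi>))
    (at t within {0..})"
proof -
  have eq: "(LINT \<xi>:Some ` D|p s (Some x). case_option 0 f \<xi>) = (LINT \<xi>|p s (Some x). case_option 0 f \<xi>)"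
    if "0 \<le> s" for s
    using that assms(2) by (simp add: kernel_set_integral Some_in_state)
  have "continuous_on D f"
    by (rule continuous_on_subset[OF assms(3)]) simp
  moreover have "bounded (f ` D)"
    unfolding bounded_iff using assms(4) by auto
  ultimately have "continuous_on D f \<and> bounded (f ` D)" ..
  then have "((\<lambda>s. LINT \<xi>:Some ` D|p s (Some x). case_option 0 f \<xi>)
      \<longlongrightarrow> (LINT \<xi>:Some ` D|p t (Some x). case_option 0 f \<xi>)) (at t within {0..})"
    using stochastic_continuity assms(1,2) unfolding stochastically_continuous_def by blast
  then show ?thesis
    unfolding eq[OF assms(1)]
    by (rule Lim_transform_eventually) (auto simp: eventually_at_topological eq intro!: exI[of _ UNIV])
qed

lemma cf_continuous_time:
  assumes "0 \<le> t" "x \<in> D"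
  shows "((\<lambda>s. cf s v (Some x)) \<longlongrightarrow> cf t v (Some x)) (at t within {0..})"
proof -
  have xs: "Some x \<in> state_cem D" using assms by (simp add: Some_in_state)
  have c: "((\<lambda>s. LINT \<xi>|p s (Some x). case_option 0 (\<lambda>x. cos (v \<bullet> x)) \<xi>)
      \<longlongrightarrow> (LINT \<xi>|p t (Some x). case_option 0 (\<lambda>x. cos (v \<bullet> x)) \<xi>)) (at t within {0..})"
    by (intro kernel_continuous[OF assms, where K = 1] continuous_intros) auto
  have s: "((\<lambda>s. LINT \<xi>|p s (Some x). case_option 0 (\<lambda>x. sin (v \<bullet> x)) \<xi>)
      \<longlongrightarrow> (LINT \<xi>|p t (Some x). case_option 0 (\<lambda>x. sin (v \<bullet> x)) \<xi>)) (at t within {0..})"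
    by (intro kernel_continuous[OF assms, where K = 1] continuous_intros) auto
  show ?thesis
    unfolding tendsto_complex_iff Re_cf[OF assms(1) xs] Im_cf[OF assms(1) xs]
    by (intro conjI Lim_transform_eventually[OF c] Lim_transform_eventually[OF s])
      (auto simp: eventually_at_topological Re_cf Im_cf xs intro!: exI[of _ UNIV])
qed

lemma tail_small:
  assumes "0 \<le> t" "x \<in> D" "0 < e"
  obtains \<delta> where "0 < \<delta>" "(LINT \<xi>|p t (Some x). case_option 0 (\<lambda>x. min 1 (\<delta> * norm x)) \<xi>) < e"
proof -
  have xs: "Some x \<in> state_cem D" using assms by (simp add: Some_in_state)
  interpret prob_space "p t (Some x)" by (rule prob_space_kernel[OF assms(1) xs])
  let ?f = "\<lambda>n. case_option 0 (\<lambda>x::'v. min 1 (inverse (real (Suc n)) * norm x))"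
  have m: "?f n \<in> borel_measurable (p t (Some x))" for n
    unfolding measurable_kernel_iff[OF assms(1) xs]
    by (intro option_test_measurable borel_measurable_continuous_onI continuous_intros)
  have "(\<lambda>n. LINT \<xi>|p t (Some x). ?f n \<xi>) \<longlonglongrightarrow> (LINT \<xi>|p t (Some x). 0)"
  proof (rule integral_dominated_convergence[where w = "\<lambda>_. 1"])
    show "AE \<xi> in p t (Some x). (\<lambda>n. ?f n \<xi>) \<longlonglongrightarrow> 0"
    proof (intro AE_I2)
      fix \<xi> :: "'v option"
      show "(\<lambda>n. ?f n \<xi>) \<longlonglongrightarrow> 0"
      proof (cases \<xi>)
        case (Some z)
        have "(\<lambda>n. min 1 (inverse (real (Suc n)) * norm z)) \<longlonglongrightarrow> min 1 (0 * norm z)"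
          by (intro tendsto_intros LIMSEQ_inverse_real_of_nat)
        then show ?thesis using Some by simp
      qed simp
    qed
    show "?f n \<in> borel_measurable (p t (Some x))" for n by (rule m)
  qed (auto split: option.split)
  then have "\<forall>\<^sub>F n in sequentially. (LINT \<xi>|p t (Some x). ?f n \<xi>) < e"
    using assms(3) by (auto dest!: order_tendstoD(2))
  then have "\<exists>n. (LINT \<xi>|p t (Some x). ?f n \<xi>) < e"
    unfolding eventually_sequentially by blast
  then obtain n where "(LINT \<xi>|p t (Some x). ?f n \<xi>) < e" ..
  then show ?thesis
    by (intro that[of "inverse (real (Suc n))"]) auto
qed

text \<open>Stochastic continuity gives continuity in time at each frequency; joint continuity follows as
  \<open>cf_diff_le\<close> controls the change of frequency uniformly in nearby times.\<close>

lemma cf_continuous: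
  assumes x: "x \<in> D"
  shows "continuous_on ({0..} \<times> UNIV) (\<lambda>(h, v). cf h v (Some x))"
  unfolding continuous_on_eq_continuous_within continuous_within_eps_delta
proof (intro ballI allI impI)
  fix q :: "real \<times> 'v" and e :: real
  assume q: "q \<in> {0..} \<times> UNIV" and e: "0 < e"
  obtain t w where tw: "q = (t, w)" "0 \<le> t" using q by auto
  have xs: "Some x \<in> state_cem D" using x by (simp add: Some_in_state)
  let ?f = "\<lambda>\<delta>. case_option 0 (\<lambda>x::'v. min 1 (\<delta> * norm x))"
  obtain \<delta> where d: "0 < \<delta>" "(LINT \<xi>|p t (Some x). ?f \<delta> \<xi>) < e / 4"
    using tail_small[OF tw(2) x, of "e / 4"] e by auto
  have "((\<lambda>s. LINT \<xi>|p s (Some x). ?f \<delta> \<xi>) \<longlongrightarrow> (LINT \<xi>|p t (Some x). ?f \<delta> \<xi>)) (at t within {0..})"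
    by (rule kernel_continuous[OF tw(2) x, where K = 1]) (use d in \<open>auto intro!: continuous_intros\<close>)
  then have "\<forall>\<^sub>F s in at t within {0..}. (LINT \<xi>|p s (Some x). ?f \<delta> \<xi>) < e / 4"
    using d(2) by (rule order_tendstoD(2))
  moreover have "\<forall>\<^sub>F s in at t within {0..}. dist (cf s w (Some x)) (cf t w (Some x)) < e / 2"
    by (rule tendstoD[OF cf_continuous_time[OF tw(2) x]]) (use e in simp)
  ultimately have "\<forall>\<^sub>F s in at t within {0..}. (LINT \<xi>|p s (Some x). ?f \<delta> \<xi>) < e / 4
      \<and> dist (cf s w (Some x)) (cf t w (Some x)) < e / 2"
    by (rule eventually_conj)
  then obtain d1 where d1: "0 < d1" "\<And>s. \<lbrakk>0 \<le> s; s \<noteq> t; dist s t < d1\<rbrakk> \<Longrightarrow>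
      (LINT \<xi>|p s (Some x). ?f \<delta> \<xi>) < e / 4 \<and> dist (cf s w (Some x)) (cf t w (Some x)) < e / 2"
    unfolding eventually_at by auto
  have d2: "(LINT \<xi>|p s (Some x). ?f \<delta> \<xi>) < e / 4 \<and> dist (cf s w (Some x)) (cf t w (Some x)) < e / 2"
    if "0 \<le> s" "dist s t < d1" for s
    using d1(2)[OF that(1) _ that(2)] d(2) e by (cases "s = t") auto
  show "\<exists>d>0. \<forall>q'\<in>{0..} \<times> UNIV. dist q' q < d \<longrightarrow>
      dist (case q' of (h, v) \<Rightarrow> cf h v (Some x)) (case q of (h, v) \<Rightarrow> cf h v (Some x)) < e"
  proof (intro exI[of _ "min d1 \<delta>"] conjI ballI impI)
    fix q' :: "real \<times> 'v" assume q': "q' \<in> {0..} \<times> UNIV" "dist q' q < min d1 \<delta>"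
    obtain s v where sv: "q' = (s, v)" "0 \<le> s" using q' by auto
    have "dist s t < d1" "norm (v - w) \<le> \<delta>"
      using q'(2) dist_fst_le[of q' q] dist_snd_le[of q' q] by (auto simp: sv tw dist_norm)
    from d2[OF sv(2) this(1)] cf_diff_le[OF sv(2) xs this(2)]
    have "dist (cf s v (Some x)) (cf s w (Some x)) < e / 2" "dist (cf s w (Some x)) (cf t w (Some x)) < e / 2"
      by (auto simp: dist_norm)
    then show "dist (case q' of (h, v) \<Rightarrow> cf h v (Some x)) (case q of (h, v) \<Rightarrow> cf h v (Some x)) < e"
      using dist_triangle[of "cf s v (Some x)" "cf t w (Some x)" "cf s w (Some x)"] by (simp add: sv tw)
  qed (use d1 d in auto)
qed

end

section \<open>Winding, bounded functionals and affine bases\<close>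

text \<open>To leave \<open>(-\<pi>/2, \<pi>/2)\<close> the function would have to pass a zero of the cosine. This replaces the
  choice of a branch of the logarithm.\<close>

lemma angle_lt_pi_half:
  fixes g :: "real \<Rightarrow> real"
  assumes "continuous_on {0..1} g" "g 0 = 0" "\<And>s. s \<in> {0..1} \<Longrightarrow> 0 < cos (g s)"
  shows "\<bar>g 1\<bar> < pi / 2"
proof (rule ccontr)
  assume "\<not> ?thesis"
  then have "pi / 2 \<le> g 1 \<or> g 1 \<le> - (pi / 2)"
    by auto
  then show False
  proof
    assume "pi / 2 \<le> g 1"
    then obtain s where "0 \<le> s" "s \<le> 1" "g s = pi / 2"
      using IVT'[of g 0 "pi / 2" 1] assms pi_gt_zero by auto
    then have "cos (g s) = 0"
      by (simp only: cos_pi_half)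
    then show False
      using assms(3)[of s] \<open>0 \<le> s\<close> \<open>s \<le> 1\<close> by simp
  next
    assume "g 1 \<le> - (pi / 2)"
    then obtain s where "0 \<le> s" "s \<le> 1" "g s = - (pi / 2)"
      using IVT2'[of g 1 "- (pi / 2)" 0] assms pi_gt_zero by auto
    then have "cos (g s) = 0"
      by (simp only: cos_minus cos_pi_half)
    then show False
      using assms(3)[of s] \<open>0 \<le> s\<close> \<open>s \<le> 1\<close> by simp
  qed
qed

lemma ratio_of_numbers_near_one:
  fixes a b :: complex
  assumes "norm (a - 1) \<le> 1 / 2" "norm (b - 1) \<le> 1 / 2"
  shows "0 < Re (a / b)" "norm (a / b) \<le> 3" "1 / 3 \<le> norm (a / b)"
proof -
  have im: "\<bar>Im z\<bar> < Re z" if z: "norm (z - 1) \<le> 1 / 2" for z :: complex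
  proof -
    have "(norm (z - 1))\<^sup>2 \<le> (1 / 2)\<^sup>2"
      using z by (rule power_mono) simp
    then have "(Re z - 1)\<^sup>2 + (Im z)\<^sup>2 \<le> 1 / 4"
      by (simp add: cmod_power2 power_divide)
    moreover have "0 < 2 * (Re z - 1 / 2)\<^sup>2 + 1 / 4"
      by (intro add_nonneg_pos) auto
    ultimately have "(Im z)\<^sup>2 < (Re z)\<^sup>2"
      by (simp add: power2_eq_square algebra_simps)
    then have im_less: "\<bar>Im z\<bar> < \<bar>Re z\<bar>"
      by (rule power2_less_imp_less[of "\<bar>Im z\<bar>" "\<bar>Re z\<bar>", simplified])
    have "\<bar>Re (z - 1)\<bar> \<le> 1 / 2"
      using abs_Re_le_cmod[of "z - 1"] z by linarith
    then have "\<bar>Re z - 1\<bar> \<le> 1 / 2" by simp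
    then have "0 < Re z" by linarith
    with im_less show ?thesis by simp
  qed
  have n: "1 / 2 \<le> norm z" "norm z \<le> 3 / 2" if z: "norm (z - 1) \<le> 1 / 2" for z :: complex
    using norm_triangle_ineq2[of 1 "1 - z"] norm_triangle_ineq[of 1 "z - 1"] z
    by (auto simp: norm_minus_commute)
  have b0: "b \<noteq> 0"
    using n(1)[OF assms(2)] by auto
  have "\<bar>Im a\<bar> * \<bar>Im b\<bar> < Re a * Re b"
    using im[OF assms(1)] im[OF assms(2)] by (intro mult_strict_mono') auto
  moreover have "\<bar>Im a * Im b\<bar> = \<bar>Im a\<bar> * \<bar>Im b\<bar>"
    by (rule abs_mult)
  ultimately have "0 < Re a * Re b + Im a * Im b"
    by linarith
  then show "0 < Re (a / b)"
    using b0 by (simp add: Re_divide sum_power2_gt_zero_iff complex_eq_iff)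
  show "norm (a / b) \<le> 3" "1 / 3 \<le> norm (a / b)"
    using n[OF assms(1)] n[OF assms(2)] b0 by (auto simp: norm_divide field_simps)
qed

text \<open>The functionals that are bounded along a sequence form a subspace; an orthonormal basis of it
  makes the bound uniform on its unit ball.\<close>

lemma
  fixes z :: "nat \<Rightarrow> 'a::euclidean_space"
  defines "L \<equiv> {w. \<exists>K. \<forall>k. \<bar>w \<bullet> z k\<bar> \<le> K}"
  shows subspace_bounded_functionals: "subspace L"
    and bounded_functionals_uniform: "\<exists>B\<ge>0. \<forall>w\<in>L. \<forall>k. \<bar>w \<bullet> z k\<bar> \<le> B * norm w"
    and eventually_bounded_functional: "\<And>w K. (\<forall>\<^sub>F k in sequentially. \<bar>w \<bullet> z k\<bar> \<le> K) \<Longrightarrow> w \<in> L"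
proof -
  show sub: "subspace L"
    unfolding subspace_def
  proof (intro conjI ballI allI)
    show "0 \<in> L" by (auto simp: L_def)
  next
    fix v w assume "v \<in> L" "w \<in> L"
    then obtain K K' where K: "\<And>k. \<bar>v \<bullet> z k\<bar> \<le> K" "\<And>k. \<bar>w \<bullet> z k\<bar> \<le> K'"
      by (auto simp: L_def)
    have "\<bar>(v + w) \<bullet> z k\<bar> \<le> K + K'" for k
      using K(1)[of k] K(2)[of k] by (simp add: inner_add_left)
    then show "v + w \<in> L" by (auto simp: L_def)
  next
    fix c :: real and w assume "w \<in> L"
    then obtain K where "\<And>k. \<bar>w \<bullet> z k\<bar> \<le> K"
      by (auto simp: L_def)
    then have "\<bar>(c *\<^sub>R w) \<bullet> z k\<bar> \<le> \<bar>c\<bar> * K" for k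
      by (simp add: abs_mult mult_left_mono)
    then show "c *\<^sub>R w \<in> L" by (auto simp: L_def)
  qed
  show "\<exists>B\<ge>0. \<forall>w\<in>L. \<forall>k. \<bar>w \<bullet> z k\<bar> \<le> B * norm w"
  proof -
    obtain Bs where Bs: "Bs \<subseteq> L" "pairwise orthogonal Bs" "\<And>b. b \<in> Bs \<Longrightarrow> norm b = 1"
        "independent Bs" "span Bs = L"
      using orthonormal_basis_subspace[OF sub] by metis
    have fin: "finite Bs"
      using Bs(4) by (rule independent_imp_finite)
    have "\<forall>b\<in>Bs. \<exists>K. \<forall>k. \<bar>b \<bullet> z k\<bar> \<le> K"
      using Bs(1) by (auto simp: L_def)
    then obtain K where K: "\<And>b k. b \<in> Bs \<Longrightarrow> \<bar>b \<bullet> z k\<bar> \<le> K b"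
      by metis
    have "\<bar>w \<bullet> z k\<bar> \<le> (\<Sum>b\<in>Bs. \<bar>K b\<bar>) * norm w" if "w \<in> L" for w k
    proof -
      have E: "(\<Sum>b\<in>Bs. (w \<bullet> b) *\<^sub>R b) = w"
        by (rule orthonormal_basis_expand[OF Bs(2,3) _ fin]) (use that Bs(5) in simp_all)
      have "w \<bullet> z k = (\<Sum>b\<in>Bs. (w \<bullet> b) *\<^sub>R b) \<bullet> z k"
        by (simp only: E)
      also have "\<dots> = (\<Sum>b\<in>Bs. (w \<bullet> b) * (b \<bullet> z k))"
        by (simp add: inner_sum_left)
      also have "\<bar>\<dots>\<bar> \<le> (\<Sum>b\<in>Bs. \<bar>(w \<bullet> b) * (b \<bullet> z k)\<bar>)"
        by (rule sum_abs)
      also have "\<dots> \<le> (\<Sum>b\<in>Bs. norm w * \<bar>K b\<bar>)"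
      proof (intro sum_mono)
        fix b assume b: "b \<in> Bs"
        have "\<bar>w \<bullet> b\<bar> \<le> norm w"
          using Cauchy_Schwarz_ineq2[of w b] Bs(3)[OF b] by simp
        moreover have "\<bar>b \<bullet> z k\<bar> \<le> \<bar>K b\<bar>"
          using K[OF b, of k] by linarith
        ultimately show "\<bar>(w \<bullet> b) * (b \<bullet> z k)\<bar> \<le> norm w * \<bar>K b\<bar>"
          unfolding abs_mult by (intro mult_mono) auto
      qed
      finally show ?thesis
        by (simp add: sum_distrib_left mult.commute)
    qed
    then show ?thesis
      by (intro exI[of _ "\<Sum>b\<in>Bs. \<bar>K b\<bar>"]) (auto intro: sum_nonneg)
  qed
  show "w \<in> L" if ev: "\<forall>\<^sub>F k in sequentially. \<bar>w \<bullet> z k\<bar> \<le> K" for w K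
  proof -
    obtain n where n: "\<And>k. n \<le> k \<Longrightarrow> \<bar>w \<bullet> z k\<bar> \<le> K"
      using ev by (auto simp: eventually_sequentially)
    have "\<bar>w \<bullet> z k\<bar> \<le> \<bar>K\<bar> + (\<Sum>i<n. \<bar>w \<bullet> z i\<bar>)" for k
    proof (cases "k < n")
      case True
      then have "\<bar>w \<bullet> z k\<bar> \<le> (\<Sum>i<n. \<bar>w \<bullet> z i\<bar>)"
        by (intro member_le_sum) auto
      then show ?thesis by linarith
    next
      case False
      then have "\<bar>w \<bullet> z k\<bar> \<le> K" using n by simp
      moreover have "0 \<le> (\<Sum>i<n. \<bar>w \<bullet> z i\<bar>)" by (rule sum_nonneg) simp
      ultimately show ?thesis by linarith
    qed
    then show ?thesis by (auto simp: L_def)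
  qed
qed

lemma continuous_on_if_locally_continuous_on:
  assumes "locally_continuous_on S f"
  shows "continuous_on S f"
  unfolding continuous_on_def
proof
  fix q assume q: "q \<in> S"
  then obtain U where U: "open U" "q \<in> U" "continuous_on (S \<inter> U) f"
    using assms unfolding locally_continuous_on_def by blast
  then have "(f \<longlongrightarrow> f q) (at q within S \<inter> U)"
    using q by (auto simp: continuous_on_def)
  moreover have "at q within S \<inter> U = at q within S"
    by (rule at_within_nhd[OF U(2,1)]) auto
  ultimately show "(f \<longlongrightarrow> f q) (at q within S)"
    by simp
qed

lemma cpair_linear:
  "cpair u (x + y) = cpair u x + cpair u y" "cpair u (x - y) = cpair u x - cpair u y"
  "cpair u (r *\<^sub>R x) = of_real r * cpair u x" "cpair u 0 = 0"
  by (auto simp: cpair_def complex_eq_iff inner_add_right inner_diff_right)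

context affine_kernel
begin

text \<open>Affine independence enters through this lemma: a linear functional is determined by its values on
  differences of states.\<close>

lemma span_differences:
  assumes "x0 \<in> D"
  shows "span ((\<lambda>x. x - x0) ` D) = UNIV"
proof -
  obtain S where S: "S \<subseteq> D" "card S = DIM('v) + 1" "\<not> affine_dependent S"
    using affine_basis by blast
  have "aff_dim S = int (card S) - 1"
    using aff_dim_unique[of S S] S(3) by simp
  then have "affine hull S = UNIV"
    using S(2) aff_dim_eq_full[of S] by simp
  then have "affine hull D = UNIV"
    using hull_mono[OF S(1), of affine] by auto
  then have "{x0 + v |v. v \<in> span {x - x0 |x. x \<in> D - {x0}}} = UNIV"
    using affine_hull_span[OF assms] by simp
  moreover have "{x - x0 |x. x \<in> D - {x0}} \<subseteq> (\<lambda>x. x - x0) ` D"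
    by auto
  ultimately have full: "{x0 + v |v. v \<in> span ((\<lambda>x. x - x0) ` D)} = UNIV"
    using span_mono by blast
  have "w \<in> span ((\<lambda>x. x - x0) ` D)" for w
  proof -
    have "x0 + w \<in> {x0 + v |v. v \<in> span ((\<lambda>x. x - x0) ` D)}"
      unfolding full by simp
    then show ?thesis by auto
  qed
  then show ?thesis by auto
qed

lemma short_time_bound:
  assumes "x0 \<in> D"
  shows "\<exists>h1>0. \<forall>h\<in>{0..h1}. \<forall>v\<in>cball 0 1. norm (cf h v (Some x0) - cis (v \<bullet> x0)) \<le> 1 / 16"
proof -
  have "compact ({0..1::real} \<times> cball (0::'v) 1)"
    by (intro compact_Times) auto
  moreover have "continuous_on ({0..1} \<times> cball 0 1) (\<lambda>(h, v). cf h v (Some x0))"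
    by (rule continuous_on_subset[OF cf_continuous[OF assms]]) auto
  ultimately have "uniformly_continuous_on ({0..1} \<times> cball 0 1) (\<lambda>(h, v). cf h v (Some x0))"
    by (rule compact_uniformly_continuous[rotated])
  then obtain d where d: "0 < d" "\<And>q q'. \<lbrakk>q \<in> {0..1} \<times> cball 0 1; q' \<in> {0..1} \<times> cball 0 1; dist q' q < d\<rbrakk>
      \<Longrightarrow> dist (case q' of (h, v) \<Rightarrow> cf h v (Some x0)) (case q of (h, v) \<Rightarrow> cf h v (Some x0)) < 1 / 16"
    using that unfolding uniformly_continuous_on_def
    by (elim allE[of _ "1 / 16"]) auto
  show ?thesis
  proof (intro exI[of _ "min 1 (d / 2)"] conjI ballI)
    fix h v assume h: "h \<in> {0..min 1 (d / 2)}" and v: "v \<in> cball (0::'v) 1"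
    have "dist (h, v) (0, v) < d"
      using h d(1) by (auto simp: dist_prod_def dist_real_def)
    with d(2)[of "(0, v)" "(h, v)"] h v
    show "norm (cf h v (Some x0) - cis (v \<bullet> x0)) \<le> 1 / 16"
      using assms by (auto simp: cf_at_0 dist_norm)
  qed (use d in auto)
qed

end

section \<open>States with tight laws after short times are bounded\<close>

text \<open>A reference state and a time span in which the transform at the reference state has not moved far
  from its initial value, for all frequencies in the unit ball. There \<open>\<Phi>\<close> has no zeros.\<close>

locale affine_kernel_short_time = affine_kernel D p \<Phi> \<psi>
  for D :: "'v::euclidean_space set" and p \<Phi> \<psi> +
  fixes x0 :: "'v" and h1 :: real
  assumes x0: "x0 \<in> D" and h1_pos: "0 < h1"
    and cf_x0_close: "\<And>h v. \<lbrakk>h \<in> {0..h1}; v \<in> cball 0 1\<rbrakk>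
      \<Longrightarrow> norm (cf h v (Some x0) - cis (v \<bullet> x0)) \<le> 1 / 16"
begin

lemma x0_state: "Some x0 \<in> state_cem D"
  using x0 by (simp add: Some_in_state)

lemma norm_cf_x0_ge:
  assumes "h \<in> {0..h1}" "v \<in> cball 0 1"
  shows "15 / 16 \<le> norm (cf h v (Some x0))"
  using norm_triangle_ineq2[of "cis (v \<bullet> x0)" "cis (v \<bullet> x0) - cf h v (Some x0)"]
    cf_x0_close[OF assms] by (simp add: norm_minus_commute)

lemma mass_x0_ge: "h \<in> {0..h1} \<Longrightarrow> 15 / 16 \<le> mass h (Some x0)"
  using norm_cf_x0_ge[of h 0] norm_cf_le_mass[of h "Some x0" 0] x0_state by force

lemma nonvanishing: "h \<in> {0..h1} \<Longrightarrow> v \<in> cball 0 1 \<Longrightarrow> \<Phi> h (0, v) \<noteq> 0"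
  using norm_cf_x0_ge[of h v] cf_transform[of h x0 v] x0 by auto

lemma mass_pos: "h \<in> {0..h1} \<Longrightarrow> x \<in> D \<Longrightarrow> 0 < mass h (Some x)"
  using nonvanishing[of h 0] cf_transform[of h x 0] cf_zero[of h "Some x"] mass_nonneg[of h "Some x"]
  by (auto simp: Some_in_state less_le)

lemma exponent_at_state_continuous:
  assumes "x \<in> D"
  shows "continuous_on ({0..h1} \<times> cball 0 1) (\<lambda>(h, v). cpair (\<psi> h (0, v)) x)"
proof -
  have c: "continuous_on (nonvanishing_set D \<Phi> 1) (\<lambda>(t, u). cpair (\<psi> t u) x)"
    by (rule continuous_on_if_locally_continuous_on[OF exponent_continuous[OF assms]])
  have "continuous_on ({0..h1} \<times> cball 0 1)
      ((\<lambda>(t, u). cpair (\<psi> t u) x) \<circ> (\<lambda>(h, v). (h, (0, v))))"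
  proof (rule continuous_on_compose[OF _ continuous_on_subset[OF c]])
    show "continuous_on ({0..h1} \<times> cball 0 1) (\<lambda>(h, v). (h, (0 :: 'v, v)))"
      by (auto simp: case_prod_unfold intro!: continuous_intros)
    show "(\<lambda>(h, v). (h, (0, v))) ` ({0..h1} \<times> cball 0 1) \<subseteq> nonvanishing_set D \<Phi> 1"
      using nonvanishing by (auto simp: nonvanishing_set_def bdd_exponents_by_def)
  qed
  then show ?thesis
    by (simp add: comp_def case_prod_unfold)
qed

text \<open>Continuity is assumed for the pairing with states only; by linearity it extends to the span of
  their differences, which is the whole space.\<close>

lemma exponent_continuous_gen:
  "continuous_on ({0..h1} \<times> cball 0 1) (\<lambda>(h, v). cpair (\<psi> h (0, v)) z)" (is "?P z")
proof -
  have "z \<in> span ((\<lambda>x. x - x0) ` D)"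
    using span_differences[OF x0] by simp
  then show ?thesis
  proof (induction rule: span_induct_alt)
    case base
    show ?case by (simp add: cpair_linear case_prod_unfold)
  next
    case (step c x y)
    then obtain x' where x': "x' \<in> D" "x = x' - x0" by auto
    have "continuous_on ({0..h1} \<times> cball 0 1)
        (\<lambda>q. of_real c * ((\<lambda>(h, v). cpair (\<psi> h (0, v)) x') q - (\<lambda>(h, v). cpair (\<psi> h (0, v)) x0) q)
          + (\<lambda>(h, v). cpair (\<psi> h (0, v)) y) q)"
      by (intro continuous_intros exponent_at_state_continuous x' x0 step)
    then show ?case
      by (simp add: x' cpair_linear case_prod_unfold algebra_simps)
  qed
qed

text \<open>Only increments of the exponent in the frequency variable matter; their real and imaginary
  parts are the following vectors.\<close>

definition re_incr :: "real \<Rightarrow> 'v \<Rightarrow> 'v" where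
  "re_incr h v = fst (\<psi> h (0, v)) - fst (\<psi> h (0, 0))"

definition im_incr :: "real \<Rightarrow> 'v \<Rightarrow> 'v" where
  "im_incr h v = snd (\<psi> h (0, v)) - snd (\<psi> h (0, 0))"

lemma re_incr_zero [simp]: "re_incr h 0 = 0" and im_incr_zero [simp]: "im_incr h 0 = 0"
  by (simp_all add: re_incr_def im_incr_def)

lemma cpair_increment:
  "cpair (\<psi> h (0, v)) z - cpair (\<psi> h (0, 0)) z = Complex (re_incr h v \<bullet> z) (im_incr h v \<bullet> z)"
  by (simp add: cpair_def re_incr_def im_incr_def inner_diff_left complex_eq_iff)

lemma
  shows re_incr_continuous: "continuous_on ({0..h1} \<times> cball 0 1) (\<lambda>(h, v). re_incr h v)"
    and im_incr_continuous: "continuous_on ({0..h1} \<times> cball 0 1) (\<lambda>(h, v). im_incr h v)"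
proof -
  let ?I = "{0..h1} \<times> cball (0 :: 'v) 1"
  have z: "continuous_on ?I (\<lambda>q. (\<lambda>(h, v). cpair (\<psi> h (0, v)) b) (fst q, 0))" for b
    by (rule continuous_on_compose2[OF exponent_continuous_gen])
      (auto intro!: continuous_intros)
  have c: "continuous_on ?I (\<lambda>(h, v). cpair (\<psi> h (0, v)) b - cpair (\<psi> h (0, 0)) b)" for b
    using continuous_on_diff[OF exponent_continuous_gen z] by (simp add: case_prod_unfold)
  have "continuous_on ?I (\<lambda>q. Re ((\<lambda>(h, v). cpair (\<psi> h (0, v)) b - cpair (\<psi> h (0, 0)) b) q))"
    "continuous_on ?I (\<lambda>q. Im ((\<lambda>(h, v). cpair (\<psi> h (0, v)) b - cpair (\<psi> h (0, 0)) b) q))" for b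
    by (intro continuous_intros c)+
  then show "continuous_on ?I (\<lambda>(h, v). re_incr h v)" "continuous_on ?I (\<lambda>(h, v). im_incr h v)"
    unfolding cpair_increment
    by (subst continuous_on_componentwise; simp add: case_prod_unfold)+
qed

text \<open>The quotient \<open>(cf h v x / cf h 0 x) / (cf h v x0 / cf h 0 x0)\<close> contains no \<open>\<Phi>\<close>. It is
  written without division.\<close>

lemma transform_increment:
  assumes "h \<in> {0..h1}" "v \<in> cball 0 1" "x \<in> D"
  shows "exp (Complex (re_incr h v \<bullet> (x - x0)) (im_incr h v \<bullet> (x - x0)))
    * (of_real (mass h (Some x)) * cf h v (Some x0)) = cf h v (Some x) * of_real (mass h (Some x0))"
proof -
  have xs: "Some x \<in> state_cem D" and h: "0 \<le> h"
    using assms by (auto simp: Some_in_state)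
  let ?c = "\<lambda>v z. cpair (\<psi> h (0, v)) z"
  have "exp (?c v (x - x0) - ?c 0 (x - x0)) * (exp (?c 0 x) * exp (?c v x0)) = exp (?c v x) * exp (?c 0 x0)"
    unfolding exp_add[symmetric] by (rule arg_cong[of _ _ exp]) (simp add: cpair_linear)
  then have "exp (?c v (x - x0) - ?c 0 (x - x0)) * ((\<Phi> h (0, 0) * exp (?c 0 x)) * (\<Phi> h (0, v) * exp (?c v x0)))
     = (\<Phi> h (0, v) * exp (?c v x)) * (\<Phi> h (0, 0) * exp (?c 0 x0))"
    by algebra
  then show ?thesis
    unfolding cpair_increment cf_zero[OF h xs, symmetric] cf_zero[OF h x0_state, symmetric]
    by (simp only: cf_transform[OF h assms(3)] cf_transform[OF h x0])
qed

text \<open>At time zero the transform is \<open>cis (v \<bullet> x)\<close>, which determines the exponent up to multiples of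
  \<open>2\<pi>i\<close>; continuity along the segment from \<open>0\<close> to \<open>v\<close> excludes these.\<close>

lemma incr_initial:
  assumes v: "v \<in> cball 0 1"
  shows "re_incr 0 v = 0" and "im_incr 0 v = v"
proof -
  have e: "re_incr 0 w \<bullet> (x - x0) = 0 \<and> cis (im_incr 0 w \<bullet> (x - x0) - w \<bullet> (x - x0)) = 1"
    if w: "w \<in> cball 0 1" and x: "x \<in> D" for w x
  proof -
    have m: "mass 0 (Some z) = 1" if "z \<in> D" for z
      using cf_zero[of 0 "Some z"] cf_at_0[OF that, of 0] that by (simp add: Some_in_state complex_eq_iff)
    have e: "exp (Complex (re_incr 0 w \<bullet> (x - x0)) (im_incr 0 w \<bullet> (x - x0))) * cis (w \<bullet> x0) = cis (w \<bullet> x)"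
      using transform_increment[of 0 w x] w x x0 h1_pos by (simp add: m cf_at_0)
    then have "norm (exp (Complex (re_incr 0 w \<bullet> (x - x0)) (im_incr 0 w \<bullet> (x - x0))) * cis (w \<bullet> x0)) = 1"
      by simp
    then have r: "re_incr 0 w \<bullet> (x - x0) = 0"
      by (simp add: norm_mult)
    have "cis (im_incr 0 w \<bullet> (x - x0)) * cis (w \<bullet> x0) = cis (w \<bullet> x)"
      using e unfolding r by (simp add: cis_conv_exp Complex_eq mult.commute)
    then have "cis (im_incr 0 w \<bullet> (x - x0) - w \<bullet> (x - x0)) = 1"
      by (simp add: cis_mult inner_diff_right flip: cis_divide)
    with r show ?thesis by simp
  qed
  have zero: "y = 0" if "\<And>x. x \<in> D \<Longrightarrow> y \<bullet> (x - x0) = 0" for y :: 'v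
  proof -
    have "y \<in> span ((\<lambda>x. x - x0) ` D)"
      using span_differences[OF x0] by simp
    then have "y \<bullet> y = 0"
      by (rule span_induct[where P = "\<lambda>z. y \<bullet> z = 0"])
        (use that in \<open>auto simp: subspace_def inner_add_right\<close>)
    then show ?thesis by simp
  qed
  show "re_incr 0 v = 0"
    using e[OF v] by (intro zero) auto
  have "im_incr 0 v - v = 0"
  proof (rule zero)
    fix x assume x: "x \<in> D"
    define g where "g s = (im_incr 0 (s *\<^sub>R v) - s *\<^sub>R v) \<bullet> (x - x0)" for s :: real
    have sv: "s *\<^sub>R v \<in> cball 0 1" if "s \<in> {0..1}" for s
      using v that by (auto simp: mult_le_one)
    have cg: "cis (g s) = 1" if "s \<in> {0..1}" for s
      using e[OF sv[OF that] x] by (simp add: g_def inner_diff_left)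
    have "continuous_on {0..1} (\<lambda>s. (\<lambda>(h, v). im_incr h v) (0, s *\<^sub>R v))"
      by (rule continuous_on_compose2[OF im_incr_continuous])
        (use sv h1_pos in \<open>auto intro!: continuous_intros\<close>)
    then have "continuous_on {0..1} g"
      unfolding g_def by (auto intro!: continuous_intros)
    then have "\<bar>g 1\<bar> < pi / 2"
      by (rule angle_lt_pi_half) (use cg in \<open>auto simp: g_def complex_eq_iff\<close>)
    moreover have "sin (g 1) = 0"
      using cg[of 1] by (simp add: complex_eq_iff)
    ultimately have "g 1 = 0"
      using sin_gt_zero[of "g 1"] sin_gt_zero[of "- g 1"] by (cases "g 1" "0::real" rule: linorder_cases) auto
    then show "(im_incr 0 v - v) \<bullet> (x - x0) = 0"
      by (simp add: g_def)
  qed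
  then show "im_incr 0 v = v" by simp
qed

lemma re_incr_small:
  assumes "0 < e"
  shows "\<exists>h3>0. h3 \<le> h1 \<and> (\<forall>h\<in>{0..h3}. \<forall>v\<in>cball 0 1. norm (re_incr h v) \<le> e)"
proof -
  have "compact ({0..h1} \<times> cball (0::'v) 1)"
    by (intro compact_Times) auto
  then have "uniformly_continuous_on ({0..h1} \<times> cball 0 1) (\<lambda>(h, v). re_incr h v)"
    by (rule compact_uniformly_continuous[OF re_incr_continuous])
  then obtain d where d: "0 < d" "\<And>q q'. \<lbrakk>q \<in> {0..h1} \<times> cball 0 1; q' \<in> {0..h1} \<times> cball 0 1; dist q' q < d\<rbrakk>
      \<Longrightarrow> dist (case q' of (h, v) \<Rightarrow> re_incr h v) (case q of (h, v) \<Rightarrow> re_incr h v) < e"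
    using that assms unfolding uniformly_continuous_on_def by (elim allE[of _ e]) auto
  show ?thesis
  proof (intro exI[of _ "min h1 (d / 2)"] conjI ballI)
    fix h v assume h: "h \<in> {0..min h1 (d / 2)}" and v: "v \<in> cball (0::'v) 1"
    have "dist (h, v) (0, v) < d"
      using h d(1) by (auto simp: dist_prod_def dist_real_def)
    with d(2)[of "(0, v)" "(h, v)"] h v incr_initial[OF v]
    show "norm (re_incr h v) \<le> e"
      by (auto simp: dist_norm)
  qed (use d h1_pos in auto)
qed


text \<open>The hypothesis is tightness after the time \<open>h\<close>, expressed by Fourier transforms near the frequency
  zero. The space \<open>L\<close> below consists of the vectors whose pairing with the sequence is bounded.
  For small \<open>h\<close> the set of frequencies at which the increments lie in \<open>L + iL\<close> contains zero and is
  stable under steps of a fixed length, so it contains the unit ball; as \<open>h \<rightarrow> 0\<close> the increments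
  tend to \<open>iv\<close>, whence \<open>v \<in> L\<close>.\<close>

lemma bounded_if_equicontinuous_at_zero:
  assumes x: "\<And>k. x k \<in> D" and h2: "0 < h2" "h2 \<le> h1"
    and equi: "\<And>h. \<lbrakk>0 < h; h \<le> h2\<rbrakk> \<Longrightarrow> \<exists>\<rho>>0. \<forall>\<^sub>F k in sequentially. \<forall>v. norm v \<le> \<rho> \<longrightarrow>
      norm (cf h v (Some (x k)) - of_real (mass h (Some (x k)))) \<le> mass h (Some (x k)) / 32"
  shows "bounded (range x)"
proof -
  define z where "z k = x k - x0" for k
  define L where "L = {w. \<exists>K. \<forall>k. \<bar>w \<bullet> z k\<bar> \<le> K}"
  have xs: "Some (x k) \<in> state_cem D" for k
    using x by (simp add: Some_in_state)
  have subL: "subspace L"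
    and evL: "\<And>w K. (\<forall>\<^sub>F k in sequentially. \<bar>w \<bullet> z k\<bar> \<le> K) \<Longrightarrow> w \<in> L"
    unfolding L_def by (rule subspace_bounded_functionals, rule eventually_bounded_functional)
  obtain B where B: "0 \<le> B" "\<And>w k. w \<in> L \<Longrightarrow> \<bar>w \<bullet> z k\<bar> \<le> B * norm w"
    using bounded_functionals_uniform[of z] unfolding L_def by blast
  \<comment> \<open>Up to the time \<open>h3\<close>, a real increment in \<open>L\<close> pairs with the sequence to at most \<open>1/16\<close>.\<close>
  obtain h3 where h3: "0 < h3" "h3 \<le> h1"
    "\<And>h v. \<lbrakk>h \<in> {0..h3}; v \<in> cball 0 1\<rbrakk> \<Longrightarrow> norm (re_incr h v) \<le> 1 / (16 * (B + 1))"
    using re_incr_small[of "1 / (16 * (B + 1))"] B(1) by auto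
  define h4 where "h4 = min h2 h3"
  have h4: "0 < h4" "h4 \<le> h1" "h4 \<le> h2" "h4 \<le> h3"
    using h2 h3 by (auto simp: h4_def)
  have good: "im_incr h v \<in> L" if h: "0 < h" "h \<le> h4" and v: "v \<in> cball 0 1" for h v
  proof -
    have hI: "h \<in> {0..h1}" and h0: "0 \<le> h"
      using h h4 by auto
    define G where "G w \<longleftrightarrow> re_incr h w \<in> L \<and> im_incr h w \<in> L" for w
    define m where "m k = mass h (Some (x k))" for k
    define f where "f w k = cf h w (Some (x k))" for w k
    define m0 where "m0 = mass h (Some x0)"
    define f0 where "f0 w = cf h w (Some x0)" for w
    have mpos: "0 < m k" for k
      unfolding m_def by (rule mass_pos[OF hI x])
    have m0: "15 / 16 \<le> m0" "m0 \<le> 1"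
      unfolding m0_def using mass_x0_ge[OF hI] mass_le_1[OF h0 x0_state] by auto
    have f0: "15 / 16 \<le> norm (f0 w)" if "w \<in> cball 0 1" for w
      unfolding f0_def by (rule norm_cf_x0_ge[OF hI that])
    obtain \<rho>1 where r1: "0 < \<rho>1" "\<forall>\<^sub>F k in sequentially. \<forall>w. norm w \<le> \<rho>1 \<longrightarrow> norm (f w k - of_real (m k)) \<le> m k / 32"
      unfolding f_def m_def using equi[OF h(1)] h h4 by (meson order_trans)
    obtain \<rho>2 where r2: "0 < \<rho>2" "\<And>w. norm w \<le> \<rho>2 \<Longrightarrow> norm (f0 w - of_real m0) \<le> m0 / 32"
    proof -
      have "continuous_on UNIV (\<lambda>w. (\<lambda>(h, v). cf h v (Some x0)) (h, w))"
        by (rule continuous_on_compose2[OF cf_continuous[OF x0]]) (use h0 in \<open>auto intro!: continuous_intros\<close>)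
      then have "isCont f0 0"
        by (simp add: f0_def[abs_def] continuous_on_eq_continuous_at)
      moreover have "f0 0 = of_real m0"
        using cf_zero[OF h0 x0_state] by (simp add: f0_def m0_def)
      moreover have "0 < m0 / 32"
        using m0 by simp
      ultimately obtain d where "0 < d" "\<And>w. dist w 0 < d \<Longrightarrow> dist (f0 w) (of_real m0) < m0 / 32"
        unfolding continuous_at_eps_delta by metis
      then show ?thesis
        by (intro that[of "d / 2"]) (auto simp: dist_norm intro: less_imp_le)
    qed
    define \<rho> where "\<rho> = min \<rho>1 \<rho>2"
    have rho: "0 < \<rho>" "\<rho> \<le> \<rho>1" "\<rho> \<le> \<rho>2"
      using r1 r2 by (auto simp: \<rho>_def)
    have close0: "norm (f0 w' - f0 w) \<le> m0 / 4" if "norm (w' - w) \<le> \<rho>" for w w'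
    proof -
      have "norm (f0 (w' - w) - of_real m0) \<le> m0 / 32"
        using r2(2) that rho by simp
      then have "m0 - Re (f0 (w' - w)) \<le> m0 / 32"
        using abs_Re_le_cmod[of "f0 (w' - w) - of_real m0"] by simp
      then show ?thesis
        using cf_diff_quadratic[OF h0 x0_state, of w' w] by (simp add: f0_def m0_def)
    qed
    \<comment> \<open>Four times \<open>1/32\<close> plus \<open>1/8\<close> is \<open>1/4\<close>: closeness at zero yields equicontinuity at all frequencies.\<close>
    have closek: "\<forall>\<^sub>F k in sequentially. \<forall>w w'. norm (w' - w) \<le> \<rho> \<longrightarrow> norm (f w' k - f w k) \<le> m k / 4"
      using r1(2)
    proof eventually_elim
      case (elim k)
      show ?case
      proof (intro allI impI)
        fix w w' :: 'v assume "norm (w' - w) \<le> \<rho>"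
        then have "norm (f (w' - w) k - of_real (m k)) \<le> m k / 32"
          using elim rho by simp
        then have "m k - Re (f (w' - w) k) \<le> m k / 32"
          using abs_Re_le_cmod[of "f (w' - w) k - of_real (m k)"] by simp
        then show "norm (f w' k - f w k) \<le> m k / 4"
          using cf_diff_quadratic[OF h0 xs[of k], of w' w] by (simp add: f_def m_def)
      qed
    qed
    have incr: "exp (Complex (re_incr h w \<bullet> z k) (im_incr h w \<bullet> z k)) = (f w k / of_real (m k)) / (f0 w / of_real m0)"
      if "w \<in> cball 0 1" for w k
    proof -
      have "f0 w \<noteq> 0" using f0[OF that] by auto
      moreover have "of_real (m k) \<noteq> (0::complex)"
        using mpos[of k] by simp
      moreover have "exp (Complex (re_incr h w \<bullet> z k) (im_incr h w \<bullet> z k)) * (of_real (m k) * f0 w) = f w k * of_real m0"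
        unfolding f_def f0_def m_def m0_def z_def by (rule transform_increment[OF hI that x])
      ultimately show ?thesis
        by (simp add: field_simps)
    qed
    \<comment> \<open>The factor \<open>7/8\<close> comes from \<open>(15/16)\<^sup>2 \<ge> 7/8\<close>.\<close>
    have large: "7 / 8 * m k \<le> norm (f w k)" if w: "w \<in> cball 0 1" and G: "G w" for w k
    proof -
      have "\<bar>re_incr h w \<bullet> z k\<bar> \<le> B * norm (re_incr h w)"
        using B(2) G by (simp add: G_def)
      also have "\<dots> \<le> (B + 1) * (1 / (16 * (B + 1)))"
        using h3(3)[of h w] h h4 w B(1) by (intro mult_mono) auto
      also have "\<dots> = 1 / 16"
        using B(1) by simp
      finally have "15 / 16 \<le> 1 + re_incr h w \<bullet> z k" by linarith
      also have "\<dots> \<le> exp (re_incr h w \<bullet> z k)"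
        by (rule exp_ge_add_one_self)
      also have "\<dots> = norm (exp (Complex (re_incr h w \<bullet> z k) (im_incr h w \<bullet> z k)))"
        by simp
      also have "\<dots> = (norm (f w k) * m0) / (m k * norm (f0 w))"
        unfolding incr[OF w] using mpos[of k] m0 by (simp add: norm_divide norm_mult)
      finally have le: "15 / 16 \<le> (norm (f w k) * m0) / (m k * norm (f0 w))" .
      have "0 < norm (f0 w)"
        using f0[OF w] by linarith
      then have "0 < m k * norm (f0 w)"
        using mpos[of k] by simp
      with le have "15 / 16 * (m k * norm (f0 w)) \<le> norm (f w k) * m0"
        by (simp add: pos_le_divide_eq)
      also have "\<dots> \<le> norm (f w k) * 1"
        by (intro mult_left_mono m0) simp
      finally have "15 / 16 * (m k * norm (f0 w)) \<le> norm (f w k)" by simp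
      moreover have "15 / 16 * (m k * (15 / 16)) \<le> 15 / 16 * (m k * norm (f0 w))"
        using f0[OF w] mpos[of k] by (intro mult_left_mono) auto
      ultimately show ?thesis
        using mpos[of k] by linarith
    qed
    \<comment> \<open>Along the segment from \<open>w\<close> to \<open>w'\<close> both transforms change by a factor near one, so the argument of their quotient cannot wind.\<close>
    have step: "G w'" if w: "w \<in> cball 0 1" and w': "w' \<in> cball 0 1" and n: "norm (w' - w) \<le> \<rho>" and G: "G w" for w w'
    proof -
      define ws where "ws s = w + s *\<^sub>R (w' - w)" for s :: real
      have wsI: "ws s \<in> cball 0 1" if "s \<in> {0..1}" for s
      proof -
        have "ws s = (1 - s) *\<^sub>R w + s *\<^sub>R w'"
          by (simp add: ws_def algebra_simps)
        moreover have "(1 - s) *\<^sub>R w + s *\<^sub>R w' \<in> cball 0 1"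
          using that by (intro convexD[OF convex_cball w w']) auto
        ultimately show ?thesis by simp
      qed
      have wsn: "norm (ws s - w) \<le> \<rho>" if "s \<in> {0..1}" for s
      proof -
        have "norm (ws s - w) = s * norm (w' - w)"
          using that by (simp add: ws_def)
        also have "\<dots> \<le> 1 * norm (w' - w)"
          using that by (intro mult_right_mono) auto
        finally show ?thesis using n by simp
      qed
      have ev: "\<forall>\<^sub>F k in sequentially. \<bar>(re_incr h w' - re_incr h w) \<bullet> z k\<bar> \<le> 2
          \<and> \<bar>(im_incr h w' - im_incr h w) \<bullet> z k\<bar> \<le> pi / 2"
        using closek
      proof eventually_elim
        case (elim k)
        define E where "E u = exp (Complex (re_incr h u \<bullet> z k) (im_incr h u \<bullet> z k))" for u
        have fw: "7 / 8 * m k \<le> norm (f w k)" by (rule large[OF w G])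
        then have fw0: "f w k \<noteq> 0" using mpos[of k] by auto
        have f0w0: "f0 w \<noteq> 0" using f0[OF w] by auto
        have quot: "E (ws s) / E w = (f (ws s) k / f w k) / (f0 (ws s) / f0 w)" if s: "s \<in> {0..1}" for s
          unfolding E_def incr[OF wsI[OF s]] incr[OF w] using mpos[of k] m0 fw0 f0w0
          by (simp add: field_simps)
        have a: "norm (f (ws s) k / f w k - 1) \<le> 1 / 2" if s: "s \<in> {0..1}" for s
        proof -
          have "norm (f (ws s) k / f w k - 1) = norm (f (ws s) k - f w k) / norm (f w k)"
            using fw0 by (simp add: diff_divide_distrib flip: norm_divide)
          also have "\<dots> \<le> 1 / 2"
            using elim wsn[OF s] fw fw0 mpos[of k] by (simp add: pos_divide_le_eq) (smt (verit))
          finally show ?thesis .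
        qed
        have b: "norm (f0 (ws s) / f0 w - 1) \<le> 1 / 2" if s: "s \<in> {0..1}" for s
        proof -
          have "norm (f0 (ws s) / f0 w - 1) = norm (f0 (ws s) - f0 w) / norm (f0 w)"
            using f0w0 by (simp add: diff_divide_distrib flip: norm_divide)
          also have "\<dots> \<le> 1 / 2"
            using close0[OF wsn[OF s]] f0[OF w] f0w0 m0 by (simp add: pos_divide_le_eq)
          finally show ?thesis .
        qed
        have AB: "0 < Re (E (ws s) / E w)" "norm (E (ws s) / E w) \<le> 3" "1 / 3 \<le> norm (E (ws s) / E w)"
          if s: "s \<in> {0..1}" for s
          unfolding quot[OF s] by (rule ratio_of_numbers_near_one[OF a[OF s] b[OF s]])+
        have EE: "E u / E w = exp (Complex ((re_incr h u - re_incr h w) \<bullet> z k) ((im_incr h u - im_incr h w) \<bullet> z k))" for u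
          unfolding E_def exp_diff[symmetric] by (rule arg_cong[of _ _ exp]) (simp add: complex_eq_iff inner_diff_left)
        define g where "g s = (im_incr h (ws s) - im_incr h w) \<bullet> z k" for s
        have "continuous_on {0..1} (\<lambda>s. (\<lambda>(h, v). im_incr h v) (h, ws s))"
          by (rule continuous_on_compose2[OF im_incr_continuous])
            (use wsI hI in \<open>auto simp: ws_def intro!: continuous_intros\<close>)
        then have "continuous_on {0..1} g"
          unfolding g_def by (auto intro!: continuous_intros)
        then have "\<bar>g 1\<bar> < pi / 2"
        proof (rule angle_lt_pi_half)
          show "g 0 = 0" by (simp add: g_def ws_def)
          show "0 < cos (g s)" if s: "s \<in> {0..1}" for s
            using AB(1)[OF s] unfolding EE by (simp add: Re_exp g_def zero_less_mult_iff)
        qed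
        moreover have "ws 1 = w'" by (simp add: ws_def)
        moreover have "\<bar>(re_incr h w' - re_incr h w) \<bullet> z k\<bar> \<le> 2"
        proof -
          let ?r = "(re_incr h w' - re_incr h w) \<bullet> z k"
          have "exp ?r \<le> 3" "1 / 3 \<le> exp ?r"
            using AB(2,3)[of 1] unfolding EE \<open>ws 1 = w'\<close> by auto
          then have "exp ?r \<le> 3" "exp (- ?r) \<le> 3"
            by (auto simp: exp_minus field_simps)
          then show ?thesis
            using exp_ge_add_one_self[of ?r] exp_ge_add_one_self[of "- ?r"] by linarith
        qed
        ultimately show ?case
          by (simp add: g_def)
      qed
      have "re_incr h w' - re_incr h w \<in> L"
        by (rule evL[of _ 2]) (use ev in \<open>auto elim: eventually_mono\<close>)
      moreover have "im_incr h w' - im_incr h w \<in> L"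
        by (rule evL[of _ "pi / 2"]) (use ev in \<open>auto elim: eventually_mono\<close>)
      ultimately show ?thesis
        using G subspace_add[OF subL, of "re_incr h w' - re_incr h w" "re_incr h w"]
          subspace_add[OF subL, of "im_incr h w' - im_incr h w" "im_incr h w"]
        by (simp add: G_def)
    qed
    \<comment> \<open>The step length \<open>\<rho>\<close> depends on \<open>h\<close> but not on \<open>k\<close>, so finitely many steps suffice for all \<open>k\<close> at once.\<close>
    obtain n :: nat where n: "1 / \<rho> < real n"
      using reals_Archimedean2 by blast
    have n0: "0 < n"
      using n rho(1) by (metis divide_pos_pos not_gr_zero of_nat_0 order_less_asym zero_less_one)
    have nr: "1 / real n \<le> \<rho>"
      using n n0 rho(1) by (simp add: field_simps)
    have vn: "norm v \<le> 1" using v by simp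
    have I: "(real i / real n) *\<^sub>R v \<in> cball 0 1" if "i \<le> n" for i
    proof -
      have "real i / real n * norm v \<le> 1 * 1"
        using that n0 vn by (intro mult_mono) auto
      then show ?thesis by simp
    qed
    have "G ((real i / real n) *\<^sub>R v)" if "i \<le> n" for i
      using that
    proof (induction i)
      case 0
      show ?case by (simp add: G_def subspace_0[OF subL])
    next
      case (Suc i)
      show ?case
      proof (rule step[OF I I])
        have "(real (Suc i) / real n) *\<^sub>R v - (real i / real n) *\<^sub>R v = (1 / real n) *\<^sub>R v"
          by (simp flip: scaleR_diff_left diff_divide_distrib)
        also have "norm \<dots> \<le> 1 / real n"
          using vn n0 by (simp add: divide_right_mono)
        finally show "norm ((real (Suc i) / real n) *\<^sub>R v - (real i / real n) *\<^sub>R v) \<le> \<rho>"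
          using nr by simp
      qed (use Suc in auto)
    qed
    from this[of n] n0 show ?thesis
      by (simp add: G_def)
  qed
  have vL: "v \<in> L" if v: "v \<in> cball 0 1" for v
  proof -
    have "continuous_on {0..h1} (\<lambda>h. (\<lambda>(h, v). im_incr h v) (h, v))"
      by (rule continuous_on_compose2[OF im_incr_continuous]) (use v in \<open>auto intro!: continuous_intros\<close>)
    then have "((\<lambda>h. im_incr h v) \<longlongrightarrow> im_incr 0 v) (at 0 within {0..h1})"
      using h1_pos by (auto simp: continuous_on_def)
    then have t1: "((\<lambda>h. im_incr h v) \<longlongrightarrow> v) (at 0 within {0<..<h4})"
      unfolding incr_initial(2)[OF v] by (rule tendsto_within_subset) (use h4 in auto)
    have t2: "at 0 within {0<..<h4} \<noteq> bot"
      using h4(1) by (simp add: trivial_limit_within islimpt_greaterThanLessThan1)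
    have t3: "\<forall>\<^sub>F h in at 0 within {0<..<h4}. im_incr h v \<in> L"
      using good[OF _ _ v] by (auto simp: eventually_at_filter)
    show ?thesis
      by (rule Lim_in_closed_set[OF closed_subspace[OF subL] t3 t2 t1])
  qed
  have all: "w \<in> L" for w
  proof (cases "w = 0")
    case True
    then show ?thesis using subspace_0[OF subL] by simp
  next
    case False
    then have "norm w *\<^sub>R (inverse (norm w) *\<^sub>R w) \<in> L"
      by (intro subspace_scale[OF subL] vL) simp
    with False show ?thesis by simp
  qed
  have "norm (z k) \<le> B" for k
  proof -
    have "norm (z k) * norm (z k) \<le> B * norm (z k)"
      using B(2)[OF all, of "z k" k] by (simp add: power2_norm_eq_inner flip: power2_eq_square)
    then show ?thesis
      using B(1) by (cases "z k = 0") auto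
  qed
  then have "norm (x k) \<le> B + norm x0" for k
    using norm_triangle_ineq[of "z k" x0] by (simp add: z_def) (smt (verit, best))
  then show ?thesis
    by (auto simp: bounded_iff)
qed

end

section \<open>Limit points of paths along dyadic times\<close>

definition dyadic_times :: "real set" where
  "dyadic_times = {real j / 2 ^ n | j n. True}"

lemma dyadic_times_nonneg: "q \<in> dyadic_times \<Longrightarrow> 0 \<le> q"
  by (auto simp: dyadic_times_def)

lemma countable_dyadic_times: "countable dyadic_times"
proof -
  have eq: "dyadic_times = (\<lambda>(j, n). real j / 2 ^ n) ` (UNIV :: (nat \<times> nat) set)"
    by (auto simp: dyadic_times_def)
  show ?thesis unfolding eq by (intro countable_image countableI_type)
qed

lemma dyadic_times_dense:
  assumes "0 \<le> a" "a < b"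
  obtains q where "q \<in> dyadic_times" "a < q" "q < b"
proof -
  obtain n where n: "inverse (b - a) < 2 ^ n"
    using real_arch_pow[of 2 "inverse (b - a)"] by auto
  then have n': "1 / 2 ^ n < b - a"
    using assms by (simp add: field_simps)
  define j where "j = nat \<lfloor>a * 2 ^ n\<rfloor> + 1"
  have "real j = of_int \<lfloor>a * 2 ^ n\<rfloor> + 1"
    using assms(1) by (simp add: j_def)
  then have "a * 2 ^ n < real j" "real j \<le> a * 2 ^ n + 1"
    by linarith+
  then have "a < real j / 2 ^ n" "real j / 2 ^ n \<le> a + 1 / 2 ^ n"
    by (simp_all add: field_simps)
  then show ?thesis
    using n' by (intro that[of "real j / 2 ^ n"]) (auto simp: dyadic_times_def)
qed

lemma dyadic_times_limit:
  assumes "0 \<le> t" "S = {t<..} \<or> S = {..<t} \<and> 0 < t"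
  shows "t islimpt (dyadic_times \<inter> S)"
  unfolding islimpt_approachable
proof (intro allI impI)
  fix e :: real assume e: "0 < e"
  show "\<exists>q\<in>dyadic_times \<inter> S. q \<noteq> t \<and> dist q t < e"
    using assms(2)
  proof (elim disjE conjE)
    assume S: "S = {t<..}"
    obtain q where "q \<in> dyadic_times" "t < q" "q < t + e"
      using dyadic_times_dense[of t "t + e"] assms(1) e by auto
    then show ?thesis using S by (auto intro!: bexI[of _ q] simp: dist_real_def)
  next
    assume S: "S = {..<t}" "0 < t"
    obtain q where "q \<in> dyadic_times" "max 0 (t - e) < q" "q < t"
      using dyadic_times_dense[of "max 0 (t - e)" t] S e by auto
    then show ?thesis using S by (auto intro!: bexI[of _ q] simp: dist_real_def)
  qed
qed

text \<open>Otherwise a subsequence stays away from \<open>y\<close>, and by compactness it has a further limit point.\<close>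

lemma tendsto_if_unique_limit_point:
  fixes x :: "nat \<Rightarrow> 'a::euclidean_space"
  assumes "bounded (range x)" "\<And>r y'. strict_mono r \<Longrightarrow> (x \<circ> r) \<longlonglongrightarrow> y' \<Longrightarrow> y' = y"
  shows "x \<longlonglongrightarrow> y"
proof (rule ccontr)
  assume "\<not> ?thesis"
  then obtain e where e: "0 < e" "\<not> (\<forall>\<^sub>F k in sequentially. dist (x k) y < e)"
    by (auto simp: tendsto_iff)
  then have "\<exists>\<^sub>F k in sequentially. e \<le> dist (x k) y"
    by (simp add: not_eventually not_less)
  then have inf: "infinite {k. e \<le> dist (x k) y}"
    by (simp add: frequently_cofinite flip: cofinite_eq_sequentially)
  define r where "r = enumerate {k. e \<le> dist (x k) y}"
  have r: "strict_mono r" "\<And>k. e \<le> dist (x (r k)) y"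
    using strict_mono_enumerate[OF inf] enumerate_in_set[OF inf] by (auto simp: r_def)
  have "bounded (range (x \<circ> r))"
    by (rule bounded_subset[OF assms(1)]) auto
  then obtain y' r' where r': "strict_mono r'" "((x \<circ> r) \<circ> r') \<longlonglongrightarrow> y'"
    using bounded_imp_convergent_subsequence by blast
  have "(x \<circ> (r \<circ> r')) \<longlonglongrightarrow> y'"
    using r'(2) by (simp add: o_assoc)
  then have "y' = y"
    by (rule assms(2)[OF strict_mono_o[OF r(1) r'(1)]])
  with r'(2) e(1) have "\<forall>\<^sub>F k in sequentially. dist (x (r (r' k))) y < e"
    by (auto simp: tendsto_iff)
  then obtain k where "dist (x (r (r' k))) y < e"
    unfolding eventually_sequentially by blast
  with r(2)[of "r' k"] show False
    by simp
qed

context affine_kernel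
begin

definition tail_mass :: "real \<Rightarrow> real \<Rightarrow> 'v option \<Rightarrow> real" where
  "tail_mass R h y = measure (p h y) (Some ` {\<xi> \<in> D. R < norm \<xi>})"

lemma tail_set_measurable: "Some ` {\<xi> \<in> D. R < norm \<xi>} \<in> sets (state_algebra D)"
proof -
  have "{x. Some x \<in> Some ` {\<xi> \<in> D. R < norm \<xi>}} = D \<inter> {\<xi>. R < norm \<xi>}"
    by auto
  moreover have "D \<inter> {\<xi>. R < norm \<xi>} \<in> sets borel"
    using closed_D by (intro sets.Int borel_closed borel_open open_Collect_less continuous_intros) auto
  ultimately show ?thesis
    by (auto simp: sets_state_algebra[OF closed_D] state_cem_def)
qed

text \<open>The case \<open>n = 0\<close> of the third condition is the frequency zero, since \<open>1 / 0 = 0\<close>; there it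
  speaks of the survival probabilities.\<close>

definition good_path :: "(real \<Rightarrow> 'v option) \<Rightarrow> bool" where
  "good_path \<gamma> \<longleftrightarrow>
     (\<forall>T\<in>dyadic_times. \<gamma> T \<noteq> None \<longrightarrow>
        (\<exists>m>0. \<forall>q\<in>dyadic_times. q \<le> T \<longrightarrow> m \<le> mass (T - q) (\<gamma> q))) \<and>
     (\<forall>T\<in>dyadic_times. \<forall>e>0. \<exists>R. \<forall>q\<in>dyadic_times. q \<le> T \<longrightarrow> tail_mass R (T - q) (\<gamma> q) \<le> e) \<and>
     (\<forall>T\<in>dyadic_times. \<forall>b\<in>Basis. \<forall>n. \<forall>t. \<forall>S\<in>{{t<..}, {..<t}}. \<forall>e>0. \<exists>\<delta>>0.
        \<forall>q\<in>dyadic_times \<inter> S. \<forall>q'\<in>dyadic_times \<inter> S.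
          q \<le> T \<and> q' \<le> T \<and> dist q t < \<delta> \<and> dist q' t < \<delta> \<longrightarrow>
          norm (cf (T - q) ((1 / real n) *\<^sub>R b) (\<gamma> q) - cf (T - q') ((1 / real n) *\<^sub>R b) (\<gamma> q')) \<le> e)"

end

context affine_kernel_short_time
begin

text \<open>The exponential form makes the dependence on the state explicit, so joint continuity reduces to the
  reference state.\<close>

lemma cf_jointly_continuous:
  "continuous_on ({0..h1} \<times> cball 0 1 \<times> D) (\<lambda>(h, v, y). cf h v (Some y))"
proof -
  let ?K = "{0..h1} \<times> cball (0 :: 'v) 1 \<times> D"
  have e: "cf h v (Some y) = cf h v (Some x0) * exp (\<Sum>b\<in>Basis. of_real ((y - x0) \<bullet> b) * cpair (\<psi> h (0, v)) b)"
    if "h \<in> {0..h1}" "v \<in> cball 0 1" "y \<in> D" for h v y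
  proof -
    let ?L = "cpair (\<psi> h (0, v))"
    have lin: "?L (\<Sum>b\<in>A. c b *\<^sub>R b) = (\<Sum>b\<in>A. of_real (c b) * ?L b)" if "finite A" for A c
      using that by induction (simp_all add: cpair_linear)
    have "?L (y - x0) = (\<Sum>b\<in>Basis. of_real ((y - x0) \<bullet> b) * ?L b)"
      using lin[OF finite_Basis, of "\<lambda>b. (y - x0) \<bullet> b"] by (simp only: euclidean_representation)
    then have "?L y = ?L x0 + (\<Sum>b\<in>Basis. of_real ((y - x0) \<bullet> b) * ?L b)"
      by (simp add: cpair_linear diff_eq_eq add.commute)
    then have "exp (?L y) = exp (?L x0) * exp (\<Sum>b\<in>Basis. of_real ((y - x0) \<bullet> b) * ?L b)"
      by (simp add: exp_add)
    then show ?thesis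
      using that x0 by (simp add: cf_transform)
  qed
  have c1: "continuous_on ?K (\<lambda>q. (\<lambda>(h, v). cf h v (Some x0)) (fst q, fst (snd q)))"
    by (rule continuous_on_compose2[OF cf_continuous[OF x0]]) (auto intro!: continuous_intros)
  have c2: "continuous_on ?K (\<lambda>q. (\<lambda>(h, v). cpair (\<psi> h (0, v)) b) (fst q, fst (snd q)))" for b
    by (rule continuous_on_compose2[OF exponent_continuous_gen]) (auto intro!: continuous_intros)
  have "continuous_on ?K (\<lambda>q. (\<lambda>(h, v). cf h v (Some x0)) (fst q, fst (snd q)) *
      exp (\<Sum>b\<in>Basis. of_real ((snd (snd q) - x0) \<bullet> b) * (\<lambda>(h, v). cpair (\<psi> h (0, v)) b) (fst q, fst (snd q))))"
    by (intro continuous_intros c1 c2)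
  then show ?thesis
    by (rule continuous_on_eq) (auto simp: e)
qed

lemma tendsto_cf:
  assumes h: "h \<longlonglongrightarrow> h'" and x: "x \<longlonglongrightarrow> x'" and v: "v \<in> cball 0 1"
    and D: "\<And>k. x k \<in> D" and I: "\<forall>\<^sub>F k in sequentially. h k \<in> {0..h1}"
  shows "(\<lambda>k. cf (h k) v (Some (x k))) \<longlonglongrightarrow> cf h' v (Some x')"
proof -
  have x'D: "x' \<in> D"
    using closed_sequentially[OF closed_D] D x by blast
  have h'I: "h' \<in> {0..h1}"
    using Lim_in_closed_set[OF closed_atLeastAtMost I _ h] by simp
  have "(\<lambda>k. (\<lambda>(h, v, y). cf h v (Some y)) (h k, v, x k)) \<longlonglongrightarrow> (\<lambda>(h, v, y). cf h v (Some y)) (h', v, x')"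
  proof (rule continuous_on_tendsto_compose[OF cf_jointly_continuous])
    show "(\<lambda>k. (h k, v, x k)) \<longlonglongrightarrow> (h', v, x')"
      by (intro tendsto_intros h x)
    show "(h', v, x') \<in> {0..h1} \<times> cball 0 1 \<times> D"
      using h'I v x'D by simp
    show "\<forall>\<^sub>F k in sequentially. (h k, v, x k) \<in> {0..h1} \<times> cball 0 1 \<times> D"
      using I by eventually_elim (use v D in auto)
  qed
  then show ?thesis by simp
qed

lemma mass_lower_bound:
  "\<exists>c>0. \<forall>s\<in>{0..h1}. \<forall>y\<in>D \<inter> cball 0 R. c \<le> mass s (Some y)"
proof (cases "D \<inter> cball 0 R = {}")
  case False
  let ?K = "{0..h1} \<times> {0 :: 'v} \<times> (D \<inter> cball 0 R)"
  have "compact ?K"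
    using closed_D by (intro compact_Times closed_Int_compact) auto
  moreover have "?K \<noteq> {}"
    using False h1_pos by auto
  moreover have "continuous_on ?K (\<lambda>q. Re ((\<lambda>(h, v, y). cf h v (Some y)) q))"
    by (intro continuous_intros continuous_on_subset[OF cf_jointly_continuous]) auto
  ultimately have "\<exists>q\<in>?K. \<forall>q'\<in>?K.
      Re ((\<lambda>(h, v, y). cf h v (Some y)) q) \<le> Re ((\<lambda>(h, v, y). cf h v (Some y)) q')"
    by (rule continuous_attains_inf)
  then obtain q where q: "q \<in> ?K" "\<And>q'. q' \<in> ?K \<Longrightarrow>
      Re ((\<lambda>(h, v, y). cf h v (Some y)) q) \<le> Re ((\<lambda>(h, v, y). cf h v (Some y)) q')"
    by blast
  obtain s y where sy: "q = (s, 0, y)" "s \<in> {0..h1}" "y \<in> D"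
    using q(1) by auto
  have m: "Re (cf s 0 (Some y)) = mass s (Some y)" if "s \<in> {0..h1}" "y \<in> D" for s y
    using that by (subst cf_zero) (auto simp: Some_in_state)
  show ?thesis
  proof (intro exI[of _ "mass s (Some y)"] conjI ballI)
    show "0 < mass s (Some y)"
      by (rule mass_pos[OF sy(2,3)])
    fix s' y' assume "s' \<in> {0..h1}" "y' \<in> D \<inter> cball 0 R"
    with q(2)[of "(s', 0, y')"] show "mass s (Some y) \<le> mass s' (Some y')"
      using sy by (simp add: m)
  qed
qed (auto intro: exI[of _ 1])

lemma cf_equicontinuous:
  assumes "0 < \<eta>"
  shows "\<exists>\<rho>>0. \<forall>s\<in>{0..h1}. \<forall>y\<in>D \<inter> cball 0 R. \<forall>v. norm v \<le> \<rho> \<longrightarrow>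
    norm (cf s v (Some y) - cf s 0 (Some y)) \<le> \<eta>"
proof -
  let ?K = "{0..h1} \<times> cball (0 :: 'v) 1 \<times> (D \<inter> cball 0 R)"
  have "compact ?K"
    using closed_D by (intro compact_Times closed_Int_compact) auto
  moreover have "continuous_on ?K (\<lambda>(h, v, y). cf h v (Some y))"
    by (rule continuous_on_subset[OF cf_jointly_continuous]) auto
  ultimately have "uniformly_continuous_on ?K (\<lambda>(h, v, y). cf h v (Some y))"
    by (rule compact_uniformly_continuous[rotated])
  then obtain d where d: "0 < d" "\<And>q q'. \<lbrakk>q \<in> ?K; q' \<in> ?K; dist q' q < d\<rbrakk>
      \<Longrightarrow> dist (case q' of (h, v, y) \<Rightarrow> cf h v (Some y)) (case q of (h, v, y) \<Rightarrow> cf h v (Some y)) < \<eta>"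
    using that assms unfolding uniformly_continuous_on_def by (elim allE[of _ \<eta>]) auto
  show ?thesis
  proof (intro exI[of _ "min 1 (d / 2)"] conjI ballI allI impI)
    fix s y v assume s: "s \<in> {0..h1}" and y: "y \<in> D \<inter> cball 0 R" and v: "norm (v::'v) \<le> min 1 (d / 2)"
    have "dist (s, v, y) (s, 0, y) < d"
      using v d(1) by (simp add: dist_prod_def)
    with d(2)[of "(s, 0, y)" "(s, v, y)"] s y v
    show "norm (cf s v (Some y) - cf s 0 (Some y)) \<le> \<eta>"
      by (auto simp: dist_norm)
  qed (use d in auto)
qed

text \<open>Tightness is known for the laws after \<open>u k = T - q k\<close>, which varies with \<open>k\<close>, while
  \<open>bounded_if_equicontinuous_at_zero\<close> needs one fixed time \<open>h\<close>. The gap \<open>h - u k\<close> is bridged by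
  Chapman--Kolmogorov: on a ball that carries almost all the mass after \<open>u k\<close>, the transforms
  after the remaining time are equicontinuous and the survival probabilities are bounded below.\<close>

lemma tightness_propagates:
  assumes x: "\<And>k. x k \<in> D" and m: "0 < m"
    and u: "\<forall>\<^sub>F k in sequentially. 0 \<le> u k \<and> u k \<le> h \<and> h - u k \<le> h1"
    and mass: "\<forall>\<^sub>F k in sequentially. m \<le> mass (u k) (Some (x k))"
    and tail: "\<And>e. 0 < e \<Longrightarrow> \<exists>R. \<forall>\<^sub>F k in sequentially. tail_mass R (u k) (Some (x k)) \<le> e"
  shows "\<exists>\<rho>>0. \<forall>\<^sub>F k in sequentially. \<forall>v. norm v \<le> \<rho> \<longrightarrow>
      norm (cf h v (Some (x k)) - of_real (mass h (Some (x k)))) \<le> mass h (Some (x k)) / 32"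
proof -
  obtain R0 where R0: "\<forall>\<^sub>F k in sequentially. tail_mass R0 (u k) (Some (x k)) \<le> m / 2"
    using tail[of "m / 2"] m by auto
  obtain c where c: "0 < c" "\<And>s y. \<lbrakk>s \<in> {0..h1}; y \<in> D \<inter> cball 0 R0\<rbrakk> \<Longrightarrow> c \<le> mass s (Some y)"
    using mass_lower_bound[of R0] by blast
  \<comment> \<open>The total error \<open>3 e\<close> is to be at most \<open>1/32\<close> of the mass, which is at least \<open>c * m / 2\<close>.\<close>
  define e where "e = c * m / 256"
  have e: "0 < e"
    using c m by (simp add: e_def)
  obtain R1 where R1: "\<forall>\<^sub>F k in sequentially. tail_mass R1 (u k) (Some (x k)) \<le> e"
    using tail[OF e] by auto
  obtain \<rho> where rho: "0 < \<rho>" "\<And>s y v. \<lbrakk>s \<in> {0..h1}; y \<in> D \<inter> cball 0 R1; norm v \<le> \<rho>\<rbrakk>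
      \<Longrightarrow> norm (cf s v (Some y) - cf s 0 (Some y)) \<le> e"
    using cf_equicontinuous[OF e, of R1] by blast
  have "\<forall>\<^sub>F k in sequentially. \<forall>v. norm v \<le> \<rho> \<longrightarrow>
      norm (cf h v (Some (x k)) - of_real (mass h (Some (x k)))) \<le> mass h (Some (x k)) / 32"
    using u mass R0 R1
  proof eventually_elim
    case (elim k)
    define s where "s = h - u k"
    have s: "s \<in> {0..h1}" and uk: "0 \<le> u k" and h0: "0 \<le> h"
      using elim by (auto simp: s_def)
    have s0: "0 \<le> s" using s by simp
    let ?y = "Some (x k)"
    have xs: "?y \<in> state_cem D"
      using x by (simp add: Some_in_state)
    interpret prob_space "p (u k) ?y"
      by (rule prob_space_kernel[OF uk xs])
    let ?P = "p (u k) ?y"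
    have sets: "sets ?P = sets (state_algebra D)" and space: "space ?P = state_cem D"
      using sets_kernel[OF uk xs] space_kernel[OF uk xs] .
    let ?T = "\<lambda>R. Some ` {\<xi> \<in> D. R < norm \<xi>}"
    have T: "?T R \<in> sets ?P" for R
      unfolding sets by (rule tail_set_measurable)
    have SD: "Some ` D \<in> sets ?P"
      unfolding sets by (rule Some_D_sets)
    have iT: "integrable ?P (\<lambda>z. r * indicator (?T R) z)" for R and r :: real
      using T by (intro integrable_mult_right integrable_real_indicator) (auto simp: less_top[symmetric])
    have iD: "integrable ?P (\<lambda>z. r * indicator (Some ` D) z)" for r :: real
      using SD by (intro integrable_mult_right integrable_real_indicator) (auto simp: less_top[symmetric])
    have h: "h = u k + s" by (simp add: s_def)
    have CK: "cf h v ?y = (LINT z|?P. cf s v z)" for v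
      unfolding h by (rule cf_chapman_kolmogorov[OF uk s0 xs])
    have icf: "integrable ?P (cf s v)" for v
      by (rule integrable_cf[OF s0 uk xs])
    have iRe: "integrable ?P (\<lambda>z. Re (cf s 0 z))"
      using icf by simp
    have big: "c * m / 2 \<le> mass h ?y"
    proof -
      have "(LINT z|?P. c * indicator (Some ` D) z - c * indicator (?T R0) z) \<le> (LINT z|?P. Re (cf s 0 z))"
      proof (rule integral_mono)
        show "integrable ?P (\<lambda>z. c * indicator (Some ` D) z - c * indicator (?T R0) z)"
          by (intro Bochner_Integration.integrable_diff iT iD)
        show "integrable ?P (\<lambda>z. Re (cf s 0 z))" by (rule iRe)
        fix z assume z: "z \<in> space ?P"
        show "c * indicator (Some ` D) z - c * indicator (?T R0) z \<le> Re (cf s 0 z)"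
        proof (cases z)
          case None
          then show ?thesis using s0 by (auto simp: cf_None)
        next
          case (Some y)
          then have y: "y \<in> D" using z by (simp add: space Some_in_state)
          have e: "Re (cf s 0 z) = mass s (Some y)"
            using Some y s0 by (simp add: cf_zero Some_in_state)
          show ?thesis
          proof (cases "norm y \<le> R0")
            case True
            then have "c \<le> mass s (Some y)" using c(2)[OF s, of y] y by simp
            then show ?thesis using True Some y unfolding e by (auto simp: indicator_def)
          next
            case False
            then show ?thesis
              using Some y mass_nonneg[OF s0, of "Some y"] unfolding e by (auto simp: indicator_def Some_in_state)
          qed
        qed
      qed
      also have "(LINT z|?P. c * indicator (Some ` D) z - c * indicator (?T R0) z)
          = c * mass (u k) ?y - c * tail_mass R0 (u k) ?y"
        by (subst Bochner_Integration.integral_diff[OF iD iT])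
          (use T[THEN sets.sets_into_space] SD[THEN sets.sets_into_space] in
            \<open>simp add: mass_def tail_mass_def Int_absorb2\<close>)
      also have "(LINT z|?P. Re (cf s 0 z)) = mass h ?y"
      proof -
        have "Re (cf h 0 ?y) = mass h ?y"
          by (simp add: cf_zero[OF h0 xs])
        then show ?thesis
          using CK[of 0] integral_Re[OF icf[of 0]] by simp
      qed
      finally have "c * (mass (u k) ?y - tail_mass R0 (u k) ?y) \<le> mass h ?y"
        by (simp add: right_diff_distrib)
      moreover have "c * (m / 2) \<le> c * (mass (u k) ?y - tail_mass R0 (u k) ?y)"
        using elim c(1) by (intro mult_left_mono) auto
      ultimately show ?thesis by simp
    qed
    show ?case
    proof (intro allI impI)
      fix v :: 'v assume v: "norm v \<le> \<rho>"
      have "cf h v ?y - of_real (mass h ?y) = (LINT z|?P. cf s v z - cf s 0 z)"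
        using CK[of v] CK[of 0] cf_zero[OF h0 xs] icf by simp
      also have "norm \<dots> \<le> (LINT z|?P. norm (cf s v z - cf s 0 z))"
        by (rule integral_norm_bound)
      also have "\<dots> \<le> (LINT z|?P. e + 2 * indicator (?T R1) z)"
      proof (rule integral_mono)
        show "integrable ?P (\<lambda>z. norm (cf s v z - cf s 0 z))"
          by (intro integrable_norm Bochner_Integration.integrable_diff icf)
        show "integrable ?P (\<lambda>z. e + 2 * indicator (?T R1) z)"
          by (intro Bochner_Integration.integrable_add iT) simp
        fix z assume z: "z \<in> space ?P"
        show "norm (cf s v z - cf s 0 z) \<le> e + 2 * indicator (?T R1) z"
        proof (cases z)
          case None
          then show ?thesis using s0 e by (auto simp: cf_None)
        next
          case (Some y)
          then have y: "y \<in> D" using z by (simp add: space Some_in_state)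
          show ?thesis
          proof (cases "norm y \<le> R1")
            case True
            then show ?thesis using rho(2)[OF s _ v, of y] y Some by (auto simp: indicator_def)
          next
            case False
            have zs: "z \<in> state_cem D" using z by (simp add: space)
            have "norm (cf s v z - cf s 0 z) \<le> norm (cf s v z) + norm (cf s 0 z)"
              by (rule norm_triangle_ineq4)
            also have "\<dots> \<le> 1 + 1"
              using norm_cf_le_mass[OF s0 zs] mass_le_1[OF s0 zs] by (intro add_mono) (auto intro: order_trans)
            finally show ?thesis using False y Some e by (auto simp: indicator_def)
          qed
        qed
      qed
      also have "\<dots> = e + 2 * tail_mass R1 (u k) ?y"
        by (subst Bochner_Integration.integral_add[OF _ iT])
          (use T[THEN sets.sets_into_space] in \<open>simp_all add: tail_mass_def Int_absorb2 prob_space\<close>)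
      also have "\<dots> \<le> 3 * e"
        using elim by simp
      also have "\<dots> \<le> mass h ?y / 32"
        using big mult_pos_pos[OF c(1) m] by (simp add: e_def)
      finally show "norm (cf h v ?y - of_real (mass h ?y)) \<le> mass h ?y / 32" .
    qed
  qed
  with rho(1) show ?thesis by blast
qed


context
  fixes \<gamma> :: "real \<Rightarrow> 'v option"
  assumes good: "good_path \<gamma>"
    and state: "\<And>q. q \<in> dyadic_times \<Longrightarrow> \<gamma> q \<in> state_cem D"
begin

lemma good_path_tail:
  "T \<in> dyadic_times \<Longrightarrow> 0 < e \<Longrightarrow> \<exists>R. \<forall>q\<in>dyadic_times. q \<le> T \<longrightarrow> tail_mass R (T - q) (\<gamma> q) \<le> e"
  using good unfolding good_path_def by blast

lemma good_path_cauchy: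
  assumes "T \<in> dyadic_times" "b \<in> Basis" "S = {t<..} \<or> S = {..<t}" "0 < e"
  shows "\<exists>\<delta>>0. \<forall>q\<in>dyadic_times \<inter> S. \<forall>q'\<in>dyadic_times \<inter> S.
          q \<le> T \<and> q' \<le> T \<and> dist q t < \<delta> \<and> dist q' t < \<delta> \<longrightarrow>
          norm (cf (T - q) ((1 / real n) *\<^sub>R b) (\<gamma> q) - cf (T - q') ((1 / real n) *\<^sub>R b) (\<gamma> q')) \<le> e"
  using good assms unfolding good_path_def by blast

text \<open>For every small \<open>h\<close> a dyadic \<open>T\<close> is chosen in \<open>(t, t + h)\<close>; tightness after \<open>T - q k\<close>
  propagates to the time \<open>h\<close>.\<close>

lemma good_path_bounded:
  assumes q: "\<And>k. q k \<in> dyadic_times" "q \<longlonglongrightarrow> t" "0 \<le> t" and x: "\<And>k. \<gamma> (q k) = Some (x k)"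
    and "0 < h0" and mass: "\<And>T. \<lbrakk>T \<in> dyadic_times; t < T; T < t + h0\<rbrakk> \<Longrightarrow>
      \<exists>m>0. \<forall>\<^sub>F k in sequentially. m \<le> mass (T - q k) (Some (x k))"
  shows "bounded (range x)"
proof -
  have xD: "x k \<in> D" for k
    using state[OF q(1)[of k]] x[of k] by (simp add: Some_in_state)
  show ?thesis
  proof (rule bounded_if_equicontinuous_at_zero[of x "min h0 h1"])
    fix h assume h: "0 < h" "h \<le> min h0 h1"
    obtain T where T: "T \<in> dyadic_times" "t < T" "T < t + h"
      using dyadic_times_dense[of t "t + h"] q(3) h by auto
    obtain m where m: "0 < m" "\<forall>\<^sub>F k in sequentially. m \<le> mass (T - q k) (Some (x k))"
      using mass[OF T(1,2)] T(3) h by auto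
    have qT: "\<forall>\<^sub>F k in sequentially. q k < T"
      using q(2) T(2) by (rule order_tendstoD(2))
    have qh: "\<forall>\<^sub>F k in sequentially. T - h < q k"
      using q(2) by (rule order_tendstoD(1)) (use T(3) in simp)
    show "\<exists>\<rho>>0. \<forall>\<^sub>F k in sequentially. \<forall>v. norm v \<le> \<rho> \<longrightarrow>
      norm (cf h v (Some (x k)) - of_real (mass h (Some (x k)))) \<le> mass h (Some (x k)) / 32"
    proof (rule tightness_propagates[where u = "\<lambda>k. T - q k", OF xD m(1) _ m(2)])
      show "\<forall>\<^sub>F k in sequentially. 0 \<le> T - q k \<and> T - q k \<le> h \<and> h - (T - q k) \<le> h1"
        using qT qh by eventually_elim (use h in auto)
      fix e :: real assume "0 < e"
      then obtain R where R: "\<And>q. q \<in> dyadic_times \<Longrightarrow> q \<le> T \<Longrightarrow> tail_mass R (T - q) (\<gamma> q) \<le> e"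
        using good_path_tail[OF T(1)] by blast
      have "\<forall>\<^sub>F k in sequentially. tail_mass R (T - q k) (Some (x k)) \<le> e"
        using qT by eventually_elim (use R[OF q(1)] x in auto)
      then show "\<exists>R. \<forall>\<^sub>F k in sequentially. tail_mass R (T - q k) (Some (x k)) \<le> e" ..
    qed
  qed (use xD assms h1_pos in auto)
qed

lemma good_path_same_limit:
  assumes q: "\<And>k. q k \<in> dyadic_times \<inter> S" "q \<longlonglongrightarrow> t" and q': "\<And>k. q' k \<in> dyadic_times \<inter> S" "q' \<longlonglongrightarrow> t"
    and t: "0 \<le> t" and S: "S = {t<..} \<or> S = {..<t}"
    and T: "T \<in> dyadic_times" "t < T" and b: "b \<in> Basis"
    and lim: "(\<lambda>k. cf (T - q k) ((1 / real n) *\<^sub>R b) (\<gamma> (q k))) \<longlonglongrightarrow> l"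
  shows "(\<lambda>k. cf (T - q' k) ((1 / real n) *\<^sub>R b) (\<gamma> (q' k))) \<longlonglongrightarrow> l"
proof -
  let ?f = "\<lambda>q. cf (T - q) ((1 / real n) *\<^sub>R b) (\<gamma> q)"
  have "(\<lambda>k. ?f (q' k) - ?f (q k)) \<longlonglongrightarrow> 0"
  proof (rule tendstoI)
    fix e :: real assume e: "0 < e"
    obtain \<delta> where d: "0 < \<delta>" "\<And>q q'. \<lbrakk>q \<in> dyadic_times \<inter> S; q' \<in> dyadic_times \<inter> S; q \<le> T; q' \<le> T;
        dist q t < \<delta>; dist q' t < \<delta>\<rbrakk> \<Longrightarrow> norm (?f q - ?f q') \<le> e / 2"
      using good_path_cauchy[OF T(1) b S, of "e / 2" n] e by (metis half_gt_zero)
    have "\<forall>\<^sub>F k in sequentially. q k < T" "\<forall>\<^sub>F k in sequentially. q' k < T"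
      using q(2) q'(2) T(2) by (auto dest: order_tendstoD(2))
    moreover have "\<forall>\<^sub>F k in sequentially. dist (q k) t < \<delta>" "\<forall>\<^sub>F k in sequentially. dist (q' k) t < \<delta>"
      using q(2) q'(2) d(1) by (auto dest: tendstoD)
    ultimately show "\<forall>\<^sub>F k in sequentially. dist (?f (q' k) - ?f (q k)) 0 < e"
    proof eventually_elim
      case (elim k)
      have "norm (?f (q' k) - ?f (q k)) \<le> e / 2"
        by (rule d(2)) (use elim q(1) q'(1) in auto)
      with e show ?case by simp
    qed
  qed
  from tendsto_add[OF this lim] show ?thesis by simp
qed

lemma good_path_transform_limit:
  assumes q: "\<And>k. q k \<in> dyadic_times" "q \<longlonglongrightarrow> t" and t: "0 \<le> t" and x: "\<And>k. \<gamma> (q k) = Some (x k)"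
    and lim: "x \<longlonglongrightarrow> y" and T: "t < T" "T < t + h1" and v: "v \<in> cball 0 1"
  shows "(\<lambda>k. cf (T - q k) v (\<gamma> (q k))) \<longlonglongrightarrow> cf (T - t) v (Some y)"
  unfolding x
proof (rule tendsto_cf[OF _ lim v])
  show "x k \<in> D" for k
    using state[OF q(1)[of k]] x[of k] by (simp add: Some_in_state)
  show "(\<lambda>k. T - q k) \<longlonglongrightarrow> T - t"
    by (intro tendsto_intros q)
  have "\<forall>\<^sub>F k in sequentially. q k < T"
    using q(2) T(1) by (rule order_tendstoD(2))
  moreover have "\<forall>\<^sub>F k in sequentially. T - h1 < q k"
    using q(2) by (rule order_tendstoD(1)) (use T(2) in simp)
  ultimately show "\<forall>\<^sub>F k in sequentially. T - q k \<in> {0..h1}"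
    by eventually_elim auto
qed

text \<open>A finite limit point \<open>y\<close> forces the survival probabilities along every sequence from the same side
  to have the positive limit \<open>p\<^bsub>T-t\<^esub>(y, D)\<close>, so \<open>good_path_bounded\<close> applies and infinity is no
  limit point. A second finite limit point has the same Fourier transforms after every short time
  \<open>T - t\<close>; letting \<open>T\<close> decrease to \<open>t\<close> identifies it with \<open>y\<close>.\<close>

lemma good_path_limit_points:
  assumes q: "\<And>k. q k \<in> dyadic_times \<inter> S" "q \<longlonglongrightarrow> t" and q': "\<And>k. q' k \<in> dyadic_times \<inter> S" "q' \<longlonglongrightarrow> t"
    and t: "0 \<le> t" and S: "S = {t<..} \<or> S = {..<t}"
    and x: "\<And>k. \<gamma> (q k) = Some (x k)" and x': "\<And>k. \<gamma> (q' k) = Some (x' k)"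
    and y: "x \<longlonglongrightarrow> y"
  shows "x' \<longlonglongrightarrow> y"
proof (rule tendsto_if_unique_limit_point)
  have qd: "q k \<in> dyadic_times" "q' k \<in> dyadic_times" for k
    using q(1) q'(1) by auto
  have xD: "x k \<in> D" "x' k \<in> D" for k
    using state[OF qd(1)[of k]] x[of k] state[OF qd(2)[of k]] x'[of k] by (simp_all add: Some_in_state)
  have yD: "y \<in> D"
    using closed_sequentially[OF closed_D] xD y by blast
  have wI: "(1 / real n) *\<^sub>R b \<in> cball 0 1" if "b \<in> Basis" for b :: 'v and n :: nat
    using that by (cases "n = 0") (auto simp: field_simps)
  show "bounded (range x')"
  proof (rule good_path_bounded[OF qd(2) q'(2) t x' h1_pos])
    fix T assume T: "T \<in> dyadic_times" "t < T" "T < t + h1"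
    obtain b :: 'v where b: "b \<in> Basis"
      using nonempty_Basis by blast
    have "(\<lambda>k. cf (T - q k) ((1 / real 0) *\<^sub>R b) (\<gamma> (q k))) \<longlonglongrightarrow> cf (T - t) ((1 / real 0) *\<^sub>R b) (Some y)"
      by (rule good_path_transform_limit[OF qd(1) q(2) t x y T(2,3) wI[OF b]])
    then have "(\<lambda>k. cf (T - q' k) ((1 / real 0) *\<^sub>R b) (\<gamma> (q' k))) \<longlonglongrightarrow> cf (T - t) ((1 / real 0) *\<^sub>R b) (Some y)"
      by (rule good_path_same_limit[OF q q' t S T(1,2) b])
    then have lim: "(\<lambda>k. Re (cf (T - q' k) 0 (Some (x' k)))) \<longlonglongrightarrow> Re (cf (T - t) 0 (Some y))"
      by (intro tendsto_Re) (simp add: x')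
    have "0 < mass (T - t) (Some y)"
      by (rule mass_pos[OF _ yD]) (use T in auto)
    moreover have "Re (cf (T - t) 0 (Some y)) = mass (T - t) (Some y)"
      using T yD by (simp add: cf_zero Some_in_state)
    ultimately have "\<forall>\<^sub>F k in sequentially. mass (T - t) (Some y) / 2 < Re (cf (T - q' k) 0 (Some (x' k)))"
      using lim by (intro order_tendstoD(1)[OF lim]) simp
    moreover have "\<forall>\<^sub>F k in sequentially. q' k < T"
      using q'(2) T(2) by (rule order_tendstoD(2))
    ultimately have "\<forall>\<^sub>F k in sequentially. mass (T - t) (Some y) / 2 \<le> mass (T - q' k) (Some (x' k))"
    proof eventually_elim
      case (elim k)
      then show ?case
        using xD(2)[of k] by (simp add: cf_zero Some_in_state)
    qed
    then show "\<exists>m>0. \<forall>\<^sub>F k in sequentially. m \<le> mass (T - q' k) (Some (x' k))"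
      using \<open>0 < mass (T - t) (Some y)\<close> by (intro exI[of _ "mass (T - t) (Some y) / 2"]) simp
  qed
  fix r y' assume r: "strict_mono r" and y': "(x' \<circ> r) \<longlonglongrightarrow> y'"
  have q'r: "q' (r k) \<in> dyadic_times \<inter> S" "q' (r k) \<in> dyadic_times" "\<gamma> (q' (r k)) = Some ((x' \<circ> r) k)" for k
    using q'(1) qd x' by auto
  have q'rt: "(\<lambda>k. q' (r k)) \<longlonglongrightarrow> t"
    using LIMSEQ_subseq_LIMSEQ[OF q'(2) r] by (simp add: comp_def)
  have y'D: "y' \<in> D"
    using closed_sequentially[OF closed_D _ y'] xD by simp
  have eq: "cf (T - t) ((1 / real n) *\<^sub>R b) (Some y) = cf (T - t) ((1 / real n) *\<^sub>R b) (Some y')"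
    if T: "T \<in> dyadic_times" "t < T" "T < t + h1" and b: "b \<in> Basis" for T b n
  proof (rule LIMSEQ_unique)
    have "(\<lambda>k. cf (T - q k) ((1 / real n) *\<^sub>R b) (\<gamma> (q k))) \<longlonglongrightarrow> cf (T - t) ((1 / real n) *\<^sub>R b) (Some y)"
      by (rule good_path_transform_limit[OF qd(1) q(2) t x y T(2,3) wI[OF b]])
    then show "(\<lambda>k. cf (T - q' (r k)) ((1 / real n) *\<^sub>R b) (\<gamma> (q' (r k)))) \<longlonglongrightarrow> cf (T - t) ((1 / real n) *\<^sub>R b) (Some y)"
      by (rule good_path_same_limit[OF q q'r(1) q'rt t S T(1,2) b])
    show "(\<lambda>k. cf (T - q' (r k)) ((1 / real n) *\<^sub>R b) (\<gamma> (q' (r k)))) \<longlonglongrightarrow> cf (T - t) ((1 / real n) *\<^sub>R b) (Some y')"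
      by (rule good_path_transform_limit[OF q'r(2) q'rt t q'r(3) y' T(2,3) wI[OF b]])
  qed
  have ev: "cis (((1 / real n) *\<^sub>R b) \<bullet> y) = cis (((1 / real n) *\<^sub>R b) \<bullet> y')" if b: "b \<in> Basis" for b n
  proof -
    have "\<forall>k. \<exists>T\<in>dyadic_times. t < T \<and> T < t + min h1 (inverse (real (Suc k)))"
    proof
      fix k
      have "t < t + min h1 (inverse (real (Suc k)))"
        using h1_pos by simp
      from dyadic_times_dense[OF t this]
      show "\<exists>T\<in>dyadic_times. t < T \<and> T < t + min h1 (inverse (real (Suc k)))"
        by blast
    qed
    then obtain T where T: "\<And>k. T k \<in> dyadic_times" "\<And>k. t < T k" "\<And>k. T k < t + min h1 (inverse (real (Suc k)))"
      by metis
    have T0: "(\<lambda>k. T k - t) \<longlonglongrightarrow> 0"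
    proof (rule tendsto_sandwich[OF _ _ tendsto_const LIMSEQ_inverse_real_of_nat])
      show "\<forall>\<^sub>F k in sequentially. 0 \<le> T k - t"
        using T(2) by (simp add: less_imp_le)
      show "\<forall>\<^sub>F k in sequentially. T k - t \<le> inverse (real (Suc k))"
      proof (intro always_eventually allI)
        fix k show "T k - t \<le> inverse (real (Suc k))" using T(3)[of k] by linarith
      qed
    qed
    have I: "\<forall>\<^sub>F k in sequentially. T k - t \<in> {0..h1}"
    proof (intro always_eventually allI)
      fix k show "T k - t \<in> {0..h1}" using T(2,3)[of k] by auto
    qed
    have "(\<lambda>k. cf (T k - t) ((1 / real n) *\<^sub>R b) (Some y)) \<longlonglongrightarrow> cf 0 ((1 / real n) *\<^sub>R b) (Some y)"
      by (rule tendsto_cf[OF T0 tendsto_const wI[OF b] yD I])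
    moreover have "(\<lambda>k. cf (T k - t) ((1 / real n) *\<^sub>R b) (Some y')) \<longlonglongrightarrow> cf 0 ((1 / real n) *\<^sub>R b) (Some y')"
      by (rule tendsto_cf[OF T0 tendsto_const wI[OF b] y'D I])
    moreover have "cf (T k - t) ((1 / real n) *\<^sub>R b) (Some y) = cf (T k - t) ((1 / real n) *\<^sub>R b) (Some y')" for k
      by (rule eq[OF T(1) T(2) _ b]) (use T(3)[of k] in simp)
    ultimately have "cf 0 ((1 / real n) *\<^sub>R b) (Some y) = cf 0 ((1 / real n) *\<^sub>R b) (Some y')"
      using LIMSEQ_unique by simp
    then show ?thesis
      by (simp only: cf_at_0[OF yD] cf_at_0[OF y'D])
  qed
  show "y' = y"
  proof (rule euclidean_eqI)
    fix b :: 'v assume b: "b \<in> Basis"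
    define a where "a = b \<bullet> y - b \<bullet> y'"
    \<comment> \<open>The frequency is taken so small that \<open>cis\<close> is injective on the relevant range.\<close>
    obtain n :: nat where n: "\<bar>a\<bar> / pi < real n"
      using reals_Archimedean2 by blast
    have n0: "0 < real n"
      using n by (rule le_less_trans[rotated]) simp
    have "cis (a / real n) = 1"
    proof -
      have "cis (a / real n) = cis (((1 / real n) *\<^sub>R b) \<bullet> y) / cis (((1 / real n) *\<^sub>R b) \<bullet> y')"
        by (simp add: cis_divide a_def diff_divide_distrib)
      also have "\<dots> = 1"
        unfolding ev[OF b] by simp
      finally show ?thesis .
    qed
    then have "sin (a / real n) = 0"
      by (simp add: complex_eq_iff)
    moreover have "\<bar>a / real n\<bar> < pi"
      using n n0 pi_gt_zero by (simp add: field_simps)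
    ultimately have "a / real n = 0"
      by (simp add: sin_zero_pi_iff)
    then show "y' \<bullet> b = y \<bullet> b"
      using n0 by (simp add: a_def inner_commute)
  qed
qed

end

end

section \<open>Regularization of paths\<close>

lemma topspace_cem: "topspace (cem_topology D) = state_cem D"
proof -
  have "{x. Some x \<in> state_cem D} = D"
    by (auto simp: state_cem_def)
  then have "openin (cem_topology D) (state_cem D)"
    by (simp add: openin_cem_topology)
  moreover have "topspace (cem_topology D) \<subseteq> state_cem D"
    using openin_topspace[of "cem_topology D"] unfolding openin_cem_topology by blast
  ultimately show ?thesis
    using openin_subset by blast
qed

lemma openin_compact_cem_preimage:
  assumes "openin (compact_cem D) U"
  obtains W where "open W" "{x. Some (Some x) \<in> U} = D \<inter> W"
proof -
  have "openin (cem_topology D) {w \<in> topspace (cem_topology D). Some w \<in> U}"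
    by (rule openin_continuous_map_preimage[OF continuous_map_Some assms])
  then have o: "openin (top_of_set D) {x. Some x \<in> {w \<in> state_cem D. Some w \<in> U}}"
    by (simp add: openin_cem_topology topspace_cem)
  have "U \<subseteq> topspace (compact_cem D)"
    using assms by (rule openin_subset)
  then have "{x. Some x \<in> {w \<in> state_cem D. Some w \<in> U}} = {x. Some (Some x) \<in> U}"
    by (auto simp: topspace_cem)
  with o show ?thesis
    using that unfolding openin_open by auto
qed

lemma compactin_cem_bounded:
  assumes "compactin (cem_topology D) C"
  obtains R where "\<And>x. Some x \<in> C \<Longrightarrow> norm x \<le> R"
proof -
  define U where "U n = insert None (Some ` (D \<inter> ball 0 (real n)))" for n :: nat
  have oU: "openin (cem_topology D) (U n)" for n
  proof -
    have "{x. Some x \<in> U n} = D \<inter> ball 0 (real n)"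
      by (auto simp: U_def)
    moreover have "openin (top_of_set D) (D \<inter> ball 0 (real n))"
      by (rule openin_open_Int) simp
    moreover have "U n \<subseteq> state_cem D"
      by (auto simp: U_def state_cem_def)
    ultimately show ?thesis
      by (simp add: openin_cem_topology)
  qed
  have C: "C \<subseteq> state_cem D"
    using compactin_subset_topspace[OF assms] by (simp add: topspace_cem)
  have "C \<subseteq> \<Union>(range U)"
  proof
    fix w assume "w \<in> C"
    then have w: "w \<in> state_cem D" using C by auto
    show "w \<in> \<Union>(range U)"
    proof (cases w)
      case (Some x)
      obtain n :: nat where "norm x < real n" using reals_Archimedean2 by blast
      then show ?thesis using Some w by (auto simp: U_def state_cem_def intro!: exI[of _ n])
    qed (auto simp: U_def)
  qed
  then obtain \<F> where F: "finite \<F>" "\<F> \<subseteq> range U" "C \<subseteq> \<Union>\<F>"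
    using compactinD[OF assms, of "range U"] oU by auto
  obtain I where I: "finite I" "\<F> = U ` I"
    using finite_subset_image[OF F(1,2)] by blast
  show ?thesis
  proof (rule that[of "\<Sum>n\<in>I. real n"])
    fix x assume "Some x \<in> C"
    then obtain n where n: "n \<in> I" "Some x \<in> U n"
      using F I by auto
    have "norm x < real n" using n by (auto simp: U_def)
    also have "real n \<le> (\<Sum>n\<in>I. real n)"
      by (rule member_le_sum) (use n I in auto)
    finally show "norm x \<le> (\<Sum>n\<in>I. real n)" by simp
  qed
qed

lemma limitin_compact_cem_state:
  assumes "y \<in> D" "\<And>\<epsilon>. 0 < \<epsilon> \<Longrightarrow> \<forall>\<^sub>F s in F. \<exists>z\<in>D \<inter> cball y \<epsilon>. g s = Some z"
  shows "limitin (compact_cem D) (\<lambda>s. Some (g s)) (Some (Some y)) F"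
  unfolding limitin_def
proof (intro conjI allI impI)
  show "Some (Some y) \<in> topspace (compact_cem D)"
    using assms(1) by (auto simp: topspace_cem state_cem_def)
  fix U assume U: "openin (compact_cem D) U \<and> Some (Some y) \<in> U"
  then obtain W where W: "open W" "{x. Some (Some x) \<in> U} = D \<inter> W"
    using openin_compact_cem_preimage by blast
  then have "y \<in> W" using U by blast
  then obtain \<epsilon> where e: "0 < \<epsilon>" "cball y \<epsilon> \<subseteq> W"
    using W(1) by (auto simp: open_contains_cball)
  from assms(2)[OF e(1)] show "\<forall>\<^sub>F s in F. Some (g s) \<in> U"
  proof eventually_elim
    case (elim s)
    then obtain z where "z \<in> D \<inter> W" "g s = Some z" using e(2) by blast
    with W(2) show ?case by auto
  qed
qed

lemma limitin_compact_cem_infinity: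
  assumes "\<And>R. \<forall>\<^sub>F s in F. \<exists>z\<in>D. R < norm z \<and> g s = Some z"
  shows "limitin (compact_cem D) (\<lambda>s. Some (g s)) None F"
  unfolding limitin_def
proof (intro conjI allI impI)
  show "None \<in> topspace (compact_cem D)" by simp
  fix U assume "openin (compact_cem D) U \<and> None \<in> U"
  then obtain C where C: "compactin (cem_topology D) C" "U = insert None (Some ` (topspace (cem_topology D) - C))"
    unfolding openin_Alexandroff_compactification by auto
  obtain R where R: "\<And>x. Some x \<in> C \<Longrightarrow> norm x \<le> R"
    using compactin_cem_bounded[OF C(1)] by blast
  show "\<forall>\<^sub>F s in F. Some (g s) \<in> U"
    using assms[of R]
  proof eventually_elim
    case (elim s)
    then obtain z where z: "z \<in> D" "R < norm z" "g s = Some z" by blast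
    then have "Some z \<notin> C" using R[of z] by auto
    with z show ?case by (auto simp: C(2) topspace_cem state_cem_def)
  qed
qed

lemma limitin_compact_cem_const_None:
  assumes "\<forall>\<^sub>F s in F. g s = None"
  shows "limitin (compact_cem D) (\<lambda>s. Some (g s)) (Some None) F"
  unfolding limitin_def
proof (intro conjI allI impI)
  show "Some None \<in> topspace (compact_cem D)"
    by (auto simp: topspace_cem state_cem_def)
  fix U assume "openin (compact_cem D) U \<and> Some None \<in> U"
  then show "\<forall>\<^sub>F s in F. Some (g s) \<in> U"
    using assms by (auto elim: eventually_mono)
qed

text \<open>A bounded part of the closed set \<open>D\<close> is compact, so its complement is a neighbourhood of infinity;
  the cemetery is isolated from \<open>D\<close>.\<close>

lemma limitin_compact_cem_finite:
  fixes D :: "'v::euclidean_space set"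
  assumes "closed D" "F \<noteq> bot" "limitin (compact_cem D) (\<lambda>s. Some (g s)) l F"
    and "\<And>\<epsilon>. 0 < \<epsilon> \<Longrightarrow> \<forall>\<^sub>F s in F. \<exists>z\<in>D \<inter> cball y \<epsilon>. g s = Some z"
  shows "ext_norm l \<noteq> \<infinity>"
proof -
  have ev: "\<forall>\<^sub>F s in F. \<exists>z\<in>D \<inter> cball y 1. g s = Some z"
    by (rule assms(4)) simp
  have no: False if "\<forall>\<^sub>F s in F. Some (g s) \<notin> Some ` Some ` (D \<inter> cball y 1)"
  proof -
    from ev that have "\<forall>\<^sub>F s in F. False"
      by eventually_elim auto
    with assms(2) show False by (simp add: trivial_limit_def)
  qed
  consider "l = None" | "l = Some None" | z where "l = Some (Some z)"
    by (metis option.exhaust)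
  then show ?thesis
  proof cases
    case 1
    let ?K = "Some ` (D \<inter> cball y 1)"
    have "continuous_map (top_of_set D) (cem_topology D) Some"
      unfolding continuous_map_def topspace_cem
    proof (intro conjI allI impI)
      fix U assume "openin (cem_topology D) U"
      then have "openin (top_of_set D) {x. Some x \<in> U}" "U \<subseteq> state_cem D"
        by (auto simp: openin_cem_topology)
      moreover have "{x \<in> topspace (top_of_set D). Some x \<in> U} = {x. Some x \<in> U}"
        using calculation(2) by (auto simp: state_cem_def)
      ultimately show "openin (top_of_set D) {x \<in> topspace (top_of_set D). Some x \<in> U}"
        by simp
    qed (auto simp: state_cem_def)
    moreover have "compactin (top_of_set D) (D \<inter> cball y 1)"
      using assms(1) by (auto simp: compactin_subtopology closed_Int_compact)
    ultimately have "compactin (cem_topology D) ?K"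
      by (rule image_compactin[rotated])
    moreover have "closedin (cem_topology D) ?K"
    proof -
      have "{x. Some x \<in> state_cem D - ?K} = D \<inter> - cball y 1"
        by (auto simp: state_cem_def)
      moreover have "openin (top_of_set D) (D \<inter> - cball y 1)"
        by (rule openin_open_Int) (simp add: open_Compl)
      ultimately have "openin (cem_topology D) (state_cem D - ?K)"
        by (simp add: openin_cem_topology)
      then show ?thesis
        by (auto simp: closedin_def topspace_cem state_cem_def)
    qed
    ultimately have "openin (compact_cem D) (insert None (Some ` (topspace (cem_topology D) - ?K)))"
      unfolding openin_Alexandroff_compactification by blast
    then have "\<forall>\<^sub>F s in F. Some (g s) \<in> insert None (Some ` (topspace (cem_topology D) - ?K))"
      using assms(3) 1 unfolding limitin_def by blast
    then have "\<forall>\<^sub>F s in F. Some (g s) \<notin> Some ` Some ` (D \<inter> cball y 1)"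
      by eventually_elim auto
    then show ?thesis using no by blast
  next
    case 2
    have "openin (cem_topology D) {None}"
      by (simp add: openin_cem_topology state_cem_def)
    then have "openin (compact_cem D) (Some ` {None})"
      by (simp only: openin_Alexandroff_compactification_image_Some)
    then have "\<forall>\<^sub>F s in F. Some (g s) \<in> Some ` {None}"
      using assms(3) 2 unfolding limitin_def by blast
    then have "\<forall>\<^sub>F s in F. Some (g s) \<notin> Some ` Some ` (D \<inter> cball y 1)"
      by eventually_elim auto
    then show ?thesis using no by blast
  next
    case 3
    then show ?thesis by simp
  qed
qed

definition regularization :: "(real \<Rightarrow> 'v::euclidean_space option) \<Rightarrow> real \<Rightarrow> 'v option" where
  "regularization \<gamma> t =
     (if \<exists>q\<in>dyadic_times. t < q \<and> \<gamma> q \<noteq> None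
      then Some (Lim (at t within dyadic_times \<inter> {t<..}) (\<lambda>q. the (\<gamma> q))) else None)"

lemma regularization_eq:
  assumes "0 \<le> t" "q \<in> dyadic_times" "t < q" "\<gamma> q \<noteq> None"
    "((\<lambda>q. the (\<gamma> q)) \<longlongrightarrow> y) (at t within dyadic_times \<inter> {t<..})"
  shows "regularization \<gamma> t = Some y"
proof -
  have "at t within dyadic_times \<inter> {t<..} \<noteq> bot"
    using dyadic_times_limit[OF assms(1), of "{t<..}"] by (simp add: trivial_limit_within)
  then show ?thesis
    using tendsto_Lim[OF _ assms(5)] assms(2-4) by (auto simp: regularization_def)
qed

context affine_kernel_short_time
begin

context
  fixes \<gamma> :: "real \<Rightarrow> 'v option"
  assumes good: "good_path \<gamma>"
    and state: "\<And>q. q \<in> dyadic_times \<Longrightarrow> \<gamma> q \<in> state_cem D"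
    and absorbed: "\<And>q q'. \<lbrakk>q \<in> dyadic_times; q' \<in> dyadic_times; q \<le> q'; \<gamma> q = None\<rbrakk> \<Longrightarrow> \<gamma> q' = None"
begin

lemma one_sided_limit:
  assumes t: "0 \<le> t" and S: "S = {t<..} \<or> S = {..<t}" and A: "A \<subseteq> dyadic_times \<inter> S"
    and alive: "\<And>q. q \<in> A \<Longrightarrow> \<gamma> q \<noteq> None"
    and q: "\<And>k. q k \<in> A" "q \<longlonglongrightarrow> t" and y: "(\<lambda>k. the (\<gamma> (q k))) \<longlonglongrightarrow> y"
  shows "((\<lambda>q. the (\<gamma> q)) \<longlongrightarrow> y) (at t within A)"
  unfolding tendsto_at_iff_sequentially comp_def
proof (intro allI impI)
  fix q' assume q': "\<forall>i. q' i \<in> A - {t}" "q' \<longlonglongrightarrow> t"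
  show "(\<lambda>k. the (\<gamma> (q' k))) \<longlonglongrightarrow> y"
  proof (rule good_path_limit_points[OF good state, of q S t q'])
    show "q k \<in> dyadic_times \<inter> S" "q' k \<in> dyadic_times \<inter> S" for k
      using q(1) q'(1) A by blast+
    show "\<gamma> (q k) = Some (the (\<gamma> (q k)))" "\<gamma> (q' k) = Some (the (\<gamma> (q' k)))" for k
      using q(1) q'(1) alive by auto
  qed (use q q' t S y in auto)
qed

text \<open>As long as the path is alive at a later time, the survival probabilities are bounded below; this
  gives boundedness without a finite limit point at hand.\<close>

lemma limit_before_death:
  assumes t: "0 \<le> t" and S: "S = {t<..} \<or> S = {..<t} \<and> 0 < t"
    and T: "T \<in> dyadic_times" "t < T" "\<gamma> T \<noteq> None"
  shows "\<exists>y\<in>D. ((\<lambda>q. the (\<gamma> q)) \<longlongrightarrow> y) (at t within dyadic_times \<inter> S)"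
proof -
  define A where "A = dyadic_times \<inter> S \<inter> {..<T}"
  have "t islimpt A"
    unfolding islimpt_approachable
  proof (intro allI impI)
    fix e :: real assume "0 < e"
    then have "0 < min e (T - t)" using T(2) by simp
    with dyadic_times_limit[OF t S] obtain q where "q \<in> dyadic_times \<inter> S" "q \<noteq> t" "dist q t < min e (T - t)"
      unfolding islimpt_approachable by blast
    then show "\<exists>q\<in>A. q \<noteq> t \<and> dist q t < e"
      by (intro bexI[of _ q]) (auto simp: A_def dist_real_def)
  qed
  then obtain q where q: "\<And>k. q k \<in> A" "q \<longlonglongrightarrow> t"
    by (auto simp: islimpt_sequential)
  have S': "S = {t<..} \<or> S = {..<t}" using S by auto
  have alive: "\<gamma> q \<noteq> None" if "q \<in> dyadic_times" "q \<le> T" for q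
    using absorbed[OF that(1) T(1) that(2)] T(3) by auto
  have aliveA: "\<gamma> q \<noteq> None" if "q \<in> A" for q
    using that alive by (auto simp: A_def)
  have qd: "q k \<in> dyadic_times" for k
    using q(1) by (auto simp: A_def)
  have qx: "\<gamma> (q k) = Some (the (\<gamma> (q k)))" for k
    using aliveA[OF q(1)] by auto
  have "bounded (range (\<lambda>k. the (\<gamma> (q k))))"
  proof (rule good_path_bounded[OF good state qd q(2) t qx, of "T - t"])
    fix T' assume T': "T' \<in> dyadic_times" "t < T'" "T' < t + (T - t)"
    then have "\<gamma> T' \<noteq> None" by (intro alive) auto
    with good[unfolded good_path_def, THEN conjunct1] T'(1)
    have "\<exists>m>0. \<forall>q\<in>dyadic_times. q \<le> T' \<longrightarrow> m \<le> mass (T' - q) (\<gamma> q)" by simp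
    then obtain m where m: "0 < m" "\<And>q. q \<in> dyadic_times \<Longrightarrow> q \<le> T' \<Longrightarrow> m \<le> mass (T' - q) (\<gamma> q)"
      by blast
    have "\<forall>\<^sub>F k in sequentially. q k < T'"
      using q(2) T'(2) by (rule order_tendstoD(2))
    then have "\<forall>\<^sub>F k in sequentially. m \<le> mass (T' - q k) (Some (the (\<gamma> (q k))))"
      by eventually_elim (use m(2) qd qx in auto)
    with m(1) show "\<exists>m>0. \<forall>\<^sub>F k in sequentially. m \<le> mass (T' - q k) (Some (the (\<gamma> (q k))))"
      by blast
  qed (use T in auto)
  then obtain y r where r: "strict_mono r" "((\<lambda>k. the (\<gamma> (q k))) \<circ> r) \<longlonglongrightarrow> y"
    using bounded_imp_convergent_subsequence by blast
  have "(\<lambda>k. q (r k)) \<longlonglongrightarrow> t"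
    using LIMSEQ_subseq_LIMSEQ[OF q(2) r(1)] by (simp add: comp_def)
  then have lim: "((\<lambda>q. the (\<gamma> q)) \<longlongrightarrow> y) (at t within A)"
    using r(2) q(1) aliveA by (intro one_sided_limit[OF t S', of A "\<lambda>k. q (r k)"]) (auto simp: A_def comp_def)
  have "the (\<gamma> (q k)) \<in> D" for k
  proof -
    have "Some (the (\<gamma> (q k))) \<in> state_cem D"
      by (subst qx[symmetric]) (rule state[OF qd])
    then show ?thesis by (simp only: Some_in_state)
  qed
  then have "y \<in> D"
    using closed_sequentially[OF closed_D _ r(2)] by simp
  moreover have "at t within A = at t within dyadic_times \<inter> S"
    by (rule at_within_nhd[of t "{..<T}"]) (use T in \<open>auto simp: A_def\<close>)
  ultimately show ?thesis using lim by auto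
qed

text \<open>The path may die at \<open>t\<close>, so that no lower bound for the survival probabilities is at hand. If the
  norm does not tend to infinity, there is a finite limit point, and this excludes all others.\<close>

lemma left_limit_at_death:
  assumes t: "0 < t" and alive: "\<And>q. q \<in> dyadic_times \<Longrightarrow> q < t \<Longrightarrow> \<gamma> q \<noteq> None"
  shows "(\<exists>y\<in>D. ((\<lambda>q. the (\<gamma> q)) \<longlongrightarrow> y) (at t within dyadic_times \<inter> {..<t})) \<or>
    filterlim (\<lambda>q. norm (the (\<gamma> q))) at_top (at t within dyadic_times \<inter> {..<t})"
proof (cases "filterlim (\<lambda>q. norm (the (\<gamma> q))) at_top (at t within dyadic_times \<inter> {..<t})")
  case False
  let ?A = "dyadic_times \<inter> {..<t}"
  obtain R where "\<not> (\<forall>\<^sub>F q in at t within ?A. R \<le> norm (the (\<gamma> q)))"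
    using False unfolding filterlim_at_top by blast
  then have fr: "\<exists>\<^sub>F q in at t within ?A. norm (the (\<gamma> q)) < R"
    by (simp add: not_eventually not_le)
  have "\<exists>q\<in>?A. dist q t < inverse (real (Suc k)) \<and> norm (the (\<gamma> q)) < R" for k
  proof (rule ccontr)
    assume no: "\<not> ?thesis"
    have "\<forall>\<^sub>F q in at t within ?A. q \<in> ?A \<and> dist q t < inverse (real (Suc k))"
      unfolding eventually_at by (intro exI[of _ "inverse (real (Suc k))"]) auto
    then have "\<forall>\<^sub>F q in at t within ?A. \<not> norm (the (\<gamma> q)) < R"
      by eventually_elim (use no in blast)
    with fr show False by (simp add: frequently_def)
  qed
  then obtain q where q: "\<And>k. q k \<in> ?A" "\<And>k. dist (q k) t < inverse (real (Suc k))" "\<And>k. norm (the (\<gamma> (q k))) < R"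
    by metis
  have qt: "q \<longlonglongrightarrow> t"
  proof (rule metric_LIMSEQ_I)
    fix e :: real assume "0 < e"
    then obtain N where N: "inverse (real (Suc N)) < e"
      using reals_Archimedean by blast
    have "dist (q n) t < e" if "N \<le> n" for n
    proof -
      have "inverse (real (Suc n)) \<le> inverse (real (Suc N))"
        using that by simp
      with q(2)[of n] N show ?thesis by linarith
    qed
    then show "\<exists>no. \<forall>n\<ge>no. dist (q n) t < e" by blast
  qed
  have "bounded (range (\<lambda>k. the (\<gamma> (q k))))"
    unfolding bounded_iff using q(3) by (auto intro!: exI[of _ R] less_imp_le)
  then obtain y r where r: "strict_mono r" "((\<lambda>k. the (\<gamma> (q k))) \<circ> r) \<longlonglongrightarrow> y"
    using bounded_imp_convergent_subsequence by blast
  have "(\<lambda>k. q (r k)) \<longlonglongrightarrow> t"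
    using LIMSEQ_subseq_LIMSEQ[OF qt r(1)] by (simp add: comp_def)
  then have "((\<lambda>q. the (\<gamma> q)) \<longlongrightarrow> y) (at t within ?A)"
    using r(2) q(1) alive t
    by (intro one_sided_limit[of t "{..<t}" ?A "\<lambda>k. q (r k)"]) (auto simp: comp_def)
  moreover have "the (\<gamma> (q k)) \<in> D" for k
    using state[of "q k"] q(1)[of k] alive[of "q k"] by (cases "\<gamma> (q k)") (auto simp: Some_in_state)
  then have "y \<in> D"
    using closed_sequentially[OF closed_D _ r(2)] by simp
  ultimately show ?thesis by blast
qed simp

lemma regularization_alive:
  assumes "0 \<le> t" "T \<in> dyadic_times" "t < T" "\<gamma> T \<noteq> None"
  obtains y where "y \<in> D" "regularization \<gamma> t = Some y"
    "((\<lambda>q. the (\<gamma> q)) \<longlongrightarrow> y) (at t within dyadic_times \<inter> {t<..})"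
  using limit_before_death[of t "{t<..}" T] regularization_eq[of t T \<gamma>] assms by blast

text \<open>The value of the regularization at \<open>s\<close> is a limit of path values at dyadic times that lie on the
  same side of \<open>t\<close> as \<open>s\<close>, which is why closed sets are inherited.\<close>

lemma regularization_in_closed:
  assumes t: "0 \<le> t" and S: "S = {t<..} \<or> S = {..<t} \<and> 0 < t" and C: "closed C"
    and alive: "\<forall>\<^sub>F q in at t within dyadic_times \<inter> S. \<gamma> q \<noteq> None"
    and ev: "\<forall>\<^sub>F q in at t within dyadic_times \<inter> S. the (\<gamma> q) \<in> C"
  shows "\<forall>\<^sub>F s in at t within S. \<exists>z\<in>D \<inter> C. regularization \<gamma> s = Some z"
proof -
  from alive ev have "\<forall>\<^sub>F q in at t within dyadic_times \<inter> S. \<gamma> q \<noteq> None \<and> the (\<gamma> q) \<in> C"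
    by (rule eventually_conj)
  then obtain d0 where d0: "0 < d0" "\<And>q. \<lbrakk>q \<in> dyadic_times \<inter> S; q \<noteq> t; dist q t < d0\<rbrakk> \<Longrightarrow> \<gamma> q \<noteq> None \<and> the (\<gamma> q) \<in> C"
    unfolding eventually_at by auto
  define d where "d = (if t = 0 then d0 else min d0 t)"
  have d: "0 < d" "d \<le> d0" "t \<noteq> 0 \<Longrightarrow> d \<le> t"
    using d0(1) t by (auto simp: d_def)
  show ?thesis
    unfolding eventually_at
  proof (intro exI[of _ d] conjI ballI impI d(1))
    fix s assume s: "s \<in> S" "s \<noteq> t \<and> dist s t < d"
    have s0: "0 \<le> s"
      using s S d t by (auto simp: dist_real_def)
    have "\<exists>b>s. \<forall>q. s < q \<and> q < b \<longrightarrow> q \<in> S \<and> q \<noteq> t \<and> dist q t < d0"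
      using S
    proof (elim disjE conjE)
      assume "S = {t<..}"
      then show ?thesis
        using s d by (intro exI[of _ "t + d"]) (auto simp: dist_real_def)
    next
      assume "S = {..<t}"
      then show ?thesis
        using s d by (intro exI[of _ t]) (auto simp: dist_real_def)
    qed
    then obtain b where b: "s < b" "\<And>q. s < q \<Longrightarrow> q < b \<Longrightarrow> q \<in> S \<and> q \<noteq> t \<and> dist q t < d0"
      by blast
    have inC: "\<gamma> q \<noteq> None \<and> the (\<gamma> q) \<in> C" if "q \<in> dyadic_times" "s < q" "q < b" for q
      using d0(2) b(2) that by blast
    obtain T where T: "T \<in> dyadic_times" "s < T" "T < b"
      using dyadic_times_dense[OF s0 b(1)] by blast
    obtain y where y: "y \<in> D" "regularization \<gamma> s = Some y"
      "((\<lambda>q. the (\<gamma> q)) \<longlongrightarrow> y) (at s within dyadic_times \<inter> {s<..})"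
      using regularization_alive[OF s0 T(1,2)] inC[OF T] by blast
    have "y \<in> C"
    proof (rule Lim_in_closed_set[OF C _ _ y(3)])
      show "\<forall>\<^sub>F q in at s within dyadic_times \<inter> {s<..}. the (\<gamma> q) \<in> C"
        unfolding eventually_at
        by (intro exI[of _ "b - s"]) (use inC b(1) in \<open>auto simp: dist_real_def\<close>)
      show "at s within dyadic_times \<inter> {s<..} \<noteq> bot"
        using dyadic_times_limit[OF s0, of "{s<..}"] by (simp add: trivial_limit_within)
    qed
    with y show "\<exists>z\<in>D \<inter> C. regularization \<gamma> s = Some z" by blast
  qed
qed

lemma regularization_state:
  assumes "0 \<le> t"
  shows "regularization \<gamma> t \<in> state_cem D"
proof (cases "\<exists>q\<in>dyadic_times. t < q \<and> \<gamma> q \<noteq> None")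
  case True
  then obtain q where q: "q \<in> dyadic_times" "t < q" "\<gamma> q \<noteq> None" by blast
  obtain y where "y \<in> D" "regularization \<gamma> t = Some y"
    using regularization_alive[OF assms q] by blast
  then show ?thesis by (simp add: Some_in_state)
next
  case False
  then have "regularization \<gamma> t = None"
    unfolding regularization_def by (rule if_not_P)
  then show ?thesis by (simp add: None_in_state)
qed

lemma regularization_converges:
  assumes t: "0 \<le> t" and S: "S = {t<..} \<or> S = {..<t} \<and> 0 < t"
    and alive: "\<forall>\<^sub>F q in at t within dyadic_times \<inter> S. \<gamma> q \<noteq> None"
    and y: "((\<lambda>q. the (\<gamma> q)) \<longlongrightarrow> y) (at t within dyadic_times \<inter> S)" and \<epsilon>: "0 < \<epsilon>"
  shows "\<forall>\<^sub>F s in at t within S. \<exists>z\<in>D \<inter> cball y \<epsilon>. regularization \<gamma> s = Some z"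
proof (rule regularization_in_closed[OF t S closed_cball alive])
  show "\<forall>\<^sub>F q in at t within dyadic_times \<inter> S. the (\<gamma> q) \<in> cball y \<epsilon>"
    using tendstoD[OF y \<epsilon>] by eventually_elim (simp add: dist_commute less_imp_le)
qed

lemma alive_eventually:
  assumes "T \<in> dyadic_times" "t < T" "\<gamma> T \<noteq> None"
  shows "\<forall>\<^sub>F q in at t within dyadic_times \<inter> S. \<gamma> q \<noteq> None"
  unfolding eventually_at
proof (intro exI[of _ "T - t"] conjI ballI impI)
  fix q assume "q \<in> dyadic_times \<inter> S" "q \<noteq> t \<and> dist q t < T - t"
  then have "q \<in> dyadic_times" "q \<le> T"
    by (auto simp: dist_real_def)
  then show "\<gamma> q \<noteq> None"
    using absorbed[of q T] assms by blast
qed (use assms in auto)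

lemma regularization_left_converges:
  assumes t: "0 < t" and alive: "regularization \<gamma> t \<noteq> None"
  shows "\<exists>y\<in>D. \<forall>\<epsilon>>0. \<forall>\<^sub>F s in at_left t. \<exists>z\<in>D \<inter> cball y \<epsilon>. regularization \<gamma> s = Some z"
proof -
  obtain T where T: "T \<in> dyadic_times" "t < T" "\<gamma> T \<noteq> None"
    using alive by (auto simp: regularization_def split: if_splits)
  obtain y where y: "y \<in> D" "((\<lambda>q. the (\<gamma> q)) \<longlongrightarrow> y) (at t within dyadic_times \<inter> {..<t})"
    using limit_before_death[of t "{..<t}", OF _ _ T] t by auto
  have "\<forall>\<^sub>F s in at_left t. \<exists>z\<in>D \<inter> cball y \<epsilon>. regularization \<gamma> s = Some z" if "0 < \<epsilon>" for \<epsilon>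
    by (rule regularization_converges[OF _ _ alive_eventually[OF T] y(2) that]) (use t in auto)
  with y(1) show ?thesis by blast
qed

lemma regularization_absorbed: "s \<le> t \<Longrightarrow> regularization \<gamma> s = None \<Longrightarrow> regularization \<gamma> t = None"
  by (auto simp: regularization_def split: if_splits)

lemma regularization_cadlag: "cadlag D (regularization \<gamma>)"
  unfolding cadlag_def
proof (intro conjI allI impI)
  fix t :: real assume t: "0 \<le> t"
  show "limitin (compact_cem D) (\<lambda>s. Some (regularization \<gamma> s)) (Some (regularization \<gamma> t)) (at_right t)"
  proof (cases "regularization \<gamma> t")
    case None
    have "\<forall>\<^sub>F s in at_right t. regularization \<gamma> s = None"
      unfolding eventually_at using regularization_absorbed[OF _ None]
      by (intro exI[of _ 1]) (auto intro: less_imp_le)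
    then show ?thesis
      unfolding None by (rule limitin_compact_cem_const_None)
  next
    case (Some y')
    obtain T where T: "T \<in> dyadic_times" "t < T" "\<gamma> T \<noteq> None"
      using Some by (auto simp: regularization_def split: if_splits)
    obtain y where y: "y \<in> D" "regularization \<gamma> t = Some y"
        "((\<lambda>q. the (\<gamma> q)) \<longlongrightarrow> y) (at t within dyadic_times \<inter> {t<..})"
      using regularization_alive[OF t T] by blast
    show ?thesis
      unfolding y(2)
      by (rule limitin_compact_cem_state[OF y(1)])
        (rule regularization_converges[OF t _ alive_eventually[OF T] y(3)], auto)
  qed
next
  fix t :: real assume t: "0 < t"
  show "\<exists>l. left_limit D (regularization \<gamma>) t l"
  proof (cases "\<exists>q\<in>dyadic_times. q < t \<and> \<gamma> q = None")
    case True
    then obtain q where q: "q \<in> dyadic_times" "q < t" "\<gamma> q = None" by blast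
    have "regularization \<gamma> s = None" if "q \<le> s" for s
      using absorbed[OF q(1) _ _ q(3)] that by (auto simp: regularization_def)
    then have "\<forall>\<^sub>F s in at_left t. regularization \<gamma> s = None"
      unfolding eventually_at using q(2)
      by (intro exI[of _ "t - q"]) (auto simp: dist_real_def)
    then have "left_limit D (regularization \<gamma>) t (Some None)"
      unfolding left_limit_def by (rule limitin_compact_cem_const_None)
    then show ?thesis ..
  next
    case False
    have alive: "\<gamma> q \<noteq> None" if "q \<in> dyadic_times" "q < t" for q
    proof
      assume "\<gamma> q = None"
      with that have "\<exists>q\<in>dyadic_times. q < t \<and> \<gamma> q = None"
        by (intro bexI[of _ q] conjI)
      with False show False ..
    qed
    have ev: "\<forall>\<^sub>F q in at t within dyadic_times \<inter> {..<t}. \<gamma> q \<noteq> None"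
      unfolding eventually_at by (intro exI[of _ 1]) (use alive in auto)
    have "(\<exists>y\<in>D. ((\<lambda>q. the (\<gamma> q)) \<longlongrightarrow> y) (at t within dyadic_times \<inter> {..<t})) \<or>
        filterlim (\<lambda>q. norm (the (\<gamma> q))) at_top (at t within dyadic_times \<inter> {..<t})"
      by (rule left_limit_at_death[OF t]) (rule alive)
    then show ?thesis
    proof (elim disjE bexE)
      fix y assume y: "y \<in> D" "((\<lambda>q. the (\<gamma> q)) \<longlongrightarrow> y) (at t within dyadic_times \<inter> {..<t})"
      have "limitin (compact_cem D) (\<lambda>s. Some (regularization \<gamma> s)) (Some (Some y)) (at_left t)"
        by (rule limitin_compact_cem_state[OF y(1)])
          (rule regularization_converges[OF _ _ ev y(2)], use t in auto)
      then show ?thesis unfolding left_limit_def by blast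
    next
      assume inf: "filterlim (\<lambda>q. norm (the (\<gamma> q))) at_top (at t within dyadic_times \<inter> {..<t})"
      have "limitin (compact_cem D) (\<lambda>s. Some (regularization \<gamma> s)) None (at_left t)"
      proof (rule limitin_compact_cem_infinity)
        fix R :: real
        have "closed {z :: 'v. R + 1 \<le> norm z}"
          by (intro closed_Collect_le continuous_intros)
        moreover have "\<forall>\<^sub>F q in at t within dyadic_times \<inter> {..<t}. the (\<gamma> q) \<in> {z. R + 1 \<le> norm z}"
          using inf unfolding filterlim_at_top by simp
        ultimately have "\<forall>\<^sub>F s in at_left t. \<exists>z\<in>D \<inter> {z. R + 1 \<le> norm z}. regularization \<gamma> s = Some z"
          using t by (intro regularization_in_closed[OF _ _ _ ev]) auto
        then show "\<forall>\<^sub>F s in at_left t. \<exists>z\<in>D. R < norm z \<and> regularization \<gamma> s = Some z"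
          by eventually_elim force
      qed
      then show ?thesis unfolding left_limit_def by blast
    qed
  qed
qed

text \<open>At a time at which the regularized path is alive its left limit is finite, by
  \<open>limit_before_death\<close>.\<close>

lemma regularization_killed: "killed_at_infinity D (regularization \<gamma>)"
  unfolding killed_at_infinity_def
proof (intro allI impI)
  fix s t :: real
  assume s: "0 \<le> s" and inf: "(0 < s \<and> (\<exists>l. left_limit D (regularization \<gamma>) s l \<and> ext_norm l = \<infinity>)) \<or>
      ext_norm (Some (regularization \<gamma> s)) = \<infinity>" and st: "s \<le> t"
  have "regularization \<gamma> s = None"
  proof (rule ccontr)
    assume alive: "regularization \<gamma> s \<noteq> None"
    then have "ext_norm (Some (regularization \<gamma> s)) \<noteq> \<infinity>" by auto
    then obtain l where l: "0 < s" "left_limit D (regularization \<gamma>) s l" "ext_norm l = \<infinity>"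
      using inf by blast
    obtain y where y: "\<And>\<epsilon>. 0 < \<epsilon> \<Longrightarrow> \<forall>\<^sub>F s in at_left s. \<exists>z\<in>D \<inter> cball y \<epsilon>. regularization \<gamma> s = Some z"
      using regularization_left_converges[OF l(1) alive] by blast
    have "ext_norm l \<noteq> \<infinity>"
      by (rule limitin_compact_cem_finite[OF closed_D trivial_limit_at_left_real l(2)[unfolded left_limit_def] y])
    with l(3) show False by simp
  qed
  then show "regularization \<gamma> t = None"
    by (rule regularization_absorbed[OF st])
qed

end

end

section \<open>Martingales of the process along dyadic times\<close>

text \<open>If the Cauchy condition failed at \<open>t\<close>, pairs of dyadic times with values more than \<open>2 e\<close> apart could be
  found one after the other, each closer to \<open>t\<close> than the previous one. On every grid that is fine
  enough to contain \<open>K\<close> such pairs the count is at least \<open>K\<close>. It suffices that the counts on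
  infinitely many grids have a common bound, which is what Fatou's lemma provides.\<close>

lemma finite_oscillation_one_sided_cauchy:
  fixes g :: "real \<Rightarrow> real"
  assumes e: "0 < e" and T: "T \<in> dyadic_times"
    and fr: "\<exists>\<^sub>F n in sequentially. osc_count e (\<lambda>j. g (min (real j / 2 ^ n) T)) (nat \<lceil>T\<rceil> * 2 ^ n) \<le> K0"
    and S: "S = {t<..} \<or> S = {..<t}"
  shows "\<exists>\<delta>>0. \<forall>q\<in>dyadic_times \<inter> S. \<forall>q'\<in>dyadic_times \<inter> S.
     q \<le> T \<and> q' \<le> T \<and> dist q t < \<delta> \<and> dist q' t < \<delta> \<longrightarrow> \<bar>g q - g q'\<bar> \<le> 2 * e"
proof (rule ccontr)
  assume no: "\<not> ?thesis"
  define idx where "idx n q = nat \<lfloor>q * 2 ^ n\<rfloor>" for n :: nat and q :: real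
  define cnt where "cnt n q = osc_count e (\<lambda>j. g (min (real j / 2 ^ n) T)) (idx n q)" for n q
  have idx: "\<forall>\<^sub>F n in sequentially. real (idx n q) / 2 ^ n = q" if q: "q \<in> dyadic_times" for q
  proof -
    obtain j m where jm: "q = real j / 2 ^ m"
      using q by (auto simp: dyadic_times_def)
    have "real (idx n q) / 2 ^ n = q" if "m \<le> n" for n
    proof -
      have "(2::real) ^ n = 2 ^ (n - m) * 2 ^ m"
        using that by (simp flip: power_add)
      then have "q * 2 ^ n = real (j * 2 ^ (n - m))"
        by (simp add: jm)
      then show ?thesis
        unfolding idx_def by (simp only: floor_of_nat nat_int) (simp add: field_simps)
    qed
    then show ?thesis
      unfolding eventually_sequentially by blast
  qed
  have cnt_mono: "cnt n q \<le> cnt n q'" if "q \<le> q'" for n q q'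
    unfolding cnt_def idx_def using that
    by (intro osc_count_mono nat_mono floor_mono mult_right_mono) auto
  have cnt_step: "\<forall>\<^sub>F n in sequentially. cnt n q + 1 \<le> cnt n q'"
    if "q \<in> dyadic_times" "q' \<in> dyadic_times" "q \<le> q'" "q' \<le> T" "2 * e < \<bar>g q - g q'\<bar>" for q q'
    using idx[OF that(1)] idx[OF that(2)]
  proof eventually_elim
    case (elim n)
    have "cnt n q < cnt n q'"
      unfolding cnt_def
    proof (rule osc_count_increases[OF e])
      show "idx n q \<le> idx n q'"
        unfolding idx_def using that(3) by (intro nat_mono floor_mono mult_right_mono) auto
      show "2 * e \<le> \<bar>g (min (real (idx n q) / 2 ^ n) T) - g (min (real (idx n q') / 2 ^ n) T)\<bar>"
        unfolding elim using that by (simp add: min_def)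
    qed
    then show ?case by simp
  qed
  have pair: "\<exists>q q'. q \<in> dyadic_times \<inter> S \<and> q' \<in> dyadic_times \<inter> S \<and> q < q' \<and> q' \<le> T \<and>
      dist q t < \<delta> \<and> dist q' t < \<delta> \<and> 2 * e < \<bar>g q - g q'\<bar>" if d: "0 < \<delta>" for \<delta>
  proof -
    obtain q q' where q: "q \<in> dyadic_times \<inter> S" "q' \<in> dyadic_times \<inter> S" "q \<le> T" "q' \<le> T"
      "dist q t < \<delta>" "dist q' t < \<delta>" "2 * e < \<bar>g q - g q'\<bar>"
      using no d by (meson not_le)
    have "q \<noteq> q'" using q(7) e by auto
    then consider "q < q'" | "q' < q" by linarith
    then show ?thesis
    proof cases
      case 1
      then show ?thesis using q by blast
    next
      case 2
      then show ?thesis using q by (intro exI[of _ q'] exI[of _ q]) (simp add: abs_minus_commute)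
    qed
  qed
  \<comment> \<open>In the induction step the new pair is chosen first; the other pairs are found closer to \<open>t\<close>.\<close>
  have many: "\<exists>a b. a \<in> dyadic_times \<inter> S \<and> b \<in> dyadic_times \<inter> S \<and> dist a t < \<delta> \<and> dist b t < \<delta> \<and> b \<le> T \<and>
      (\<forall>\<^sub>F n in sequentially. cnt n a + K \<le> cnt n b)" if "0 < \<delta>" for \<delta> K
    using that
  proof (induction K arbitrary: \<delta>)
    case 0
    obtain q q' where q: "q \<in> dyadic_times \<inter> S" "q' \<in> dyadic_times \<inter> S" "q < q'" "q' \<le> T" "dist q t < \<delta>" "dist q' t < \<delta>"
      using pair[OF 0] by blast
    then show ?case by (intro exI[of _ q']) auto
  next
    case (Suc K)
    obtain q q' where q: "q \<in> dyadic_times \<inter> S" "q' \<in> dyadic_times \<inter> S" "q < q'" "q' \<le> T"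
        "dist q t < \<delta>" "dist q' t < \<delta>" "2 * e < \<bar>g q - g q'\<bar>"
      using pair[OF Suc.prems] by blast
    have step: "\<forall>\<^sub>F n in sequentially. cnt n q + 1 \<le> cnt n q'"
      using q by (intro cnt_step) auto
    show ?case
      using S
    proof
      assume S: "S = {t<..}"
      then have "0 < q - t" using q by auto
      then obtain a b where ab: "a \<in> dyadic_times \<inter> S" "b \<in> dyadic_times \<inter> S" "dist a t < q - t" "dist b t < q - t"
          "\<forall>\<^sub>F n in sequentially. cnt n a + K \<le> cnt n b"
        using Suc.IH by blast
      have bq: "b \<le> q" and aq: "dist a t < \<delta>"
        using ab q S by (auto simp: dist_real_def)
      have "\<forall>\<^sub>F n in sequentially. cnt n a + Suc K \<le> cnt n q'"
        using ab(5) step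
      proof eventually_elim
        case (elim n)
        then show ?case using cnt_mono[OF bq, of n] by linarith
      qed
      with ab(1) q aq show ?case by blast
    next
      assume S: "S = {..<t}"
      then have "0 < t - q'" using q by auto
      then obtain a b where ab: "a \<in> dyadic_times \<inter> S" "b \<in> dyadic_times \<inter> S" "dist a t < t - q'" "dist b t < t - q'"
          "b \<le> T" "\<forall>\<^sub>F n in sequentially. cnt n a + K \<le> cnt n b"
        using Suc.IH by blast
      have qa: "q' \<le> a" and bt: "dist b t < \<delta>"
        using ab q S by (auto simp: dist_real_def)
      have "\<forall>\<^sub>F n in sequentially. cnt n q + Suc K \<le> cnt n b"
        using ab(6) step
      proof eventually_elim
        case (elim n)
        then show ?case using cnt_mono[OF qa, of n] by linarith
      qed
      with ab(2,5) q bt show ?case by blast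
    qed
  qed
  obtain a b where ab: "b \<in> dyadic_times" "b \<le> T" "\<forall>\<^sub>F n in sequentially. cnt n a + Suc K0 \<le> cnt n b"
    using many[of 1 "Suc K0"] by auto
  have T0: "0 \<le> T" by (rule dyadic_times_nonneg[OF T])
  have "\<forall>\<^sub>F n in sequentially. \<not> osc_count e (\<lambda>j. g (min (real j / 2 ^ n) T)) (nat \<lceil>T\<rceil> * 2 ^ n) \<le> K0"
    using ab(3)
  proof eventually_elim
    case (elim n)
    have "b \<le> real (nat \<lceil>T\<rceil>)"
      using ab(2) real_nat_ceiling_ge[of T] by linarith
    then have "b * 2 ^ n \<le> real (nat \<lceil>T\<rceil> * 2 ^ n)"
      by simp
    then have "\<lfloor>b * 2 ^ n\<rfloor> \<le> \<lfloor>real (nat \<lceil>T\<rceil> * 2 ^ n)\<rfloor>"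
      by (rule floor_mono)
    then have "idx n b \<le> nat \<lceil>T\<rceil> * 2 ^ n"
      unfolding idx_def floor_of_nat by (simp only: nat_le_iff)
    then have "cnt n b \<le> osc_count e (\<lambda>j. g (min (real j / 2 ^ n) T)) (nat \<lceil>T\<rceil> * 2 ^ n)"
      unfolding cnt_def by (rule osc_count_mono)
    with elim show ?case by linarith
  qed
  with fr show False unfolding frequently_def by (rule notE)
qed

locale affine_markov = affine_kernel D p \<Phi> \<psi>
  for D :: "'v::euclidean_space set" and p \<Phi> \<psi> +
  fixes \<Omega> :: "'w set" and P :: "'v option \<Rightarrow> 'w measure" and X :: "real \<Rightarrow> 'w \<Rightarrow> 'v option"
  assumes markov: "markov_process D \<Omega> P (\<lambda>x. natural_filtration D \<Omega> X) p X"
begin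

abbreviation "\<F> \<equiv> natural_filtration D \<Omega> X"

definition kint :: "('v option \<Rightarrow> real) \<Rightarrow> real \<Rightarrow> 'v option \<Rightarrow> real" where
  "kint f h y = (LINT \<xi>|p h y. f \<xi>)"

lemmas markov_parts = markov[unfolded markov_process_def]
lemmas markov_cemetery = markov_parts[THEN conjunct1]
lemmas markov_spaces = markov_parts[THEN conjunct2, THEN conjunct2, THEN conjunct1]
lemmas markov_filtration = markov_parts[THEN conjunct2, THEN conjunct2, THEN conjunct2, THEN conjunct1]
lemmas markov_conditional = markov_parts[THEN conjunct2, THEN conjunct2, THEN conjunct2, THEN conjunct2]

lemma path_state: "0 \<le> t \<Longrightarrow> \<omega> \<in> \<Omega> \<Longrightarrow> X t \<omega> \<in> state_cem D"
  using markov_cemetery unfolding cemetery_process_def by simp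

lemma path_absorbed: "0 \<le> s \<Longrightarrow> s \<le> t \<Longrightarrow> \<omega> \<in> \<Omega> \<Longrightarrow> X s \<omega> = None \<Longrightarrow> X t \<omega> = None"
  using markov_cemetery unfolding cemetery_process_def by simp

lemma
  assumes "x \<in> state_cem D"
  shows prob_space_P: "prob_space (P x)" and space_P: "space (P x) = \<Omega>"
    and subalgebra_P: "0 \<le> t \<Longrightarrow> subalgebra (P x) (\<F> t)"
  using markov_spaces markov_filtration assms by simp_all

lemma natural_filtration_generator:
  "{X s -` A \<inter> \<Omega> |s A. 0 \<le> s \<and> s \<le> t \<and> A \<in> sets (state_algebra D)} \<subseteq> Pow \<Omega>"
  by auto

lemma space_natural_filtration: "space (\<F> t) = \<Omega>"
  unfolding natural_filtration_def by (rule space_measure_of[OF natural_filtration_generator])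

lemma natural_filtration_mono: "s \<le> t \<Longrightarrow> sets (\<F> s) \<subseteq> sets (\<F> t)"
  unfolding natural_filtration_def sets_measure_of[OF natural_filtration_generator]
  by (rule sigma_sets_mono') (use order_trans in blast)

lemma adapted:
  assumes "0 \<le> s" "s \<le> t"
  shows "X s \<in> measurable (\<F> t) (state_algebra D)"
proof (rule measurableI)
  show "X s \<omega> \<in> space (state_algebra D)" if "\<omega> \<in> space (\<F> t)" for \<omega>
    using that path_state assms by (simp add: space_natural_filtration space_state_algebra)
  show "X s -` A \<inter> space (\<F> t) \<in> sets (\<F> t)" if "A \<in> sets (state_algebra D)" for A
    unfolding space_natural_filtration
    unfolding natural_filtration_def sets_measure_of[OF natural_filtration_generator]
    using that assms by (intro sigma_sets.Basic) blast
qed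

lemma X_measurable: "x \<in> state_cem D \<Longrightarrow> 0 \<le> t \<Longrightarrow> X t \<in> measurable (P x) (state_algebra D)"
  by (rule measurable_from_subalg[OF subalgebra_P adapted]) auto

lemma kint_measurable:
  "0 \<le> h \<Longrightarrow> f \<in> borel_measurable (state_algebra D) \<Longrightarrow> kint f h \<in> borel_measurable (state_algebra D)"
  unfolding kint_def[abs_def] by (rule kernel_integral_measurable)

lemma kint_bound:
  "0 \<le> h \<Longrightarrow> f \<in> borel_measurable (state_algebra D) \<Longrightarrow> (\<And>\<xi>. \<xi> \<in> state_cem D \<Longrightarrow> \<bar>f \<xi>\<bar> \<le> K) \<Longrightarrow>
    y \<in> state_cem D \<Longrightarrow> \<bar>kint f h y\<bar> \<le> K"
  unfolding kint_def by (rule kernel_integral_bound)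

lemma markov_integral:
  assumes x: "x \<in> state_cem D" and s: "0 \<le> s" "s \<le> t"
    and f: "f \<in> borel_measurable (state_algebra D)" "\<And>\<xi>. \<xi> \<in> state_cem D \<Longrightarrow> \<bar>f \<xi>\<bar> \<le> K" "f None = 0"
    and G: "G \<in> borel_measurable (\<F> s)" "\<And>\<omega>. \<omega> \<in> \<Omega> \<Longrightarrow> \<bar>G \<omega>\<bar> \<le> L"
  shows "(LINT \<omega>|P x. G \<omega> * f (X t \<omega>)) = (LINT \<omega>|P x. G \<omega> * kint f (t - s) (X s \<omega>))"
proof -
  interpret prob_space "P x" by (rule prob_space_P[OF x])
  have sub: "subalgebra (P x) (\<F> s)" by (rule subalgebra_P[OF x s(1)])
  interpret finite_measure_subalgebra "P x" "\<F> s"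
    by (standard) (rule sub)
  have t: "0 \<le> t" "0 \<le> t - s" using s by auto
  have fX: "(\<lambda>\<omega>. f (X t \<omega>)) \<in> borel_measurable (P x)"
    using measurable_compose[OF X_measurable[OF x t(1)] f(1)] .
  have GM: "G \<in> borel_measurable (P x)"
    by (rule measurable_from_subalg[OF sub G(1)])
  have int: "integrable (P x) (\<lambda>\<omega>. G \<omega> * f (X t \<omega>))"
  proof (rule integrable_const_bound[where B = "\<bar>L\<bar> * \<bar>K\<bar>"])
    show "AE \<omega> in P x. norm (G \<omega> * f (X t \<omega>)) \<le> \<bar>L\<bar> * \<bar>K\<bar>"
      using G(2) f(2) path_state[OF t(1)]
      by (intro AE_I2) (auto simp: space_P[OF x] abs_mult intro!: mult_mono intro: order_trans[OF _ abs_ge_self])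
  qed (use GM fX in auto)
  have bd: "bounded (f ` state_cem D)"
    unfolding bounded_iff using f(2) by auto
  have "AE \<omega> in P x. real_cond_exp (P x) (\<F> s) (\<lambda>\<omega>'. f (X t \<omega>')) \<omega> = kint f (t - s) (X s \<omega>)"
  proof -
    have "AE \<omega> in P x. real_cond_exp (P x) (\<F> s) (\<lambda>\<omega>'. f (X (t - s + s) \<omega>')) \<omega>
             = (LINT \<omega>'|P (X s \<omega>). f (X (t - s) \<omega>')) \<and>
           (LINT \<omega>'|P (X s \<omega>). f (X (t - s) \<omega>')) = (LINT \<xi>:Some ` D|p (t - s) (X s \<omega>). f \<xi>)"
      using markov_conditional s(1) t(2) x f(1,3) bd by blast
    then show ?thesis
      using AE_space
    proof eventually_elim
      case (elim \<omega>)
      then have "X s \<omega> \<in> state_cem D"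
        using path_state[OF s(1)] by (simp add: space_P[OF x])
      from kernel_set_integral[where f = f, OF t(2) this f(3)] elim show ?case
        by (simp add: kint_def)
    qed
  qed
  then have "(LINT \<omega>|P x. G \<omega> * real_cond_exp (P x) (\<F> s) (\<lambda>\<omega>'. f (X t \<omega>')) \<omega>)
      = (LINT \<omega>|P x. G \<omega> * kint f (t - s) (X s \<omega>))"
  proof (intro integral_cong_AE)
    show "(\<lambda>\<omega>. G \<omega> * kint f (t - s) (X s \<omega>)) \<in> borel_measurable (P x)"
      by (intro borel_measurable_times GM measurable_compose[OF X_measurable[OF x s(1)] kint_measurable[OF t(2) f(1)]])
  qed (use GM in auto)
  then show ?thesis
    using real_cond_exp_intg(2)[OF int G(1) fX] by simp
qed

text \<open>The times are stopped at the horizon \<open>T\<close>, so that every grid yields a martingale indexed by all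
  natural numbers.\<close>

lemma dyadic_martingale:
  assumes x: "x \<in> state_cem D" and T: "0 \<le> T"
    and f: "f \<in> borel_measurable (state_algebra D)" "\<And>\<xi>. \<xi> \<in> state_cem D \<Longrightarrow> \<bar>f \<xi>\<bar> \<le> K" "f None = 0"
  defines "\<tau> \<equiv> \<lambda>n j. min (real j / 2 ^ n) T"
  shows "bounded_martingale (P x) (\<lambda>j. \<F> (\<tau> n j)) (\<lambda>j \<omega>. kint f (T - \<tau> n j) (X (\<tau> n j) \<omega>)) K"
proof -
  interpret prob_space "P x" by (rule prob_space_P[OF x])
  have \<tau>: "0 \<le> \<tau> n j" "\<tau> n j \<le> T" "0 \<le> T - \<tau> n j" "\<tau> n j \<le> \<tau> n (Suc j)" for j
    using T by (auto simp: \<tau>_def divide_right_mono min.coboundedI1)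
  show ?thesis
  proof
    show "subalgebra (P x) (\<F> (\<tau> n j))" for j
      by (rule subalgebra_P[OF x \<tau>(1)])
    show "sets (\<F> (\<tau> n j)) \<subseteq> sets (\<F> (\<tau> n (Suc j)))" for j
      by (rule natural_filtration_mono[OF \<tau>(4)])
    show "(\<lambda>\<omega>. kint f (T - \<tau> n j) (X (\<tau> n j) \<omega>)) \<in> borel_measurable (\<F> (\<tau> n j))" for j
      by (rule measurable_compose[OF adapted[OF \<tau>(1) order_refl] kint_measurable[OF \<tau>(3) f(1)]])
    show "\<bar>kint f (T - \<tau> n j) (X (\<tau> n j) \<omega>)\<bar> \<le> K" if "\<omega> \<in> space (P x)" for j \<omega>
      using that path_state[OF \<tau>(1)] by (intro kint_bound[OF \<tau>(3) f(1,2)]) (auto simp: space_P[OF x])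
    fix j :: nat and G :: "'w \<Rightarrow> real" and L
    assume G: "G \<in> borel_measurable (\<F> (\<tau> n j))" "\<And>\<omega>. \<omega> \<in> space (P x) \<Longrightarrow> \<bar>G \<omega>\<bar> \<le> L"
    have G': "G \<in> borel_measurable (\<F> (\<tau> n (Suc j)))"
      using G(1) natural_filtration_mono[OF \<tau>(4)[of j]] by (auto simp: measurable_def space_natural_filtration)
    have GL: "\<bar>G \<omega>\<bar> \<le> L" if "\<omega> \<in> \<Omega>" for \<omega>
      using G(2) that by (simp add: space_P[OF x])
    show "(LINT \<omega>|P x. G \<omega> * kint f (T - \<tau> n (Suc j)) (X (\<tau> n (Suc j)) \<omega>))
      = (LINT \<omega>|P x. G \<omega> * kint f (T - \<tau> n j) (X (\<tau> n j) \<omega>))"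
      using markov_integral[OF x \<tau>(1,2) f G(1) GL] markov_integral[OF x \<tau>(1,2) f G' GL] by simp
  qed
qed

end

section \<open>Almost sure properties of the dyadic skeleton\<close>

context affine_markov
begin

text \<open>The events on the grids increase to the event on all dyadic times. The threshold may be negative,
  which also covers infima.\<close>

lemma maximal_inequality_dyadic:
  fixes a :: real
  assumes x: "x \<in> state_cem D" and T: "T \<in> dyadic_times"
    and f: "f \<in> borel_measurable (state_algebra D)" "\<And>\<xi>. \<xi> \<in> state_cem D \<Longrightarrow> \<bar>f \<xi>\<bar> \<le> K" "f None = 0"
  defines "E \<equiv> {\<omega> \<in> \<Omega>. \<exists>q\<in>dyadic_times. q \<le> T \<and> a \<le> kint f (T - q) (X q \<omega>)}"
  shows "E \<in> sets (P x)" "a * measure (P x) E \<le> (LINT \<omega>|P x. indicator E \<omega> * f (X T \<omega>))"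
proof -
  interpret prob_space "P x" by (rule prob_space_P[OF x])
  have T0: "0 \<le> T" by (rule dyadic_times_nonneg[OF T])
  define \<tau> where "\<tau> n j = min (real j / 2 ^ n) T" for n j :: nat
  define J where "J n = nat \<lceil>T\<rceil> * 2 ^ n" for n :: nat
  define B where "B n = {\<omega> \<in> space (P x). \<exists>i\<le>J n. a \<le> kint f (T - \<tau> n i) (X (\<tau> n i) \<omega>)}" for n
  have TJ: "T \<le> real (nat \<lceil>T\<rceil>)" by (rule real_nat_ceiling_ge)
  have \<tau>J: "\<tau> n (J n) = T" for n
    using TJ by (simp add: \<tau>_def J_def)
  have mart: "bounded_martingale (P x) (\<lambda>j. \<F> (\<tau> n j)) (\<lambda>j \<omega>. kint f (T - \<tau> n j) (X (\<tau> n j) \<omega>)) K" for n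
    unfolding \<tau>_def by (rule dyadic_martingale[OF x T0 f])
  have fX: "(\<lambda>\<omega>. f (X T \<omega>)) \<in> borel_measurable (P x)"
    by (rule measurable_compose[OF X_measurable[OF x T0] f(1)])
  have BM: "B n \<in> sets (P x)" for n
    using bounded_martingale.weak_maximal_inequality(1)[OF mart[of n], where a = a and n = "J n"] subalgebra_P[OF x T0]
    unfolding B_def \<tau>J subalgebra_def by blast
  have ineq: "a * prob (B n) \<le> (LINT \<omega>|P x. indicator (B n) \<omega> * f (X T \<omega>))" for n
  proof -
    have "a * prob (B n) \<le> (LINT \<omega>|P x. indicator (B n) \<omega> * kint f 0 (X T \<omega>))"
      using bounded_martingale.weak_maximal_inequality(2)[OF mart[of n], where a = a and n = "J n"]
      unfolding B_def[symmetric] \<tau>J by simp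
    also have "\<dots> = (LINT \<omega>|P x. indicator (B n) \<omega> * f (X T \<omega>))"
    proof (rule Bochner_Integration.integral_cong)
      fix \<omega> assume "\<omega> \<in> space (P x)"
      then have "kint f 0 (X T \<omega>) = f (X T \<omega>)"
        unfolding kint_def using path_state[OF T0] by (intro kernel_0 f(1)) (simp add: space_P[OF x])
      then show "indicator (B n) \<omega> * kint f 0 (X T \<omega>) = indicator (B n) \<omega> * f (X T \<omega>)" by simp
    qed simp
    finally show ?thesis .
  qed
  have E: "E = (\<Union>n. B n)"
  proof (intro equalityI subsetI)
    fix \<omega> assume "\<omega> \<in> E"
    then obtain q where q: "\<omega> \<in> \<Omega>" "q \<in> dyadic_times" "q \<le> T" "a \<le> kint f (T - q) (X q \<omega>)"
      by (auto simp: E_def)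
    obtain j m where jm: "q = real j / 2 ^ m"
      using q(2) by (auto simp: dyadic_times_def)
    have "real j \<le> real (nat \<lceil>T\<rceil>) * 2 ^ m"
      using q(3) TJ unfolding jm by (simp add: divide_le_eq) (meson mult_right_mono order_trans zero_le_numeral zero_le_power)
    then have "j \<le> J m"
      unfolding J_def by (metis (mono_tags) of_nat_le_iff of_nat_mult of_nat_numeral of_nat_power)
    moreover have "\<tau> m j = q"
      using q(3) by (simp add: \<tau>_def jm)
    ultimately have "\<omega> \<in> B m"
      using q by (auto simp: B_def space_P[OF x])
    then show "\<omega> \<in> (\<Union>n. B n)" by blast
  next
    fix \<omega> assume "\<omega> \<in> (\<Union>n. B n)"
    then obtain n i where "\<omega> \<in> \<Omega>" "a \<le> kint f (T - \<tau> n i) (X (\<tau> n i) \<omega>)"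
      by (auto simp: B_def space_P[OF x])
    moreover have "\<tau> n i \<in> dyadic_times" "\<tau> n i \<le> T"
      using T by (auto simp: \<tau>_def min_def dyadic_times_def)
    ultimately show "\<omega> \<in> E"
      by (auto simp: E_def)
  qed
  show "E \<in> sets (P x)"
    unfolding E using BM by blast
  have inc: "incseq B"
  proof (rule incseq_SucI, rule subsetI)
    fix n \<omega> assume "\<omega> \<in> B n"
    then obtain i where i: "\<omega> \<in> space (P x)" "i \<le> J n" "a \<le> kint f (T - \<tau> n i) (X (\<tau> n i) \<omega>)"
      by (auto simp: B_def)
    have "\<tau> (Suc n) (2 * i) = \<tau> n i" "2 * i \<le> J (Suc n)"
      using i(2) by (auto simp: \<tau>_def J_def)
    then show "\<omega> \<in> B (Suc n)"
      using i unfolding B_def by (intro CollectI conjI exI[of _ "2 * i"]) auto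
  qed
  have "(\<lambda>n. a * prob (B n)) \<longlonglongrightarrow> a * prob E"
    unfolding E by (intro tendsto_intros finite_Lim_measure_incseq inc) (use BM in auto)
  moreover have "(\<lambda>n. LINT \<omega>|P x. indicator (B n) \<omega> * f (X T \<omega>)) \<longlonglongrightarrow> (LINT \<omega>|P x. indicator E \<omega> * f (X T \<omega>))"
  proof (rule integral_dominated_convergence[where w = "\<lambda>_. \<bar>K\<bar>"])
    show "(\<lambda>\<omega>. indicator E \<omega> * f (X T \<omega>)) \<in> borel_measurable (P x)"
      using fX \<open>E \<in> sets (P x)\<close> by (intro borel_measurable_times borel_measurable_indicator)
    show "(\<lambda>\<omega>. indicator (B n) \<omega> * f (X T \<omega>)) \<in> borel_measurable (P x)" for n
      using fX BM by (intro borel_measurable_times borel_measurable_indicator)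
    show "AE \<omega> in P x. (\<lambda>n. indicator (B n) \<omega> * f (X T \<omega>)) \<longlonglongrightarrow> indicator E \<omega> * f (X T \<omega>)"
      unfolding E by (intro AE_I2 tendsto_intros LIMSEQ_indicator_incseq inc)
    show "AE \<omega> in P x. norm (indicator (B n) \<omega> * f (X T \<omega>)) \<le> \<bar>K\<bar>" for n
      using f(2) path_state[OF T0]
      by (intro AE_I2) (auto simp: space_P[OF x] indicator_def intro: order_trans[OF _ abs_ge_self])
  qed simp
  ultimately show "a * prob E \<le> (LINT \<omega>|P x. indicator E \<omega> * f (X T \<omega>))"
    using ineq by (intro LIMSEQ_le) auto
qed

lemma mass_eq_kint: "0 \<le> h \<Longrightarrow> y \<in> state_cem D \<Longrightarrow> mass h y = kint (case_option 0 (\<lambda>x. 1)) h y"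
  unfolding kint_def by (rule mass_eq_integral)

lemma tail_mass_eq_kint:
  assumes "0 \<le> h" "y \<in> state_cem D"
  shows "tail_mass R h y = kint (indicator (Some ` {\<xi> \<in> D. R < norm \<xi>})) h y"
proof -
  have "Some ` {\<xi> \<in> D. R < norm \<xi>} \<inter> space (p h y) = Some ` {\<xi> \<in> D. R < norm \<xi>}"
    using assms by (auto simp: space_kernel state_cem_def)
  then show ?thesis
    by (simp add: tail_mass_def kint_def)
qed

text \<open>The maximal inequality for \<open>-1\<close> and a negative threshold: on the event that the conditional
  survival probability falls below \<open>m\<close>, survival up to \<open>T\<close> has probability at most \<open>m\<close>.\<close>

lemma AE_mass_bounded_below:
  assumes x: "x \<in> state_cem D" and T: "T \<in> dyadic_times"
  shows "AE \<omega> in P x. X T \<omega> \<noteq> None \<longrightarrow> (\<exists>m>0. \<forall>q\<in>dyadic_times. q \<le> T \<longrightarrow> m \<le> mass (T - q) (X q \<omega>))"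
proof -
  interpret prob_space "P x" by (rule prob_space_P[OF x])
  have T0: "0 \<le> T" by (rule dyadic_times_nonneg[OF T])
  define f :: "'v option \<Rightarrow> real" where "f = case_option 0 (\<lambda>x. - 1)"
  have f: "f \<in> borel_measurable (state_algebra D)" "\<And>\<xi>. \<bar>f \<xi>\<bar> \<le> 1" "f None = 0"
    unfolding f_def by (auto intro: option_test_measurable split: option.split)
  have fm: "kint f h y = - mass h y" if "0 \<le> h" "y \<in> state_cem D" for h y
  proof -
    have "f = (\<lambda>\<xi>. - case_option 0 (\<lambda>x. 1) \<xi>)"
      by (auto simp: f_def fun_eq_iff split: option.split)
    then show ?thesis
      by (simp add: mass_eq_kint[OF that] kint_def)
  qed
  define E where "E k = {\<omega> \<in> \<Omega>. \<exists>q\<in>dyadic_times. q \<le> T \<and> - inverse (real (Suc k)) \<le> kint f (T - q) (X q \<omega>)}" for k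
  define L where "L = {\<omega> \<in> \<Omega>. X T \<omega> \<noteq> None}"
  have EM: "E k \<in> sets (P x)" for k
    unfolding E_def by (rule maximal_inequality_dyadic(1)[OF x T f])
  have "L = X T -` (Some ` D) \<inter> space (P x)"
  proof (intro equalityI subsetI)
    fix \<omega> assume "\<omega> \<in> L"
    then have "\<omega> \<in> \<Omega>" "X T \<omega> \<noteq> None" "X T \<omega> \<in> state_cem D"
      using path_state[OF T0] by (auto simp: L_def)
    then show "\<omega> \<in> X T -` (Some ` D) \<inter> space (P x)"
      by (cases "X T \<omega>") (auto simp: state_cem_def space_P[OF x])
  next
    fix \<omega> assume "\<omega> \<in> X T -` (Some ` D) \<inter> space (P x)"
    then show "\<omega> \<in> L"
      by (auto simp: L_def space_P[OF x])
  qed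
  then have LM: "L \<in> sets (P x)"
    using measurable_sets[OF X_measurable[OF x T0] Some_D_sets] by simp
  have le: "prob (E k \<inter> L) \<le> inverse (real (Suc k))" for k
  proof -
    have "- inverse (real (Suc k)) * prob (E k) \<le> (LINT \<omega>|P x. indicator (E k) \<omega> * f (X T \<omega>))"
      unfolding E_def by (rule maximal_inequality_dyadic(2)[OF x T f])
    also have "\<dots> = (LINT \<omega>|P x. - indicator (E k \<inter> L) \<omega>)"
      by (rule Bochner_Integration.integral_cong)
        (auto simp: f_def L_def space_P[OF x] indicator_def split: option.split)
    also have "\<dots> = - prob (E k \<inter> L)"
      using EM LM by (simp add: sets.sets_into_space Int_absorb2 sets.Int)
    finally have "prob (E k \<inter> L) \<le> inverse (real (Suc k)) * prob (E k)" by simp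
    also have "\<dots> \<le> inverse (real (Suc k)) * 1"
      by (intro mult_left_mono prob_le_1) simp
    finally show ?thesis by simp
  qed
  have null: "prob (\<Inter>k. E k \<inter> L) = 0"
  proof (rule antisym)
    have "prob (\<Inter>k. E k \<inter> L) \<le> inverse (real (Suc k))" for k
      by (rule order_trans[OF finite_measure_mono le[of k]]) (use EM LM in auto)
    then show "prob (\<Inter>k. E k \<inter> L) \<le> 0"
      by (intro LIMSEQ_le_const[OF LIMSEQ_inverse_real_of_nat]) auto
  qed simp
  have "(\<Inter>k. E k \<inter> L) \<in> sets (P x)"
    using EM LM by auto
  with null have "AE \<omega> in P x. \<omega> \<notin> (\<Inter>k. E k \<inter> L)"
    by (intro AE_not_in null_setsI) (auto simp: emeasure_eq_measure)
  with AE_space show ?thesis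
  proof eventually_elim
    case (elim \<omega>)
    show ?case
    proof
      assume "X T \<omega> \<noteq> None"
      then obtain k where k: "\<omega> \<notin> E k"
        using elim by (auto simp: L_def space_P[OF x])
      have w: "\<omega> \<in> \<Omega>" using elim by (simp add: space_P[OF x])
      have "inverse (real (Suc k)) \<le> mass (T - q) (X q \<omega>)" if q: "q \<in> dyadic_times" "q \<le> T" for q
      proof -
        have "\<not> - inverse (real (Suc k)) \<le> kint f (T - q) (X q \<omega>)"
          using k w q unfolding E_def by blast
        moreover have "kint f (T - q) (X q \<omega>) = - mass (T - q) (X q \<omega>)"
          using q w path_state dyadic_times_nonneg by (intro fm) auto
        ultimately show ?thesis by simp
      qed
      then show "\<exists>m>0. \<forall>q\<in>dyadic_times. q \<le> T \<longrightarrow> m \<le> mass (T - q) (X q \<omega>)"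
        by (intro exI[of _ "inverse (real (Suc k))"]) auto
    qed
  qed
qed

text \<open>By the maximal inequality, the conditional probability of \<open>|X T| > R\<close> exceeds \<open>e\<close> at some time with
  probability at most \<open>P(|X T| > R) / e\<close>, which tends to zero.\<close>

lemma AE_tail_mass_small:
  assumes x: "x \<in> state_cem D" and T: "T \<in> dyadic_times"
  shows "AE \<omega> in P x. \<forall>e>0. \<exists>R. \<forall>q\<in>dyadic_times. q \<le> T \<longrightarrow> tail_mass R (T - q) (X q \<omega>) \<le> e"
proof -
  interpret prob_space "P x" by (rule prob_space_P[OF x])
  have T0: "0 \<le> T" by (rule dyadic_times_nonneg[OF T])
  define A where "A R = Some ` {\<xi> \<in> D. real R < norm \<xi>}" for R :: nat
  have AM: "A R \<in> sets (state_algebra D)" for R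
    unfolding A_def by (rule tail_set_measurable)
  define f :: "nat \<Rightarrow> 'v option \<Rightarrow> real" where "f R = indicator (A R)" for R
  have f: "f R \<in> borel_measurable (state_algebra D)" "\<And>\<xi>. \<bar>f R \<xi>\<bar> \<le> 1" "f R None = 0" for R
    unfolding f_def using AM by (auto simp: A_def)
  define E where "E k R = {\<omega> \<in> \<Omega>. \<exists>q\<in>dyadic_times. q \<le> T \<and> inverse (real (Suc k)) \<le> kint (f R) (T - q) (X q \<omega>)}" for k R
  define L where "L R = X T -` A R \<inter> space (P x)" for R
  have EM: "E k R \<in> sets (P x)" for k R
    unfolding E_def by (rule maximal_inequality_dyadic(1)[OF x T f])
  have LM: "L R \<in> sets (P x)" for R
    unfolding L_def by (rule measurable_sets[OF X_measurable[OF x T0] AM])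
  have le: "prob (E k R) \<le> real (Suc k) * prob (L R)" for k R
  proof -
    have "inverse (real (Suc k)) * prob (E k R) \<le> (LINT \<omega>|P x. indicator (E k R) \<omega> * f R (X T \<omega>))"
      unfolding E_def by (rule maximal_inequality_dyadic(2)[OF x T f])
    also have "\<dots> = (LINT \<omega>|P x. indicator (E k R \<inter> L R) \<omega>)"
      by (rule Bochner_Integration.integral_cong) (auto simp: f_def L_def indicator_def)
    also have "\<dots> = prob (E k R \<inter> L R)"
      using EM LM by (simp add: sets.sets_into_space Int_absorb2 sets.Int)
    also have "\<dots> \<le> prob (L R)"
      by (rule finite_measure_mono) (use LM in auto)
    finally show ?thesis by (simp add: field_simps)
  qed
  have "decseq L"
    by (rule decseq_SucI) (auto simp: L_def A_def)
  then have "(\<lambda>R. prob (L R)) \<longlonglongrightarrow> prob (\<Inter>R. L R)"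
    by (intro finite_Lim_measure_decseq) (use LM in auto)
  moreover have "(\<Inter>R. L R) = {}"
  proof (rule equals0I)
    fix \<omega> assume w: "\<omega> \<in> (\<Inter>R. L R)"
    then have "X T \<omega> \<in> A 0" by (auto simp: L_def)
    then obtain \<xi> where xi: "X T \<omega> = Some \<xi>" by (auto simp: A_def)
    obtain R :: nat where R: "norm \<xi> < real R" using reals_Archimedean2 by blast
    have "X T \<omega> \<in> A R" using w by (auto simp: L_def)
    with xi R show False by (auto simp: A_def)
  qed
  ultimately have L0: "(\<lambda>R. prob (L R)) \<longlonglongrightarrow> 0" by simp
  have null: "prob (\<Inter>R. E k R) = 0" for k
  proof (rule antisym)
    have "(\<lambda>R. real (Suc k) * prob (L R)) \<longlonglongrightarrow> real (Suc k) * 0"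
      by (intro tendsto_intros L0)
    then have lim: "(\<lambda>R. real (Suc k) * prob (L R)) \<longlonglongrightarrow> 0"
      by (simp only: mult_zero_right)
    have "prob (\<Inter>R. E k R) \<le> real (Suc k) * prob (L R)" for R
      by (rule order_trans[OF finite_measure_mono le[of k R]]) (use EM in auto)
    then show "prob (\<Inter>R. E k R) \<le> 0"
      by (intro LIMSEQ_le_const[OF lim]) blast
  qed simp
  have "AE \<omega> in P x. \<forall>k. \<omega> \<notin> (\<Inter>R. E k R)"
    unfolding AE_all_countable
  proof
    fix k
    have "(\<Inter>R. E k R) \<in> sets (P x)"
      using EM by auto
    with null[of k] show "AE \<omega> in P x. \<omega> \<notin> (\<Inter>R. E k R)"
      by (intro AE_not_in null_setsI) (auto simp: emeasure_eq_measure)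
  qed
  with AE_space show ?thesis
  proof eventually_elim
    case (elim \<omega>)
    show ?case
    proof (intro allI impI)
      fix e :: real assume "0 < e"
      then obtain k where k: "inverse (real (Suc k)) < e"
        using reals_Archimedean by blast
      obtain R where R: "\<omega> \<notin> E k R"
        using elim by blast
      have w: "\<omega> \<in> \<Omega>" using elim by (simp add: space_P[OF x])
      have "tail_mass (real R) (T - q) (X q \<omega>) \<le> e" if q: "q \<in> dyadic_times" "q \<le> T" for q
      proof -
        have "\<not> inverse (real (Suc k)) \<le> kint (f R) (T - q) (X q \<omega>)"
          using R w q unfolding E_def by blast
        moreover have "tail_mass (real R) (T - q) (X q \<omega>) = kint (f R) (T - q) (X q \<omega>)"
          unfolding f_def A_def using q w path_state dyadic_times_nonneg by (intro tail_mass_eq_kint) auto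
        ultimately show ?thesis using k by simp
      qed
      then show "\<exists>R. \<forall>q\<in>dyadic_times. q \<le> T \<longrightarrow> tail_mass R (T - q) (X q \<omega>) \<le> e" by blast
    qed
  qed
qed

text \<open>The expected counts are bounded uniformly over all grids, so by Fatou's lemma their lower limit is
  almost surely finite.\<close>

lemma AE_one_sided_cauchy:
  assumes x: "x \<in> state_cem D" and T: "T \<in> dyadic_times"
    and f: "f \<in> borel_measurable (state_algebra D)" "\<And>\<xi>. \<xi> \<in> state_cem D \<Longrightarrow> \<bar>f \<xi>\<bar> \<le> K" "f None = 0"
  shows "AE \<omega> in P x. \<forall>t. \<forall>S\<in>{{t<..}, {..<t}}. \<forall>e>0. \<exists>\<delta>>0. \<forall>q\<in>dyadic_times \<inter> S. \<forall>q'\<in>dyadic_times \<inter> S.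
     q \<le> T \<and> q' \<le> T \<and> dist q t < \<delta> \<and> dist q' t < \<delta> \<longrightarrow>
     \<bar>kint f (T - q) (X q \<omega>) - kint f (T - q') (X q' \<omega>)\<bar> \<le> e"
proof -
  interpret prob_space "P x" by (rule prob_space_P[OF x])
  have T0: "0 \<le> T" by (rule dyadic_times_nonneg[OF T])
  define g where "g \<omega> q = kint f (T - q) (X q \<omega>)" for \<omega> q
  define C where "C e n \<omega> = osc_count e (\<lambda>j. g \<omega> (min (real j / 2 ^ n) T)) (nat \<lceil>T\<rceil> * 2 ^ n)" for e n \<omega>
  have fin: "AE \<omega> in P x. \<exists>K0. \<exists>\<^sub>F n in sequentially. C e n \<omega> \<le> K0" if e: "0 < e" for e
  proof -
    have mart: "bounded_martingale (P x) (\<lambda>j. \<F> (min (real j / 2 ^ n) T)) (\<lambda>j \<omega>. g \<omega> (min (real j / 2 ^ n) T)) K" for n :: nat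
      unfolding g_def by (rule dyadic_martingale[OF x T0 f])
    have meas: "(\<lambda>\<omega>. real (C e n \<omega>)) \<in> borel_measurable (P x)" for n
      unfolding C_def
      by (rule bounded_martingale.F_measurable_M[OF mart bounded_martingale.osc_measurable(2)[OF mart]])
    have bd: "(\<integral>\<^sup>+ \<omega>. ennreal (real (C e n \<omega>)) \<partial>P x) \<le> ennreal (K\<^sup>2 / e\<^sup>2)" for n
    proof -
      have "integrable (P x) (\<lambda>\<omega>. real (C e n \<omega>))"
      proof (rule integrable_const_bound[where B = "real (nat \<lceil>T\<rceil> * 2 ^ n)"])
        show "AE \<omega> in P x. norm (real (C e n \<omega>)) \<le> real (nat \<lceil>T\<rceil> * 2 ^ n)"
          unfolding C_def using bounded_martingale.osc_bounds(2)[OF mart]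
          by (intro AE_I2) (simp only: real_norm_def abs_of_nat of_nat_le_iff)
      qed (rule meas)
      then have "(\<integral>\<^sup>+ \<omega>. ennreal (real (C e n \<omega>)) \<partial>P x) = ennreal (LINT \<omega>|P x. real (C e n \<omega>))"
        by (rule nn_integral_eq_integral) simp
      moreover have "e\<^sup>2 * (LINT \<omega>|P x. real (C e n \<omega>)) \<le> K\<^sup>2"
        unfolding C_def by (rule bounded_martingale.expected_osc_count[OF mart e])
      then have "(LINT \<omega>|P x. real (C e n \<omega>)) \<le> K\<^sup>2 / e\<^sup>2"
        using e by (simp add: pos_le_divide_eq mult.commute)
      ultimately show ?thesis
        by (simp add: ennreal_leI)
    qed
    have "(\<integral>\<^sup>+ \<omega>. liminf (\<lambda>n. ennreal (real (C e n \<omega>))) \<partial>P x)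
        \<le> liminf (\<lambda>n. \<integral>\<^sup>+ \<omega>. ennreal (real (C e n \<omega>)) \<partial>P x)"
      by (rule nn_integral_liminf) (use meas in measurable)
    also have "\<dots> \<le> ennreal (K\<^sup>2 / e\<^sup>2)"
      by (intro Liminf_le sequentially_bot always_eventually allI bd)
    also have "\<dots> < \<infinity>" by simp
    finally have "(\<integral>\<^sup>+ \<omega>. liminf (\<lambda>n. ennreal (real (C e n \<omega>))) \<partial>P x) \<noteq> \<infinity>" by simp
    then have "AE \<omega> in P x. liminf (\<lambda>n. ennreal (real (C e n \<omega>))) \<noteq> \<infinity>"
      by (intro nn_integral_PInf_AE) (use meas in measurable)
    then show ?thesis
    proof eventually_elim
      case (elim \<omega>)
      show ?case
      proof (rule ccontr)
        assume no: "\<not> (\<exists>K0. \<exists>\<^sub>F n in sequentially. C e n \<omega> \<le> K0)"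
        have "of_nat K0 \<le> liminf (\<lambda>n. ennreal (real (C e n \<omega>)))" for K0
        proof (rule Liminf_bounded)
          have "\<forall>\<^sub>F n in sequentially. \<not> C e n \<omega> \<le> K0"
            using no by (simp add: not_frequently)
          then show "\<forall>\<^sub>F n in sequentially. of_nat K0 \<le> ennreal (real (C e n \<omega>))"
            by eventually_elim (simp add: ennreal_of_nat_eq_real_of_nat)
        qed
        moreover obtain K0 where "liminf (\<lambda>n. ennreal (real (C e n \<omega>))) < of_nat K0"
          using elim ennreal_Ex_less_of_nat[of "liminf (\<lambda>n. ennreal (real (C e n \<omega>)))"] by (auto simp: less_top)
        ultimately show False
          by (meson not_le)
      qed
    qed
  qed
  have "AE \<omega> in P x. \<forall>k. \<exists>K0. \<exists>\<^sub>F n in sequentially. C (inverse (real (Suc k))) n \<omega> \<le> K0"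
    unfolding AE_all_countable by (intro allI fin) simp
  then show ?thesis
  proof eventually_elim
    case (elim \<omega>)
    show ?case
    proof (intro allI ballI impI)
      fix t and S :: "real set" and e :: real
      assume S: "S \<in> {{t<..}, {..<t}}" and e: "0 < e"
      obtain k where k: "inverse (real (Suc k)) < e / 2"
        using reals_Archimedean[of "e / 2"] e by auto
      obtain K0 where K0: "\<exists>\<^sub>F n in sequentially. osc_count (inverse (real (Suc k))) (\<lambda>j. g \<omega> (min (real j / 2 ^ n) T)) (nat \<lceil>T\<rceil> * 2 ^ n) \<le> K0"
        using elim unfolding C_def by blast
      obtain \<delta> where d: "0 < \<delta>" "\<forall>q\<in>dyadic_times \<inter> S. \<forall>q'\<in>dyadic_times \<inter> S.
          q \<le> T \<and> q' \<le> T \<and> dist q t < \<delta> \<and> dist q' t < \<delta> \<longrightarrow> \<bar>g \<omega> q - g \<omega> q'\<bar> \<le> 2 * inverse (real (Suc k))"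
        using finite_oscillation_one_sided_cauchy[OF _ T K0, of S t] S by auto
      have "2 * inverse (real (Suc k)) \<le> e" using k by simp
      with d show "\<exists>\<delta>>0. \<forall>q\<in>dyadic_times \<inter> S. \<forall>q'\<in>dyadic_times \<inter> S.
         q \<le> T \<and> q' \<le> T \<and> dist q t < \<delta> \<and> dist q' t < \<delta> \<longrightarrow>
         \<bar>kint f (T - q) (X q \<omega>) - kint f (T - q') (X q' \<omega>)\<bar> \<le> e"
        unfolding g_def by (meson order_trans)
    qed
  qed
qed

end

section \<open>The regularized process is a version\<close>

context affine_markov
begin

lemma AE_good_path:
  assumes x: "x \<in> state_cem D"
  shows "AE \<omega> in P x. good_path (\<lambda>t. X t \<omega>)"
proof -
  define c :: "'v \<Rightarrow> nat \<Rightarrow> 'v option \<Rightarrow> real" where "c b n = case_option 0 (\<lambda>x. cos (((1 / real n) *\<^sub>R b) \<bullet> x))" for b n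
  define s :: "'v \<Rightarrow> nat \<Rightarrow> 'v option \<Rightarrow> real" where "s b n = case_option 0 (\<lambda>x. sin (((1 / real n) *\<^sub>R b) \<bullet> x))" for b n
  define Q where "Q f T \<omega> \<longleftrightarrow> (\<forall>t. \<forall>S\<in>{{t<..}, {..<t}}. \<forall>e>0. \<exists>\<delta>>0. \<forall>q\<in>dyadic_times \<inter> S. \<forall>q'\<in>dyadic_times \<inter> S.
     q \<le> T \<and> q' \<le> T \<and> dist q t < \<delta> \<and> dist q' t < \<delta> \<longrightarrow>
     \<bar>kint f (T - q) (X q \<omega>) - kint f (T - q') (X q' \<omega>)\<bar> \<le> e)" for f T \<omega>
  have Qc: "AE \<omega> in P x. Q (c b n) T \<omega>" if "T \<in> dyadic_times" for b n T
    unfolding Q_def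
  proof (rule AE_one_sided_cauchy[OF x that, where K = 1])
    show "c b n \<in> borel_measurable (state_algebra D)"
      unfolding c_def by (intro option_test_measurable borel_measurable_continuous_onI continuous_intros)
  qed (auto simp: c_def split: option.split)
  have Qs: "AE \<omega> in P x. Q (s b n) T \<omega>" if "T \<in> dyadic_times" for b n T
    unfolding Q_def
  proof (rule AE_one_sided_cauchy[OF x that, where K = 1])
    show "s b n \<in> borel_measurable (state_algebra D)"
      unfolding s_def by (intro option_test_measurable borel_measurable_continuous_onI continuous_intros)
  qed (auto simp: s_def split: option.split)
  have B: "countable (Basis :: 'v set)"
    by (rule countable_finite[OF finite_Basis])
  have "AE \<omega> in P x. \<forall>T\<in>dyadic_times. X T \<omega> \<noteq> None \<longrightarrow>
      (\<exists>m>0. \<forall>q\<in>dyadic_times. q \<le> T \<longrightarrow> m \<le> mass (T - q) (X q \<omega>))"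
    unfolding AE_ball_countable[OF countable_dyadic_times] using AE_mass_bounded_below[OF x] by blast
  moreover have "AE \<omega> in P x. \<forall>T\<in>dyadic_times. \<forall>e>0. \<exists>R. \<forall>q\<in>dyadic_times. q \<le> T \<longrightarrow> tail_mass R (T - q) (X q \<omega>) \<le> e"
    unfolding AE_ball_countable[OF countable_dyadic_times] using AE_tail_mass_small[OF x] by blast
  moreover have "AE \<omega> in P x. \<forall>T\<in>dyadic_times. \<forall>b\<in>Basis. \<forall>n. Q (c b n) T \<omega>"
    unfolding AE_ball_countable[OF countable_dyadic_times] AE_ball_countable[OF B] AE_all_countable
    using Qc by blast
  moreover have "AE \<omega> in P x. \<forall>T\<in>dyadic_times. \<forall>b\<in>Basis. \<forall>n. Q (s b n) T \<omega>"
    unfolding AE_ball_countable[OF countable_dyadic_times] AE_ball_countable[OF B] AE_all_countable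
    using Qs by blast
  ultimately show ?thesis
    using AE_space
  proof eventually_elim
    case (elim \<omega>)
    have w: "\<omega> \<in> \<Omega>" using elim(5) by (simp add: space_P[OF x])
    show ?case
      unfolding good_path_def
    proof (intro conjI)
      show "\<forall>T\<in>dyadic_times. \<forall>b\<in>Basis. \<forall>n. \<forall>t. \<forall>S\<in>{{t<..}, {..<t}}. \<forall>e>0. \<exists>\<delta>>0.
        \<forall>q\<in>dyadic_times \<inter> S. \<forall>q'\<in>dyadic_times \<inter> S.
          q \<le> T \<and> q' \<le> T \<and> dist q t < \<delta> \<and> dist q' t < \<delta> \<longrightarrow>
          norm (cf (T - q) ((1 / real n) *\<^sub>R b) (X q \<omega>) - cf (T - q') ((1 / real n) *\<^sub>R b) (X q' \<omega>)) \<le> e"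
      proof (intro ballI allI impI)
        fix T b n and t :: real and S :: "real set" and e :: real
        assume T: "T \<in> dyadic_times" and b: "b \<in> (Basis :: 'v set)" and S: "S \<in> {{t<..}, {..<t}}" and e: "0 < e"
        then have e2: "0 < e / 2" by simp
        have "Q (c b n) T \<omega>" "Q (s b n) T \<omega>"
          using elim(3,4) T b by blast+
        note QQ = this[unfolded Q_def, rule_format, OF S e2]
        obtain d1 where d1: "0 < d1" "\<And>q q'. \<lbrakk>q \<in> dyadic_times \<inter> S; q' \<in> dyadic_times \<inter> S; q \<le> T; q' \<le> T; dist q t < d1; dist q' t < d1\<rbrakk>
            \<Longrightarrow> \<bar>kint (c b n) (T - q) (X q \<omega>) - kint (c b n) (T - q') (X q' \<omega>)\<bar> \<le> e / 2"
          using QQ(1) by blast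
        obtain d2 where d2: "0 < d2" "\<And>q q'. \<lbrakk>q \<in> dyadic_times \<inter> S; q' \<in> dyadic_times \<inter> S; q \<le> T; q' \<le> T; dist q t < d2; dist q' t < d2\<rbrakk>
            \<Longrightarrow> \<bar>kint (s b n) (T - q) (X q \<omega>) - kint (s b n) (T - q') (X q' \<omega>)\<bar> \<le> e / 2"
          using QQ(2) by blast
        let ?v = "(1 / real n) *\<^sub>R b"
        have Rc: "Re (cf (T - q) ?v (X q \<omega>)) = kint (c b n) (T - q) (X q \<omega>)"
          and Is: "Im (cf (T - q) ?v (X q \<omega>)) = kint (s b n) (T - q) (X q \<omega>)"
          if "q \<in> dyadic_times" "q \<le> T" for q
        proof -
          have *: "0 \<le> T - q" "X q \<omega> \<in> state_cem D"
            using that path_state[OF dyadic_times_nonneg w] by auto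
          show "Re (cf (T - q) ?v (X q \<omega>)) = kint (c b n) (T - q) (X q \<omega>)"
            unfolding kint_def c_def by (rule Re_cf[OF *])
          show "Im (cf (T - q) ?v (X q \<omega>)) = kint (s b n) (T - q) (X q \<omega>)"
            unfolding kint_def s_def by (rule Im_cf[OF *])
        qed
        show "\<exists>\<delta>>0. \<forall>q\<in>dyadic_times \<inter> S. \<forall>q'\<in>dyadic_times \<inter> S.
          q \<le> T \<and> q' \<le> T \<and> dist q t < \<delta> \<and> dist q' t < \<delta> \<longrightarrow>
          norm (cf (T - q) ?v (X q \<omega>) - cf (T - q') ?v (X q' \<omega>)) \<le> e"
        proof (intro exI[of _ "min d1 d2"] conjI ballI impI)
          fix q q' assume q: "q \<in> dyadic_times \<inter> S" "q' \<in> dyadic_times \<inter> S"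
            "q \<le> T \<and> q' \<le> T \<and> dist q t < min d1 d2 \<and> dist q' t < min d1 d2"
          let ?z = "cf (T - q) ?v (X q \<omega>) - cf (T - q') ?v (X q' \<omega>)"
          have "\<bar>Re ?z\<bar> \<le> e / 2"
            using d1(2)[OF q(1,2)] q by (simp add: Rc)
          moreover have "\<bar>Im ?z\<bar> \<le> e / 2"
            using d2(2)[OF q(1,2)] q by (simp add: Is)
          ultimately show "norm ?z \<le> e"
            using cmod_le[of ?z] by linarith
        qed (use d1 d2 in auto)
      qed
    qed (use elim(1,2) in blast)+
  qed
qed

end

locale affine_markov_short_time =
  affine_markov D p \<Phi> \<psi> \<Omega> P X + affine_kernel_short_time D p \<Phi> \<psi> x0 h1
  for D :: "'v::euclidean_space set" and p \<Phi> \<psi> and \<Omega> :: "'w set" and P X x0 h1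
begin

text \<open>Paths that are not good form a null set under every initial state; they are sent to the cemetery so
  that all paths are cadlag.\<close>

definition Y :: "real \<Rightarrow> 'w \<Rightarrow> 'v option" where
  "Y t \<omega> = (if good_path (\<lambda>t. X t \<omega>) then regularization (\<lambda>t. X t \<omega>) t else None)"

lemma path_dyadic_state: "\<omega> \<in> \<Omega> \<Longrightarrow> q \<in> dyadic_times \<Longrightarrow> X q \<omega> \<in> state_cem D"
  by (rule path_state[OF dyadic_times_nonneg])

lemma path_dyadic_absorbed:
  "\<omega> \<in> \<Omega> \<Longrightarrow> q \<in> dyadic_times \<Longrightarrow> q' \<in> dyadic_times \<Longrightarrow> q \<le> q' \<Longrightarrow> X q \<omega> = None \<Longrightarrow> X q' \<omega> = None"
  by (rule path_absorbed[OF dyadic_times_nonneg])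

lemma Y_cemetery: "cemetery_process D \<Omega> Y"
  unfolding cemetery_process_def
proof (intro conjI allI impI ballI)
  fix t \<omega> assume t: "0 \<le> (t::real)" and w: "\<omega> \<in> \<Omega>"
  show "Y t \<omega> \<in> state_cem D"
  proof (cases "good_path (\<lambda>t. X t \<omega>)")
    case True
    have "regularization (\<lambda>t. X t \<omega>) t \<in> state_cem D"
      by (rule regularization_state[OF True path_dyadic_state[OF w] path_dyadic_absorbed[OF w] t])
    then show ?thesis using True by (simp add: Y_def)
  qed (simp add: Y_def None_in_state)
next
  fix s t \<omega> assume "s \<le> (t::real)" "Y s \<omega> = None"
  then show "Y t \<omega> = None"
    by (auto simp: Y_def regularization_def split: if_splits)
qed

lemma Y_cadlag: "\<omega> \<in> \<Omega> \<Longrightarrow> cadlag D (\<lambda>t. Y t \<omega>)"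
proof (cases "good_path (\<lambda>t. X t \<omega>)")
  case True
  assume w: "\<omega> \<in> \<Omega>"
  have "cadlag D (regularization (\<lambda>t. X t \<omega>))"
    by (rule regularization_cadlag[OF True path_dyadic_state[OF w] path_dyadic_absorbed[OF w]])
  then show ?thesis using True by (simp add: Y_def[abs_def])
next
  case False
  then have "Y t \<omega> = None" for t by (simp add: Y_def)
  moreover have "limitin (compact_cem D) (\<lambda>t. Some None) (Some None) F" for F :: "real filter"
    by (rule limitin_compact_cem_const_None) simp
  ultimately show ?thesis
    unfolding cadlag_def left_limit_def by (auto intro!: exI[of _ "Some None"])
qed

lemma Y_killed: "\<omega> \<in> \<Omega> \<Longrightarrow> killed_at_infinity D (\<lambda>t. Y t \<omega>)"
proof (cases "good_path (\<lambda>t. X t \<omega>)")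
  case True
  assume w: "\<omega> \<in> \<Omega>"
  have "killed_at_infinity D (regularization (\<lambda>t. X t \<omega>))"
    by (rule regularization_killed[OF True path_dyadic_state[OF w] path_dyadic_absorbed[OF w]])
  then show ?thesis using True by (simp add: Y_def[abs_def])
next
  case False
  then show ?thesis by (simp add: killed_at_infinity_def Y_def)
qed

lemma kint_tendsto:
  assumes r: "r \<longlonglongrightarrow> 0" "\<And>k. 0 \<le> r k" and y: "y \<in> state_cem D"
    and f: "continuous_on UNIV f" "\<And>z. \<bar>f z\<bar> \<le> K"
  shows "(\<lambda>k. kint (case_option 0 f) (r k) y) \<longlonglongrightarrow> case_option 0 f y"
proof -
  have m: "case_option 0 f \<in> borel_measurable (state_algebra D)"
    by (intro option_test_measurable borel_measurable_continuous_onI f)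
  show ?thesis
  proof (cases y)
    case None
    then show ?thesis using r(2) m by (simp add: kint_def kernel_None)
  next
    case (Some z)
    then have z: "z \<in> D" using y by (simp add: Some_in_state)
    have "((\<lambda>s. LINT \<xi>|p s (Some z). case_option 0 f \<xi>) \<longlongrightarrow> (LINT \<xi>|p 0 (Some z). case_option 0 f \<xi>)) (at 0 within {0..})"
      by (rule kernel_continuous[OF order_refl z f])
    then have c: "continuous (at 0 within {0..}) (\<lambda>s. LINT \<xi>|p s (Some z). case_option 0 f \<xi>)"
      by (simp add: continuous_within)
    have "(\<lambda>k. LINT \<xi>|p (r k) (Some z). case_option 0 f \<xi>) \<longlonglongrightarrow> (LINT \<xi>|p 0 (Some z). case_option 0 f \<xi>)"
      using c r unfolding continuous_within_sequentially comp_def by auto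
    then show ?thesis
      using kernel_0[OF y m] Some by (simp add: kint_def)
  qed
qed

text \<open>The second moment of \<open>f(X q) - f(X t)\<close> is expressed by the kernels \<open>p\<^bsub>q-t\<^esub>\<close> at \<open>X t\<close> and tends to
  zero by stochastic continuity; on the other hand \<open>f(X q)\<close> converges to \<open>f(Y t)\<close> on good paths.\<close>

lemma Y_agrees_on_test_functions:
  fixes f :: "'v \<Rightarrow> real"
  assumes x: "x \<in> state_cem D" and t: "0 \<le> t" and f: "continuous_on UNIV f" "\<And>z. \<bar>f z\<bar> \<le> K"
  shows "AE \<omega> in P x. case_option 0 f (Y t \<omega>) = case_option 0 f (X t \<omega>)"
proof -
  interpret prob_space "P x" by (rule prob_space_P[OF x])
  define g where "g = case_option 0 f"
  define g2 where "g2 = case_option 0 (\<lambda>z. (f z)\<^sup>2)"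
  have K: "0 \<le> K" using f(2)[of 0] by linarith
  have f2: "continuous_on UNIV (\<lambda>z. (f z)\<^sup>2)" "\<bar>(f z)\<^sup>2\<bar> \<le> K\<^sup>2" for z
    using f(1) f(2)[of z] power_mono[OF f(2)[of z], of 2] by (auto intro!: continuous_intros)
  have g: "g \<in> borel_measurable (state_algebra D)" "\<And>\<xi>. \<bar>g \<xi>\<bar> \<le> K" "g None = 0"
    and g2: "g2 \<in> borel_measurable (state_algebra D)" "\<And>\<xi>. \<bar>g2 \<xi>\<bar> \<le> K\<^sup>2" "g2 None = 0"
    unfolding g_def g2_def using f f2 K
    by (auto intro!: option_test_measurable borel_measurable_continuous_onI split: option.split)
  have gg: "g \<xi> * g \<xi> = g2 \<xi>" for \<xi>
    by (auto simp: g_def g2_def power2_eq_square split: option.split)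
  have "\<exists>q\<in>dyadic_times. t < q \<and> q < t + inverse (real (Suc k))" for k
    using dyadic_times_dense[OF t, of "t + inverse (real (Suc k))"] by (metis inverse_positive_iff_positive less_add_same_cancel1 of_nat_0_less_iff zero_less_Suc)
  then obtain q where q: "\<And>k. q k \<in> dyadic_times" "\<And>k. t < q k" "\<And>k. q k < t + inverse (real (Suc k))"
    by metis
  have q0: "0 \<le> q k" "t \<le> q k" "0 \<le> q k - t" for k
    using dyadic_times_nonneg[OF q(1)] q(2)[of k] by auto
  have r: "(\<lambda>k. q k - t) \<longlonglongrightarrow> 0"
  proof (rule tendsto_sandwich[OF _ _ tendsto_const LIMSEQ_inverse_real_of_nat])
    show "\<forall>\<^sub>F k in sequentially. q k - t \<le> inverse (real (Suc k))"
    proof (intro always_eventually allI)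
      fix k show "q k - t \<le> inverse (real (Suc k))" using q(3)[of k] by linarith
    qed
  qed (use q0 in simp)
  have qt: "q \<longlonglongrightarrow> t"
    using tendsto_add[OF r tendsto_const[of t]] by simp
  have Xm: "X u \<in> measurable (P x) (state_algebra D)" if "0 \<le> u" for u
    by (rule X_measurable[OF x that])
  have gX: "(\<lambda>\<omega>. g (X u \<omega>)) \<in> borel_measurable (P x)" "(\<lambda>\<omega>. g2 (X u \<omega>)) \<in> borel_measurable (P x)" if "0 \<le> u" for u
    using measurable_compose[OF Xm[OF that] g(1)] measurable_compose[OF Xm[OF that] g2(1)] .
  have kX: "(\<lambda>\<omega>. kint g (q k - t) (X t \<omega>)) \<in> borel_measurable (P x)"
    "(\<lambda>\<omega>. kint g2 (q k - t) (X t \<omega>)) \<in> borel_measurable (P x)" for k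
    using measurable_compose[OF Xm[OF t] kint_measurable[OF q0(3) g(1)]]
      measurable_compose[OF Xm[OF t] kint_measurable[OF q0(3) g2(1)]] .
  have kb: "\<bar>kint g (q k - t) (X t \<omega>)\<bar> \<le> K" "\<bar>kint g2 (q k - t) (X t \<omega>)\<bar> \<le> K\<^sup>2" if "\<omega> \<in> space (P x)" for k \<omega>
    using kint_bound[OF q0(3) g(1,2)] kint_bound[OF q0(3) g2(1,2)] path_state[OF t] that
    by (auto simp: space_P[OF x])
  have ig2: "integrable (P x) (\<lambda>\<omega>. g2 (X u \<omega>))" if "0 \<le> u" for u
    by (rule integrable_const_bound[where B = "K\<^sup>2"]) (use g2 gX[OF that] in auto)
  have ig: "integrable (P x) (\<lambda>\<omega>. g (X t \<omega>) * g (X u \<omega>))" if "0 \<le> u" for u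
    by (rule integrable_const_bound[where B = "K * K"])
      (use g gX[OF that] gX[OF t] K in \<open>auto simp: abs_mult intro!: AE_I2 mult_mono\<close>)
  define U where "U k \<omega> = (g (X (q k) \<omega>) - g (X t \<omega>))\<^sup>2" for k \<omega>
  have Ueq: "U k \<omega> = g2 (X (q k) \<omega>) - 2 * (g (X t \<omega>) * g (X (q k) \<omega>)) + g2 (X t \<omega>)" for k \<omega>
    by (simp add: U_def gg[symmetric] power2_eq_square algebra_simps)
  have iU: "integrable (P x) (U k)" for k
    unfolding Ueq[abs_def]
    by (intro Bochner_Integration.integrable_add Bochner_Integration.integrable_diff integrable_mult_right ig ig2 q0 t)
  have EU: "(LINT \<omega>|P x. U k \<omega>) = (LINT \<omega>|P x. kint g2 (q k - t) (X t \<omega>))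
      - 2 * (LINT \<omega>|P x. g (X t \<omega>) * kint g (q k - t) (X t \<omega>)) + (LINT \<omega>|P x. g2 (X t \<omega>))" for k
  proof -
    have "(LINT \<omega>|P x. U k \<omega>) = (LINT \<omega>|P x. g2 (X (q k) \<omega>))
        - 2 * (LINT \<omega>|P x. g (X t \<omega>) * g (X (q k) \<omega>)) + (LINT \<omega>|P x. g2 (X t \<omega>))"
      unfolding Ueq using ig2[OF q0(1)[of k]] ig[OF q0(1)[of k]] ig2[OF t] by simp
    also have "(LINT \<omega>|P x. g2 (X (q k) \<omega>)) = (LINT \<omega>|P x. kint g2 (q k - t) (X t \<omega>))"
      using markov_integral[OF x t q0(2) g2, of "\<lambda>_. 1" 1 k] by simp
    also have "(LINT \<omega>|P x. g (X t \<omega>) * g (X (q k) \<omega>)) = (LINT \<omega>|P x. g (X t \<omega>) * kint g (q k - t) (X t \<omega>))"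
      by (rule markov_integral[OF x t q0(2) g _ g(2)])
        (rule measurable_compose[OF adapted[OF t order_refl] g(1)])
    finally show ?thesis .
  qed
  have lim1: "(\<lambda>k. kint g (q k - t) (X t \<omega>)) \<longlonglongrightarrow> g (X t \<omega>)"
    and lim2: "(\<lambda>k. kint g2 (q k - t) (X t \<omega>)) \<longlonglongrightarrow> g2 (X t \<omega>)" if "\<omega> \<in> space (P x)" for \<omega>
    unfolding g_def g2_def using that path_state[OF t]
    by (auto intro!: kint_tendsto[OF r q0(3)] f f2 simp: space_P[OF x])
  have L1: "(\<lambda>k. LINT \<omega>|P x. kint g2 (q k - t) (X t \<omega>)) \<longlonglongrightarrow> (LINT \<omega>|P x. g2 (X t \<omega>))"
    by (rule integral_dominated_convergence[where w = "\<lambda>_. K\<^sup>2"])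
      (use kX gX[OF t] kb lim2 in auto)
  have L2: "(\<lambda>k. LINT \<omega>|P x. g (X t \<omega>) * kint g (q k - t) (X t \<omega>)) \<longlonglongrightarrow> (LINT \<omega>|P x. g (X t \<omega>) * g (X t \<omega>))"
  proof (rule integral_dominated_convergence[where w = "\<lambda>_. K * K"])
    show "AE \<omega> in P x. (\<lambda>k. g (X t \<omega>) * kint g (q k - t) (X t \<omega>)) \<longlonglongrightarrow> g (X t \<omega>) * g (X t \<omega>)"
      by (intro AE_I2 tendsto_intros lim1)
    show "AE \<omega> in P x. norm (g (X t \<omega>) * kint g (q k - t) (X t \<omega>)) \<le> K * K" for k
      using kb(1) g(2) K by (intro AE_I2) (auto simp: abs_mult intro!: mult_mono)
  qed (use kX gX[OF t] in auto)
  have "(\<lambda>k. LINT \<omega>|P x. U k \<omega>) \<longlonglongrightarrow> (LINT \<omega>|P x. g2 (X t \<omega>))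
      - 2 * (LINT \<omega>|P x. g (X t \<omega>) * g (X t \<omega>)) + (LINT \<omega>|P x. g2 (X t \<omega>))"
    unfolding EU by (intro tendsto_intros L1 L2)
  then have U0: "(\<lambda>k. LINT \<omega>|P x. norm (U k \<omega>)) \<longlonglongrightarrow> 0"
    by (simp add: gg U_def)
  obtain \<rho> where \<rho>: "strict_mono \<rho>" "AE \<omega> in P x. (\<lambda>k. U (\<rho> k) \<omega>) \<longlonglongrightarrow> 0"
    using tendsto_L1_AE_subseq[OF iU U0] by blast
  from \<rho>(2) AE_good_path[OF x] AE_space show ?thesis
  proof eventually_elim
    case (elim \<omega>)
    have w: "\<omega> \<in> \<Omega>" using elim(3) by (simp add: space_P[OF x])
    have Yw: "Y t \<omega> = regularization (\<lambda>t. X t \<omega>) t"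
      using elim(2) by (simp add: Y_def)
    have lim: "(\<lambda>k. g (X (q k) \<omega>)) \<longlonglongrightarrow> g (Y t \<omega>)"
    proof (cases "\<exists>T\<in>dyadic_times. t < T \<and> X T \<omega> \<noteq> None")
      case False
      then have "X (q k) \<omega> = None" for k
        using q(1,2) by blast
      moreover have "Y t \<omega> = None"
        unfolding Yw regularization_def using False by (rule if_not_P)
      ultimately show ?thesis by simp
    next
      case True
      then obtain T where T: "T \<in> dyadic_times" "t < T" "X T \<omega> \<noteq> None" by blast
      obtain y where y: "y \<in> D" "regularization (\<lambda>t. X t \<omega>) t = Some y"
          "((\<lambda>q. the (X q \<omega>)) \<longlongrightarrow> y) (at t within dyadic_times \<inter> {t<..})"
        by (rule regularization_alive[OF elim(2) path_dyadic_state[OF w] path_dyadic_absorbed[OF w] t T])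
      have "(\<lambda>k. the (X (q k) \<omega>)) \<longlonglongrightarrow> y"
      proof -
        have "\<forall>k. q k \<in> dyadic_times \<inter> {t<..} - {t}"
          using q(1,2) by (auto simp: less_imp_neq)
        then show ?thesis
          using y(3) qt unfolding tendsto_at_iff_sequentially comp_def by blast
      qed
      then have "(\<lambda>k. f (the (X (q k) \<omega>))) \<longlonglongrightarrow> f y"
        using f(1) by (intro continuous_on_tendsto_compose[OF f(1)]) auto
      moreover have "\<forall>\<^sub>F k in sequentially. q k < T"
        using qt T(2) by (rule order_tendstoD(2))
      then have "\<forall>\<^sub>F k in sequentially. f (the (X (q k) \<omega>)) = g (X (q k) \<omega>)"
      proof eventually_elim
        case (elim k)
        then have "X (q k) \<omega> \<noteq> None"
          using path_dyadic_absorbed[OF w q(1)[of k] T(1)] T(3) by auto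
        then show ?case by (auto simp: g_def)
      qed
      ultimately have "(\<lambda>k. g (X (q k) \<omega>)) \<longlonglongrightarrow> f y"
        by (rule Lim_transform_eventually)
      then show ?thesis by (simp add: Yw y(2) g_def)
    qed
    have "(\<lambda>k. U (\<rho> k) \<omega>) \<longlonglongrightarrow> (g (Y t \<omega>) - g (X t \<omega>))\<^sup>2"
      unfolding U_def using LIMSEQ_subseq_LIMSEQ[OF lim \<rho>(1)]
      by (intro tendsto_intros) (simp add: comp_def)
    then have "(g (Y t \<omega>) - g (X t \<omega>))\<^sup>2 = 0"
      using elim(1) LIMSEQ_unique by blast
    then show ?case by (simp add: g_def)
  qed
qed

text \<open>The constant \<open>1\<close> separates the cemetery from \<open>D\<close>, and the functions \<open>arctan (z \<bullet> b)\<close> separate the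
  points of \<open>D\<close>.\<close>

lemma Y_version:
  assumes x: "x \<in> state_cem D" and t: "0 \<le> t"
  shows "AE \<omega> in P x. Y t \<omega> = X t \<omega>"
proof -
  have 1: "AE \<omega> in P x. case_option (0::real) (\<lambda>z. 1) (Y t \<omega>) = case_option 0 (\<lambda>z. 1) (X t \<omega>)"
    by (rule Y_agrees_on_test_functions[OF x t, where K = 1]) auto
  have 2: "AE \<omega> in P x. \<forall>b\<in>Basis. case_option 0 (\<lambda>z. arctan (z \<bullet> b)) (Y t \<omega>) = case_option 0 (\<lambda>z. arctan (z \<bullet> b)) (X t \<omega>)"
    unfolding AE_ball_countable[OF countable_finite[OF finite_Basis]]
  proof
    fix b :: 'v
    show "AE \<omega> in P x. case_option 0 (\<lambda>z. arctan (z \<bullet> b)) (Y t \<omega>) = case_option 0 (\<lambda>z. arctan (z \<bullet> b)) (X t \<omega>)"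
    proof (rule Y_agrees_on_test_functions[OF x t, where K = "pi / 2"])
      show "\<bar>arctan (z \<bullet> b)\<bar> \<le> pi / 2" for z
        using arctan_lbound[of "z \<bullet> b"] arctan_ubound[of "z \<bullet> b"] by (auto simp: abs_le_iff less_imp_le)
    qed (intro continuous_intros)
  qed
  from 1 2 show ?thesis
  proof eventually_elim
    case (elim \<omega>)
    show ?case
    proof (cases "Y t \<omega>")
      case None
      then show ?thesis using elim(1) by (cases "X t \<omega>") auto
    next
      case (Some y)
      then obtain z where z: "X t \<omega> = Some z"
        using elim(1) by (cases "X t \<omega>") auto
      have "y \<bullet> b = z \<bullet> b" if "b \<in> Basis" for b
        using elim(2) that Some z by (auto simp: arctan_eq_iff)
      then have "y = z" by (rule euclidean_eqI)
      then show ?thesis using Some z by simp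
    qed
  qed
qed

end

section \<open>Transfer to the augmented filtration\<close>

lemma integral_completion_AE_eq:
  fixes f g :: "'a \<Rightarrow> 'b::{banach, second_countable_topology}"
  assumes "f \<in> borel_measurable (completion M)" "g \<in> borel_measurable M" "AE \<omega> in M. f \<omega> = g \<omega>"
  shows "integral\<^sup>L (completion M) f = integral\<^sup>L M g"
proof -
  have "integral\<^sup>L (completion M) f = integral\<^sup>L (completion M) g"
    by (rule integral_cong_AE) (use assms AE_completion measurable_completion in auto)
  also have "\<dots> = integral\<^sup>L M g"
    by (rule integral_completion[OF assms(2)])
  finally show ?thesis .
qed

context affine_markov_short_time
begin

abbreviation "\<G> x \<equiv> augmented_filtration D \<Omega> X (P x)"

lemma Y_state: "0 \<le> t \<Longrightarrow> \<omega> \<in> \<Omega> \<Longrightarrow> Y t \<omega> \<in> state_cem D"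
  using Y_cemetery unfolding cemetery_process_def by simp

context
  fixes x :: "'v option"
  assumes x: "x \<in> state_cem D"
begin

lemma sets_F_P: "0 \<le> t \<Longrightarrow> sets (\<F> t) \<subseteq> sets (P x)"
  using subalgebra_P[OF x] by (simp add: subalgebra_def)

lemma augmented_generator:
  assumes "0 \<le> t"
  shows "sets (\<F> t) \<union> null_sets (completion (P x)) \<subseteq> Pow \<Omega>"
  using sets.sets_into_space[of _ "\<F> t"] sets.sets_into_space[of _ "completion (P x)"]
  by (auto simp: space_natural_filtration space_P[OF x])

lemma space_augmented: "0 \<le> t \<Longrightarrow> space (\<G> x t) = \<Omega>"
  unfolding augmented_filtration_def by (rule space_measure_of[OF augmented_generator])

lemma sets_augmented: "0 \<le> t \<Longrightarrow> sets (\<G> x t) = sigma_sets \<Omega> (sets (\<F> t) \<union> null_sets (completion (P x)))"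
  unfolding augmented_filtration_def by (rule sets_measure_of[OF augmented_generator])

lemma sets_augmented_completion: "0 \<le> t \<Longrightarrow> sets (\<G> x t) \<subseteq> sets (completion (P x))"
  unfolding sets_augmented
  using sets.sigma_sets_subset[of "sets (\<F> t) \<union> null_sets (completion (P x))" "completion (P x)"] sets_F_P
  by (auto simp: space_P[OF x])

lemma subalgebra_augmented: "0 \<le> t \<Longrightarrow> subalgebra (completion (P x)) (\<G> x t)"
  using sets_augmented_completion by (simp add: subalgebra_def space_augmented space_P[OF x])

lemma augmented_mono: "0 \<le> s \<Longrightarrow> s \<le> t \<Longrightarrow> sets (\<G> x s) \<subseteq> sets (\<G> x t)"
  using natural_filtration_mono[of s t] by (simp add: sets_augmented) (intro sigma_sets_mono', blast)

lemma augmentedI: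
  assumes t: "0 \<le> t" and B: "B \<in> sets (\<F> t)" and A: "A \<subseteq> \<Omega>"
    and N: "(A - B) \<union> (B - A) \<in> null_sets (completion (P x))"
  shows "A \<in> sets (\<G> x t)"
proof -
  have "A - B \<in> null_sets (completion (P x))" "B - A \<in> null_sets (completion (P x))"
    by (rule null_sets_completion_subset[OF _ N], blast)+
  then have G: "B \<in> sets (\<G> x t)" "A - B \<in> sets (\<G> x t)" "B - A \<in> sets (\<G> x t)"
    using B unfolding sets_augmented[OF t] by (auto intro: sigma_sets.Basic)
  have "(B - (B - A)) \<union> (A - B) \<in> sets (\<G> x t)"
    by (rule sets.Un[OF sets.Diff[OF G(1,3)] G(2)])
  moreover have "(B - (B - A)) \<union> (A - B) = A" by blast
  ultimately show ?thesis by simp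
qed

text \<open>The sets with this approximation property form a \<open>\<sigma>\<close>-algebra.\<close>

lemma augmentedD:
  assumes t: "0 \<le> t" and A: "A \<in> sets (\<G> x t)"
  shows "\<exists>B\<in>sets (\<F> t). (A - B) \<union> (B - A) \<in> null_sets (completion (P x))"
  using A unfolding sets_augmented[OF t]
proof (induction rule: sigma_sets.induct)
  case (Basic A)
  then show ?case
  proof
    assume "A \<in> sets (\<F> t)"
    then show ?thesis by (intro bexI[of _ A]) auto
  next
    assume "A \<in> null_sets (completion (P x))"
    then show ?thesis by (intro bexI[of _ "{}"]) auto
  qed
next
  case Empty
  show ?case by (intro bexI[of _ "{}"]) auto
next
  case (Compl A)
  then obtain B where B: "B \<in> sets (\<F> t)" "(A - B) \<union> (B - A) \<in> null_sets (completion (P x))" by blast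
  have "\<Omega> - B \<in> sets (\<F> t)"
    using sets.compl_sets[OF B(1)] by (simp add: space_natural_filtration)
  moreover have "((\<Omega> - A) - (\<Omega> - B)) \<union> ((\<Omega> - B) - (\<Omega> - A)) \<in> null_sets (completion (P x))"
    by (rule null_sets_completion_subset[OF _ B(2)]) blast
  ultimately show ?case by blast
next
  case (Union A)
  then have "\<forall>i. \<exists>B. B \<in> sets (\<F> t) \<and> (A i - B) \<union> (B - A i) \<in> null_sets (completion (P x))" by blast
  then obtain B where B: "\<And>i. B i \<in> sets (\<F> t)" "\<And>i::nat. (A i - B i) \<union> (B i - A i) \<in> null_sets (completion (P x))"
    by metis
  have "(\<Union>i. (A i - B i) \<union> (B i - A i)) \<in> null_sets (completion (P x))"
    using B(2) by (rule null_sets_UN)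
  then have "((\<Union>i. A i) - (\<Union>i. B i)) \<union> ((\<Union>i. B i) - (\<Union>i. A i)) \<in> null_sets (completion (P x))"
    by (rule null_sets_completion_subset[rotated]) blast
  moreover have "(\<Union>i. B i) \<in> sets (\<F> t)"
    using B(1) by blast
  ultimately show ?case by blast
qed

lemma Y_adapted:
  assumes s: "0 \<le> s" "s \<le> t"
  shows "Y s \<in> measurable (\<G> x t) (state_algebra D)"
proof (rule measurableI)
  have t: "0 \<le> t" using s by simp
  show "Y s \<omega> \<in> space (state_algebra D)" if "\<omega> \<in> space (\<G> x t)" for \<omega>
    using Y_state[OF s(1)] that by (simp add: space_augmented[OF t] space_state_algebra)
  fix A assume A: "A \<in> sets (state_algebra D)"
  obtain N where N: "N \<in> null_sets (P x)" "{\<omega> \<in> space (P x). Y s \<omega> \<noteq> X s \<omega>} \<subseteq> N"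
    using Y_version[OF x s(1)] by (auto simp: eventually_ae_filter)
  show "Y s -` A \<inter> space (\<G> x t) \<in> sets (\<G> x t)"
    unfolding space_augmented[OF t]
  proof (rule augmentedI[OF t])
    show "X s -` A \<inter> \<Omega> \<in> sets (\<F> t)"
      using measurable_sets[OF adapted[OF s] A] by (simp add: space_natural_filtration)
    show "(Y s -` A \<inter> \<Omega> - X s -` A \<inter> \<Omega>) \<union> (X s -` A \<inter> \<Omega> - Y s -` A \<inter> \<Omega>) \<in> null_sets (completion (P x))"
      unfolding null_sets_completion_iff2
    proof (rule bexI[OF _ N(1)])
      show "(Y s -` A \<inter> \<Omega> - X s -` A \<inter> \<Omega>) \<union> (X s -` A \<inter> \<Omega> - Y s -` A \<inter> \<Omega>) \<subseteq> N"
        using N(2) by (auto simp: space_P[OF x])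
    qed
  qed auto
qed

lemma Y_measurable: "0 \<le> t \<Longrightarrow> Y t \<in> measurable (completion (P x)) (state_algebra D)"
  by (rule measurable_from_subalg[OF subalgebra_augmented Y_adapted]) auto

lemma Y_integral:
  fixes f :: "'v option \<Rightarrow> 'b::{banach, second_countable_topology}"
  assumes "0 \<le> t" "f \<in> borel_measurable (state_algebra D)"
  shows "(LINT \<omega>|completion (P x). f (Y t \<omega>)) = (LINT \<omega>|P x. f (X t \<omega>))"
proof (rule integral_completion_AE_eq)
  show "(\<lambda>\<omega>. f (Y t \<omega>)) \<in> borel_measurable (completion (P x))"
    by (rule measurable_compose[OF Y_measurable[OF assms(1)] assms(2)])
  show "(\<lambda>\<omega>. f (X t \<omega>)) \<in> borel_measurable (P x)"
    by (rule measurable_compose[OF X_measurable[OF x assms(1)] assms(2)])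
  show "AE \<omega> in P x. f (Y t \<omega>) = f (X t \<omega>)"
    using Y_version[OF x assms(1)] by eventually_elim simp
qed

lemma natural_filtration_Y: "0 \<le> t \<Longrightarrow> sets (natural_filtration D \<Omega> Y t) \<subseteq> sets (\<G> x t)"
proof -
  assume t: "0 \<le> t"
  have gen: "{Y s -` A \<inter> \<Omega> |s A. 0 \<le> s \<and> s \<le> t \<and> A \<in> sets (state_algebra D)} \<subseteq> sets (\<G> x t)"
  proof clarify
    fix s A assume s: "0 \<le> s" "s \<le> t" and A: "A \<in> sets (state_algebra D)"
    from measurable_sets[OF Y_adapted[OF s] A] show "Y s -` A \<inter> \<Omega> \<in> sets (\<G> x t)"
      by (simp add: space_augmented[OF t])
  qed
  have "sets (natural_filtration D \<Omega> Y t) =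
      sigma_sets \<Omega> {Y s -` A \<inter> \<Omega> |s A. 0 \<le> s \<and> s \<le> t \<and> A \<in> sets (state_algebra D)}"
    unfolding natural_filtration_def by (rule sets_measure_of) auto
  also have "\<dots> \<subseteq> sets (\<G> x t)"
    using sets.sigma_sets_subset[OF gen] by (simp only: space_augmented[OF t])
  finally show ?thesis .
qed

text \<open>An event of the augmented filtration is replaced by one of the natural filtration, and \<open>Y\<close> by \<open>X\<close>;
  then the Markov property of \<open>X\<close> applies.\<close>

lemma Y_conditional_expectation:
  assumes s: "0 \<le> s" and t: "0 \<le> t"
    and f: "f \<in> borel_measurable (state_algebra D)" "\<And>\<xi>. \<xi> \<in> state_cem D \<Longrightarrow> \<bar>f \<xi>\<bar> \<le> K" "f None = 0"
  shows "AE \<omega> in completion (P x). real_cond_exp (completion (P x)) (\<G> x s) (\<lambda>\<omega>'. f (Y (t + s) \<omega>')) \<omega> = kint f t (Y s \<omega>)"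
proof -
  interpret P: prob_space "P x" by (rule prob_space_P[OF x])
  interpret C: prob_space "completion (P x)"
    by (rule P.prob_space_completion)
  interpret finite_measure_subalgebra "completion (P x)" "\<G> x s"
    by (standard) (rule subalgebra_augmented[OF s])
  have st: "0 \<le> t + s" "s \<le> t + s" using s t by auto
  have kf: "kint f t \<in> borel_measurable (state_algebra D)"
    by (rule kint_measurable[OF t f(1)])
  have m1: "(\<lambda>\<omega>. f (Y (t + s) \<omega>)) \<in> borel_measurable (completion (P x))"
    by (rule measurable_compose[OF Y_measurable[OF st(1)] f(1)])
  have m2: "(\<lambda>\<omega>. kint f t (Y s \<omega>)) \<in> borel_measurable (\<G> x s)"
    by (rule measurable_compose[OF Y_adapted[OF s order_refl] kf])
  have m2': "(\<lambda>\<omega>. kint f t (Y s \<omega>)) \<in> borel_measurable (completion (P x))"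
    by (rule measurable_compose[OF Y_measurable[OF s] kf])
  show ?thesis
  proof (rule real_cond_exp_charact)
    show "integrable (completion (P x)) (\<lambda>\<omega>. f (Y (t + s) \<omega>))"
      by (rule C.integrable_const_bound[where B = K])
        (use m1 f(2) Y_state st in \<open>auto intro!: AE_I2 simp: space_P[OF x]\<close>)
    show "integrable (completion (P x)) (\<lambda>\<omega>. kint f t (Y s \<omega>))"
      by (rule C.integrable_const_bound[where B = K])
        (use m2' kint_bound[OF t f(1,2)] Y_state s in \<open>auto intro!: AE_I2 simp: space_P[OF x]\<close>)
    show "(\<lambda>\<omega>. kint f t (Y s \<omega>)) \<in> borel_measurable (\<G> x s)" by (rule m2)
    fix A assume A: "A \<in> sets (\<G> x s)"
    then obtain B where B: "B \<in> sets (\<F> s)" "(A - B) \<union> (B - A) \<in> null_sets (completion (P x))"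
      using augmentedD[OF s] by blast
    have AC: "A \<in> sets (completion (P x))" using A sets_augmented_completion[OF s] by blast
    have BP: "B \<in> sets (P x)" using B(1) sets_F_P[OF s] by blast
    have AB: "AE \<omega> in P x. indicator A \<omega> = (indicator B \<omega> :: real)"
    proof -
      have "AE \<omega> in completion (P x). \<omega> \<notin> (A - B) \<union> (B - A)"
        by (rule AE_not_in[OF B(2)])
      then have "AE \<omega> in P x. \<omega> \<notin> (A - B) \<union> (B - A)"
        by (simp only: AE_completion_iff)
      then show ?thesis
        by eventually_elim (auto simp: indicator_def)
    qed
    have "(\<integral>\<omega>\<in>A. f (Y (t + s) \<omega>) \<partial>completion (P x)) = (LINT \<omega>|P x. indicator B \<omega> * f (X (t + s) \<omega>))"
      unfolding set_lebesgue_integral_def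
    proof (rule integral_completion_AE_eq)
      show "AE \<omega> in P x. indicator A \<omega> *\<^sub>R f (Y (t + s) \<omega>) = indicator B \<omega> * f (X (t + s) \<omega>)"
        using AB Y_version[OF x st(1)] by eventually_elim simp
      show "(\<lambda>\<omega>. indicator B \<omega> * f (X (t + s) \<omega>)) \<in> borel_measurable (P x)"
        by (intro borel_measurable_times borel_measurable_indicator BP measurable_compose[OF X_measurable[OF x st(1)] f(1)])
    qed (use AC m1 in auto)
    also have "\<dots> = (LINT \<omega>|P x. indicator B \<omega> * kint f t (X s \<omega>))"
    proof -
      have "(LINT \<omega>|P x. indicator B \<omega> * f (X (t + s) \<omega>)) = (LINT \<omega>|P x. indicator B \<omega> * kint f (t + s - s) (X s \<omega>))"
        by (rule markov_integral[OF x s st(2) f, where L = 1]) (use B(1) in \<open>auto simp: indicator_def\<close>)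
      then show ?thesis by simp
    qed
    also have "\<dots> = (\<integral>\<omega>\<in>A. kint f t (Y s \<omega>) \<partial>completion (P x))"
      unfolding set_lebesgue_integral_def
    proof (rule integral_completion_AE_eq[symmetric])
      show "AE \<omega> in P x. indicator A \<omega> *\<^sub>R kint f t (Y s \<omega>) = indicator B \<omega> * kint f t (X s \<omega>)"
        using AB Y_version[OF x s] by eventually_elim simp
      show "(\<lambda>\<omega>. indicator B \<omega> * kint f t (X s \<omega>)) \<in> borel_measurable (P x)"
        by (intro borel_measurable_times borel_measurable_indicator BP measurable_compose[OF X_measurable[OF x s] kf])
    qed (use AC m2' in auto)
    finally show "(\<integral>\<omega>\<in>A. f (Y (t + s) \<omega>) \<partial>completion (P x)) = (\<integral>\<omega>\<in>A. kint f t (Y s \<omega>) \<partial>completion (P x))" .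
  qed
qed

end

lemma Y_transition:
  fixes f :: "'v option \<Rightarrow> real"
  assumes x: "x \<in> state_cem D" and s: "0 \<le> s" and t: "0 \<le> t"
    and f: "f \<in> borel_measurable (state_algebra D)" "bounded (f ` state_cem D)" "f None = 0"
  shows "AE \<omega> in completion (P x). (LINT \<omega>'|completion (P (Y s \<omega>)). f (Y t \<omega>')) = (LINT \<xi>:Some ` D|p t (Y s \<omega>). f \<xi>)"
proof (rule AE_completion)
  have "AE \<omega> in P x. (LINT \<omega>'|P (X s \<omega>). f (X t \<omega>')) = (LINT \<xi>:Some ` D|p t (X s \<omega>). f \<xi>)"
    using markov_conditional s t x f by (auto elim!: AE_mp)
  then show "AE \<omega> in P x. (LINT \<omega>'|completion (P (Y s \<omega>)). f (Y t \<omega>')) = (LINT \<xi>:Some ` D|p t (Y s \<omega>). f \<xi>)"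
    using Y_version[OF x s] AE_space
  proof eventually_elim
    case (elim \<omega>)
    have "\<omega> \<in> \<Omega>"
      using elim(3) by (simp add: space_P[OF x])
    then have "Y s \<omega> \<in> state_cem D"
      by (rule Y_state[OF s])
    from Y_integral[OF this t f(1)] elim show ?case by simp
  qed
qed

lemma Y_markov: "markov_process D \<Omega> (\<lambda>x. completion (P x)) \<G> p Y"
  unfolding markov_process_def
proof (intro conjI ballI allI impI)
  show "cemetery_process D \<Omega> Y" by (rule Y_cemetery)
  show "transition_function D p" by (rule transition)
next
  fix x assume x: "x \<in> state_cem D"
  show "prob_space (completion (P x))"
    using prob_space.prob_space_completion[OF prob_space_P[OF x]] .
  show "space (completion (P x)) = \<Omega>" by (simp add: space_P[OF x])
next
  fix x t assume x: "x \<in> state_cem D" and t: "0 \<le> (t :: real)"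
  show "subalgebra (completion (P x)) (\<G> x t)" by (rule subalgebra_augmented[OF x t])
  show "sets (natural_filtration D \<Omega> Y t) \<subseteq> sets (\<G> x t)" by (rule natural_filtration_Y[OF x t])
  fix s assume "s \<in> {0..t}"
  then show "sets (\<G> x s) \<subseteq> sets (\<G> x t)" by (intro augmented_mono[OF x]) auto
next
  fix s t :: real and x and f :: "'v option \<Rightarrow> real"
  assume s: "0 \<le> s" and t: "0 \<le> t" and x: "x \<in> state_cem D" and f: "f \<in> borel_measurable (state_algebra D)"
    and bd: "bounded (f ` state_cem D) \<and> f None = 0"
  then obtain K where K: "\<And>\<xi>. \<xi> \<in> state_cem D \<Longrightarrow> \<bar>f \<xi>\<bar> \<le> K"
    by (auto simp: bounded_iff)
  have "AE \<omega> in completion (P x). real_cond_exp (completion (P x)) (\<G> x s) (\<lambda>\<omega>'. f (Y (t + s) \<omega>')) \<omega> = kint f t (Y s \<omega>)"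
    by (rule Y_conditional_expectation[OF x s t f K]) (use bd in auto)
  moreover have "AE \<omega> in completion (P x). (LINT \<omega>'|completion (P (Y s \<omega>)). f (Y t \<omega>')) = (LINT \<xi>:Some ` D|p t (Y s \<omega>). f \<xi>)"
    using bd by (intro Y_transition[OF x s t f]) auto
  ultimately show "AE \<omega> in completion (P x).
           real_cond_exp (completion (P x)) (\<G> x s) (\<lambda>\<omega>'. f (Y (t + s) \<omega>')) \<omega>
             = (LINT \<omega>'|completion (P (Y s \<omega>)). f (Y t \<omega>')) \<and>
           (LINT \<omega>'|completion (P (Y s \<omega>)). f (Y t \<omega>')) = (LINT \<xi>:Some ` D|p t (Y s \<omega>). f \<xi>)"
    using AE_space
  proof eventually_elim
    case (elim \<omega>)
    have "\<omega> \<in> \<Omega>"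
      using elim(3) by (simp add: space_P[OF x])
    then have "Y s \<omega> \<in> state_cem D"
      by (rule Y_state[OF s])
    from kernel_set_integral[where f = f, OF t this] bd elim show ?case
      by (simp add: kint_def)
  qed
qed

end

lemma exp_fun_measurable_gen:
  fixes D :: "'v::euclidean_space set"
  assumes "closed D"
  shows "exp_fun u \<in> borel_measurable (state_algebra D)"
  unfolding exp_fun_def
proof (rule measurable_case_option_state[OF assms])
  have "cpair u = (\<lambda>x. of_real (fst u \<bullet> x) + \<i> * of_real (snd u \<bullet> x))"
    by (auto simp: cpair_def complex_eq_iff)
  then show "(\<lambda>x. exp (cpair u x)) \<in> borel_measurable borel"
    by (auto intro!: borel_measurable_continuous_onI continuous_intros)
qed

theorem corollary3p11:
  fixes D :: "'v::euclidean_space set" and \<Omega> :: "'w set"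
    and P :: "'v option \<Rightarrow> 'w measure" and X :: "real \<Rightarrow> 'w \<Rightarrow> 'v option"
  assumes "closed D" and "D \<noteq> {}"
    and "\<exists>S\<subseteq>D. card S = DIM('v) + 1 \<and> \<not> affine_dependent S"
    and "\<forall>x\<in>state_cem D. prob_space (P x) \<and> sets (P x) = sets (natural_algebra D \<Omega> X)"
    and "affine_process D \<Omega> P (\<lambda>x. natural_filtration D \<Omega> X) X"
  shows "\<exists>Y :: real \<Rightarrow> 'w \<Rightarrow> 'v option.
    affine_process D \<Omega> (\<lambda>x. completion (P x)) (\<lambda>x. augmented_filtration D \<Omega> X (P x)) Y \<and>
    (\<forall>\<omega>\<in>\<Omega>. cadlag D (\<lambda>t. Y t \<omega>)) \<and>
    (\<forall>x\<in>state_cem D.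
       version_of (P x) Y X \<and>
       (AE \<omega> in P x. killed_at_infinity D (\<lambda>t. Y t \<omega>)))"
proof -
  obtain p where markov: "markov_process D \<Omega> P (\<lambda>x. natural_filtration D \<Omega> X) p X"
    and stoch: "stochastically_continuous D p" and aff: "affine_transform D P p X"
    using assms(5) unfolding affine_process_def by blast
  obtain \<Phi> :: "real \<Rightarrow> 'v \<times> 'v \<Rightarrow> complex" and \<psi> :: "real \<Rightarrow> 'v \<times> 'v \<Rightarrow> 'v \<times> 'v"
    where cont: "\<forall>x\<in>D. \<forall>m\<ge>1. locally_continuous_on (nonvanishing_set D \<Phi> m) (\<lambda>(t, u). cpair (\<psi> t u) x)"
    and trans: "\<forall>x\<in>D. \<forall>t\<ge>0. \<forall>u\<in>bdd_exponents D.
           (LINT \<omega>|P (Some x). exp_fun u (X t \<omega>)) = (LINT \<xi>:Some ` D|p t (Some x). exp_fun u \<xi>) \<and>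
           (LINT \<xi>:Some ` D|p t (Some x). exp_fun u \<xi>) = \<Phi> t u * exp (cpair (\<psi> t u) x)"
    using aff unfolding affine_transform_def by (elim exE conjE)
  have tf: "transition_function D p"
    using markov unfolding markov_process_def by (elim conjE)
  interpret affine_markov D p \<Phi> \<psi> \<Omega> P X
    by unfold_locales (use assms tf stoch cont trans markov in auto)
  obtain x0 where x0: "x0 \<in> D" using assms(2) by blast
  obtain h1 where h1: "0 < h1" "\<forall>h\<in>{0..h1}. \<forall>v\<in>cball 0 1. norm (cf h v (Some x0) - cis (v \<bullet> x0)) \<le> 1 / 16"
    using short_time_bound[OF x0] by blast
  interpret affine_markov_short_time D p \<Phi> \<psi> \<Omega> P X x0 h1
    by unfold_locales (use x0 h1 in auto)
  have "affine_transform D (\<lambda>x. completion (P x)) p Y"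
    unfolding affine_transform_def
  proof (intro exI[of _ \<Phi>] exI[of _ \<psi>] conjI cont ballI allI impI)
    fix x t u assume x: "x \<in> D" and t: "0 \<le> (t::real)" and u: "u \<in> bdd_exponents D"
    have "(LINT \<omega>|completion (P (Some x)). exp_fun u (Y t \<omega>)) = (LINT \<omega>|P (Some x). exp_fun u (X t \<omega>))"
      by (rule Y_integral) (use x t exp_fun_measurable_gen[OF assms(1)] in \<open>auto simp: Some_in_state\<close>)
    then show "(LINT \<omega>|completion (P (Some x)). exp_fun u (Y t \<omega>)) = (LINT \<xi>:Some ` D|p t (Some x). exp_fun u \<xi>)"
      "(LINT \<xi>:Some ` D|p t (Some x). exp_fun u \<xi>) = \<Phi> t u * exp (cpair (\<psi> t u) x)"
      using trans x t u by auto
  qed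
  then have "affine_process D \<Omega> (\<lambda>x. completion (P x)) (\<lambda>x. augmented_filtration D \<Omega> X (P x)) Y"
    unfolding affine_process_def using Y_markov stoch by blast
  moreover have "AE \<omega> in P x. killed_at_infinity D (\<lambda>t. Y t \<omega>)" if "x \<in> state_cem D" for x
    using Y_killed space_P[OF that] by (intro AE_I2) auto
  ultimately show ?thesis
    using Y_cadlag Y_version unfolding version_of_def by blast
qed

end
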